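(* Let $s\ge 0$. Let $r\ge 1$ and let $\mathcal L$ be the Fourier multiplier operator on $\mathbb T^2$ with symbol $b:\mathbb Z^2\to\mathbb R$ satisfying $|b(\mathbf k)|\le C|\mathbf k|^{r-1}$ for all $\mathbf k\in\mathbb Z^2$ with $|\mathbf k|\ge N_0$, for some constants $C>0$, $N_0\ge 0$. Put $\lambda_{\mathbf k}=k_1 b(\mathbf k)$ for $\mathbf k=(k_1,k_2)\in\mathbb Z^2$, so that $\partial_x\mathcal L\psi_{\mathbf k}=i\lambda_{\mathbf k}\psi_{\mathbf k}$ for all $\mathbf k\in\mathbb Z^2$. Assume: (i) for all $(k_1,k_2)\in\mathbb Z^2$, $\lambda_{(-k_1,k_2)}=\lambda_{(k_1,k_2)}$ and $\lambda_{(k_1,-k_2)}=-\lambda_{(k_1,k_2)}$; (ii) for all $(k_1,k_2)\in\mathbb Z^2$ with $k_1\ne 0$, the unique solution $j_2\in\mathbb Z$ of $\lambda_{(k_1,j_2)}=\lambda_{(k_1,k_2)}$ is $j_2=k_2$; (iii) for all $(k_1,k_2)\in\mathbb Z^2$ with $k_2\neq 0$, the only solutions $j_1\in\mathbb Z$ of $\lambda_{(j_1,k_2)}=\lambda_{(k_1,k_2)}$ are $j_1=\pm k_1$. Let $\mathbb J\subset\mathbb Z^2$ be a maximal subset such that $\lambda_{\mathbf k}\ne\lambda_{\mathbf k'}$ for all $\mathbf k,\mathbf k'\in\mathbb J$ with $\mathbf k\ne\mathbf k'$. Suppose that $$\gamma:=\inf_{\mathbf k,\mathbf k'\in\mathbb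 J,\ \mathbf k\ne\mathbf k'}|\lambda_{\mathbf k}-\lambda_{\mathbf k'}|>0,$$ and define $$\gamma':=\sup_{S\subset\mathbb J,\ S\text{ finite}}\ \ \inf_{\mathbf k,\mathbf k'\in\mathbb J\setminus S,\ \mathbf k\ne\mathbf k'}|\lambda_{\mathbf k}-\lambda_{\mathbf k'}|.$$ Then, for any $T>\frac{2\pi}{\gamma'}$ and for each $u_0,u_1\in H^s_p(\mathbb T^2)$ with $\widehat{u_0}(0,0)=\widehat{u_1}(0,0)$, there exists a function $h\in L^2([0,T];H^s_p(\mathbb T^2))$ such that the unique solution $u$ of $$u\in C([0,T];H^s_p(\mathbb T^2)),\qquad \partial_t u=\partial_x\mathcal L u+G(h)(t)\in H^{s-r}_p(\mathbb T^2),\ t\in(0,T),\qquad u(0)=u_0,$$ satisfies $u(T)=u_1$. Furthermore, $$\|h\|_{L^2([0,T];H^s_p(\mathbb T^2))}\le \nu\left(\|u_0\|_{H^s_p(\mathbb T^2)}+\|u_1\|_{H^s_p(\mathbb T^2)}\right)$$ for some positive constant $\nu\equiv\nu(s,g_1,T)$.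
   Context: $\mathbb T=\mathbb R/2\pi\mathbb Z$, $\mathbb T^2=\mathbb R^2/(2\pi\mathbb Z)^2$, $\mathbf k=(k_1,k_2)$, $|\mathbf k|=\sqrt{k_1^2+k_2^2}$. For a distribution $u$ on $\mathbb T^2$, $\widehat u(\mathbf k)=\frac1{(2\pi)^2}\langle u,e^{-i\mathbf k\cdot\mathbf x}\rangle$; for functions on $\mathbb T$, $\widehat g(k)=\frac1{2\pi}\int_0^{2\pi}g(x)e^{-ikx}dx$. $H^s_p(\mathbb T^2)$ is the space of distributions $u$ on $\mathbb T^2$ with $\|u\|^2_{H^s_p(\mathbb T^2)}=(2\pi)^2\sum_{\mathbf k\in\mathbb Z^2}(1+|\mathbf k|)^{2s}|\widehat u(\mathbf k)|^2<\infty$. $\psi_{\mathbf k}(\mathbf x)=\frac1{2\pi}e^{i\mathbf k\cdot\mathbf x}$, $\mathbf x=(x,y)\in\mathbb T^2$. The operator $\mathcal L$ is defined by $\widehat{\mathcal Lu}(\mathbf k)=b(\mathbf k)\widehat u(\mathbf k)$. The functions $g_1,g_2\in C^\infty(\mathbb T)$ are fixed, non-negative, real-valued, with $\int_{\mathbb T}g_1(x)dx=1=\int_{\mathbb T}g_2(y)dy$, and such that $\omega_1=\{x\in\mathbb T: g_1(x)>0\}$ and $\omega_2=\{y\in\mathbb T:g_2(y)>0\}$ are open intervals, with $\operatorname{supp}g_i=\overline{\omega_i}$. The operator $G:H^s_p(\mathbb T^2)\to H^s_p(\mathbb T^2)$, $s\ge0$, is $$G(\phi)(x,y)=g_2(y)\,G_1(\phi)(x,y)+g_1(x)\,G_2(\phi)(x,y),$$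 $$G_1(\phi)(x,y)=\tfrac1{2\pi}\phi(x,y)-\tfrac1{(2\pi)^2}\int_0^{2\pi}\phi(x',y)dx',\qquad G_2(\phi)(x,y)=\tfrac1{2\pi}\phi(x,y)-\tfrac1{(2\pi)^2}\int_0^{2\pi}\phi(x,y')dy'.$$ It is applied to $h$ for each fixed $t$. Solutions of the non-homogeneous problem are understood in the mild sense: $u(t)=U(t)u_0+\int_0^tU(t-t')Gh(t')dt'$, where $U(t)$ is the unitary group given by $\widehat{U(t)\varphi}(\mathbf k)=e^{ik_1b(\mathbf k)t}\widehat\varphi(\mathbf k)$. If $\gamma'=+\infty$, the condition $T>2\pi/\gamma'$ means $T>0$. The constant $\nu$ does not depend on $u_0,u_1$ (the operator $\mathcal L$ being fixed). *)

theory Defs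
  imports "HOL-Analysis.Analysis"
begin

section \<open>Smooth functions and distributions on the torus\<close>

text \<open>Functions on the circle and on the two-dimensional torus are functions on the line and on
  the plane that are periodic with period \<open>2 * pi\<close> in each variable.\<close>

definition partial_x :: "(real \<times> real \<Rightarrow> complex) \<Rightarrow> real \<times> real \<Rightarrow> complex" where
  "partial_x f = (\<lambda>(x, y). vector_derivative (\<lambda>t. f (t, y)) (at x))"

definition partial_y :: "(real \<times> real \<Rightarrow> complex) \<Rightarrow> real \<times> real \<Rightarrow> complex" where
  "partial_y f = (\<lambda>(x, y). vector_derivative (\<lambda>t. f (x, t)) (at y))"

definition mixed_partial :: "nat \<Rightarrow> nat \<Rightarrow> (real \<times> real \<Rightarrow> complex) \<Rightarrow> real \<times> real \<Rightarrow> complex" where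
  "mixed_partial i j f = (partial_x ^^ i) ((partial_y ^^ j) f)"

definition torus_periodic :: "(real \<times> real \<Rightarrow> complex) \<Rightarrow> bool" where
  "torus_periodic f \<longleftrightarrow> (\<forall>x y. f (x + 2 * pi, y) = f (x, y) \<and> f (x, y + 2 * pi) = f (x, y))"

text \<open>If every \<open>mixed_partial i j f\<close> is (Frechet) differentiable, then all first-order partials of
  these functions are continuous and, by the theorem on equality of mixed derivatives, the order of
  differentiation is immaterial. So this is the space of smooth functions on the torus.\<close>

definition test_function :: "(real \<times> real \<Rightarrow> complex) \<Rightarrow> bool" where
  "test_function f \<longleftrightarrow> torus_periodic f \<and> (\<forall>i j p. mixed_partial i j f differentiable (at p))"

text \<open>Convergence in the Frechet space of smooth functions.\<close>

definition test_tendsto ::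
  "(nat \<Rightarrow> real \<times> real \<Rightarrow> complex) \<Rightarrow> (real \<times> real \<Rightarrow> complex) \<Rightarrow> bool" where
  "test_tendsto F f \<longleftrightarrow>
     (\<forall>i j. uniform_limit UNIV (\<lambda>n. mixed_partial i j (F n)) (mixed_partial i j f) sequentially)"

text \<open>Distributions are the continuous complex-linear functionals on test functions; sequential
  continuity suffices because the space of test functions is metrizable. Outside the test functions
  a functional is set to zero, so that equality of distributions is equality on test functions.\<close>

definition is_distribution :: "((real \<times> real \<Rightarrow> complex) \<Rightarrow> complex) \<Rightarrow> bool" where
  "is_distribution u \<longleftrightarrow>
     (\<forall>f g. test_function f \<longrightarrow> test_function g \<longrightarrow> u (\<lambda>p. f p + g p) = u f + u g) \<and>
     (\<forall>c f. test_function f \<longrightarrow> u (\<lambda>p. c * f p) = c * u f) \<and>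
     (\<forall>F f. (\<forall>n. test_function (F n)) \<longrightarrow> test_function f \<longrightarrow> test_tendsto F f
        \<longrightarrow> (\<lambda>n. u (F n)) \<longlonglongrightarrow> u f) \<and>
     (\<forall>f. \<not> test_function f \<longrightarrow> u f = 0)"

typedef torus_distribution = "{u. is_distribution u}"
  morphisms pairing Abs_torus_distribution
proof
  show "(\<lambda>_. 0) \<in> {u. is_distribution u}"
    by (simp add: is_distribution_def)
qed

lemma is_distribution_pairing: "is_distribution (pairing u)"
  using pairing[of u] by simp

lemma is_distribution_zero: "is_distribution (\<lambda>_. 0)"
  by (simp add: is_distribution_def)

lemma is_distribution_add:
  assumes "is_distribution u" "is_distribution v"
  shows "is_distribution (\<lambda>f. u f + v f)"
  using assms unfolding is_distribution_def
  by (auto simp: algebra_simps intro!: tendsto_add)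

lemma is_distribution_scale:
  assumes "is_distribution u"
  shows "is_distribution (\<lambda>f. r *\<^sub>R u f)"
  using assms unfolding is_distribution_def
  by (auto simp: algebra_simps intro!: tendsto_scaleR)

instantiation torus_distribution :: real_vector
begin

definition "0 = Abs_torus_distribution (\<lambda>_. 0)"
definition "u + v = Abs_torus_distribution (\<lambda>f. pairing u f + pairing v f)"
definition "r *\<^sub>R u = Abs_torus_distribution (\<lambda>f. r *\<^sub>R pairing u f)"
definition "- u = (-1) *\<^sub>R (u :: torus_distribution)"
definition "u - v = u + - (v :: torus_distribution)"

lemma pairing_zero: "pairing 0 f = 0"
  by (simp add: zero_torus_distribution_def Abs_torus_distribution_inverse is_distribution_zero)

lemma pairing_add: "pairing (u + v) f = pairing u f + pairing v f"
  by (simp add: plus_torus_distribution_def Abs_torus_distribution_inverse is_distribution_add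
      is_distribution_pairing)

lemma pairing_scaleR: "pairing (r *\<^sub>R u) f = r *\<^sub>R pairing u f"
  by (simp add: scaleR_torus_distribution_def Abs_torus_distribution_inverse is_distribution_scale
      is_distribution_pairing)

lemma pairing_uminus: "pairing (- u) f = - pairing u f"
  by (simp add: uminus_torus_distribution_def pairing_scaleR)

lemma pairing_diff: "pairing (u - v) f = pairing u f - pairing v f"
  by (simp add: minus_torus_distribution_def pairing_add pairing_uminus)

instance
  by standard
    (auto simp: pairing_inject[symmetric] fun_eq_iff pairing_zero pairing_add pairing_scaleR
      pairing_uminus pairing_diff algebra_simps)

end

section \<open>Fourier coefficients, Sobolev spaces and Fourier multipliers\<close>

definition fourier_coeff :: "torus_distribution \<Rightarrow> int \<times> int \<Rightarrow> complex" where
  "fourier_coeff u k = pairing u (\<lambda>(x, y). exp (- \<i> * of_real (of_int (fst k) * x + of_int (snd k) * y)))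
     / of_real ((2 * pi)\<^sup>2)"

definition freq_abs :: "int \<times> int \<Rightarrow> real" where
  "freq_abs k = sqrt ((of_int (fst k))\<^sup>2 + (of_int (snd k))\<^sup>2)"

definition sobolev :: "real \<Rightarrow> torus_distribution set" where
  "sobolev s = {u. (\<lambda>k. (1 + freq_abs k) powr (2 * s) * (cmod (fourier_coeff u k))\<^sup>2) summable_on UNIV}"

definition sobolev_norm :: "real \<Rightarrow> torus_distribution \<Rightarrow> real" where
  "sobolev_norm s u = sqrt ((2 * pi)\<^sup>2 *
     (\<Sum>\<^sub>\<infinity>k. (1 + freq_abs k) powr (2 * s) * (cmod (fourier_coeff u k))\<^sup>2))"

text \<open>A distribution is determined by its Fourier coefficients. The description below denotes the
  expected distribution whenever there is one with the prescribed coefficients, which is the case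
  for every distribution \<open>u\<close> if \<open>m\<close> has at most polynomial growth.\<close>

definition fourier_multiplier ::
  "(int \<times> int \<Rightarrow> complex) \<Rightarrow> torus_distribution \<Rightarrow> torus_distribution" where
  "fourier_multiplier m u = (THE v. \<forall>k. fourier_coeff v k = m k * fourier_coeff u k)"

section \<open>Functions of time with values in Sobolev spaces\<close>

text \<open>The library's Bochner integral needs the target to be a type of class \<open>banach\<close>, but
  the Sobolev spaces form a family of sets indexed by a real number. The next three definitions
  spell out strong measurability and the Bochner integral with respect to \<open>sobolev_norm s\<close>;
  they are meant for finite measures, where every simple function is integrable.\<close>

definition sobolev_simple :: "real \<Rightarrow> 'a measure \<Rightarrow> ('a \<Rightarrow> torus_distribution) \<Rightarrow> bool" where
  "sobolev_simple s M f \<longleftrightarrow> simple_function M f \<and> f ` space M \<subseteq> sobolev s"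

definition sobolev_measurable :: "real \<Rightarrow> 'a measure \<Rightarrow> ('a \<Rightarrow> torus_distribution) \<Rightarrow> bool" where
  "sobolev_measurable s M f \<longleftrightarrow> f ` space M \<subseteq> sobolev s \<and>
     (\<exists>S. (\<forall>n. sobolev_simple s M (S n)) \<and>
          (AE t in M. (\<lambda>n. sobolev_norm s (f t - S n t)) \<longlonglongrightarrow> 0))"

definition has_sobolev_integral ::
  "real \<Rightarrow> 'a measure \<Rightarrow> ('a \<Rightarrow> torus_distribution) \<Rightarrow> torus_distribution \<Rightarrow> bool" where
  "has_sobolev_integral s M f v \<longleftrightarrow> sobolev_measurable s M f \<and> v \<in> sobolev s \<and>
     (\<exists>S. (\<forall>n. sobolev_simple s M (S n)) \<and>
          (\<lambda>n. \<integral>\<^sup>+ t. ennreal (sobolev_norm s (f t - S n t)) \<partial>M) \<longlonglongrightarrow> 0 \<and>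
          (\<lambda>n. sobolev_norm s (Bochner_Integration.simple_bochner_integral M (S n) - v)) \<longlonglongrightarrow> 0)"

definition L2_sobolev :: "real \<Rightarrow> real \<Rightarrow> (real \<Rightarrow> torus_distribution) set" where
  "L2_sobolev s T = {h. sobolev_measurable s (lebesgue_on {0..T}) h \<and>
     (\<integral>\<^sup>+ t. ennreal ((sobolev_norm s (h t))\<^sup>2) \<partial>lebesgue_on {0..T}) < \<infinity>}"

definition L2_sobolev_norm :: "real \<Rightarrow> real \<Rightarrow> (real \<Rightarrow> torus_distribution) \<Rightarrow> real" where
  "L2_sobolev_norm s T h = sqrt (\<integral> t. (sobolev_norm s (h t))\<^sup>2 \<partial>lebesgue_on {0..T})"

definition C_sobolev :: "real \<Rightarrow> real \<Rightarrow> (real \<Rightarrow> torus_distribution) set" where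
  "C_sobolev s T = {u. \<forall>t\<in>{0..T}. u t \<in> sobolev s \<and>
     ((\<lambda>t'. sobolev_norm s (u t' - u t)) \<longlongrightarrow> 0) (at t within {0..T})}"

section \<open>The control operator\<close>

text \<open>The set where \<open>g\<close> is positive is an open arc of the circle: modulo the period it is
  the interval from \<open>a\<close> to \<open>b\<close>.\<close>

definition control_profile :: "(real \<Rightarrow> real) \<Rightarrow> bool" where
  "control_profile g \<longleftrightarrow>
     (\<forall>n x. (deriv ^^ n) g differentiable (at x)) \<and>
     (\<forall>x. g (x + 2 * pi) = g x) \<and>
     (\<forall>x. 0 \<le> g x) \<and>
     (LBINT x:{0..2 * pi}. g x) = 1 \<and>
     (\<exists>a b. a < b \<and> b \<le> a + 2 * pi \<and>
        {x. 0 < g x} = {x. \<exists>n::int. a < x + 2 * pi * of_int n \<and> x + 2 * pi * of_int n < b}) \<and>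
     closure {x. g x \<noteq> 0} = closure {x. 0 < g x}"

definition represents :: "(real \<times> real \<Rightarrow> complex) \<Rightarrow> torus_distribution \<Rightarrow> bool" where
  "represents f u \<longleftrightarrow> torus_periodic f \<and> set_integrable lborel ({0..2 * pi} \<times> {0..2 * pi}) f \<and>
     (\<forall>\<theta>. test_function \<theta> \<longrightarrow> pairing u \<theta> = (LINT p:({0..2 * pi} \<times> {0..2 * pi})|lborel. f p * \<theta> p))"

definition G1_fun :: "(real \<times> real \<Rightarrow> complex) \<Rightarrow> real \<times> real \<Rightarrow> complex" where
  "G1_fun \<phi> = (\<lambda>(x, y). of_real (1 / (2 * pi)) * \<phi> (x, y)
     - of_real (1 / (2 * pi)\<^sup>2) * (LINT x':{0..2 * pi}|lborel. \<phi> (x', y)))"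

definition G2_fun :: "(real \<times> real \<Rightarrow> complex) \<Rightarrow> real \<times> real \<Rightarrow> complex" where
  "G2_fun \<phi> = (\<lambda>(x, y). of_real (1 / (2 * pi)) * \<phi> (x, y)
     - of_real (1 / (2 * pi)\<^sup>2) * (LINT y':{0..2 * pi}|lborel. \<phi> (x, y')))"

definition G_fun ::
  "(real \<Rightarrow> real) \<Rightarrow> (real \<Rightarrow> real) \<Rightarrow> (real \<times> real \<Rightarrow> complex) \<Rightarrow> real \<times> real \<Rightarrow> complex" where
  "G_fun g\<^sub>1 g\<^sub>2 \<phi> = (\<lambda>(x, y). of_real (g\<^sub>2 y) * G1_fun \<phi> (x, y) + of_real (g\<^sub>1 x) * G2_fun \<phi> (x, y))"

text \<open>For \<open>s \<ge> 0\<close> every element of \<open>sobolev s\<close> is represented by a square-integrable function,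
  unique almost everywhere, and the operator acts on that function.\<close>

definition G_op ::
  "(real \<Rightarrow> real) \<Rightarrow> (real \<Rightarrow> real) \<Rightarrow> torus_distribution \<Rightarrow> torus_distribution" where
  "G_op g\<^sub>1 g\<^sub>2 \<phi> = (THE v. \<exists>f. represents f \<phi> \<and> represents (G_fun g\<^sub>1 g\<^sub>2 f) v)"

section \<open>The control problem\<close>

text \<open>Here \<open>b\<close> is the symbol of the Fourier multiplier operator \<open>L\<close>, so that
  \<open>\<i> * eigenfreq b k\<close> is the eigenvalue of the \<open>x\<close>-derivative of \<open>L\<close> on the mode
  \<open>k\<close>, and \<open>propagator b\<close> is the unitary group which that operator generates.
  Solutions of the inhomogeneous equation are mild solutions.\<close>

definition eigenfreq :: "(int \<times> int \<Rightarrow> real) \<Rightarrow> int \<times> int \<Rightarrow> real" where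
  "eigenfreq b k = of_int (fst k) * b k"

definition propagator ::
  "(int \<times> int \<Rightarrow> real) \<Rightarrow> real \<Rightarrow> torus_distribution \<Rightarrow> torus_distribution" where
  "propagator b t = fourier_multiplier (\<lambda>k. exp (\<i> * of_real (eigenfreq b k * t)))"

definition mild_solution ::
  "real \<Rightarrow> (int \<times> int \<Rightarrow> real) \<Rightarrow> (real \<Rightarrow> real) \<Rightarrow> (real \<Rightarrow> real) \<Rightarrow> real \<Rightarrow>
   torus_distribution \<Rightarrow> (real \<Rightarrow> torus_distribution) \<Rightarrow> (real \<Rightarrow> torus_distribution) \<Rightarrow> bool" where
  "mild_solution s b g\<^sub>1 g\<^sub>2 T u\<^sub>0 h u \<longleftrightarrow> u \<in> C_sobolev s T \<and> u 0 = u\<^sub>0 \<and>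
     (\<forall>t\<in>{0..T}. \<exists>w.
        has_sobolev_integral s (lebesgue_on {0..t}) (\<lambda>t'. propagator b (t - t') (G_op g\<^sub>1 g\<^sub>2 (h t'))) w \<and>
        u t = propagator b t u\<^sub>0 + w)"

definition maximal_separated :: "(int \<times> int \<Rightarrow> real) \<Rightarrow> (int \<times> int) set \<Rightarrow> bool" where
  "maximal_separated \<mu> J \<longleftrightarrow> inj_on \<mu> J \<and> (\<forall>J'. J \<subseteq> J' \<longrightarrow> inj_on \<mu> J' \<longrightarrow> J' = J)"

definition spectral_gap :: "(int \<times> int \<Rightarrow> real) \<Rightarrow> (int \<times> int) set \<Rightarrow> ereal" where
  "spectral_gap \<mu> J = (INF (k, k') \<in> {(k, k'). k \<in> J \<and> k' \<in> J \<and> k \<noteq> k'}. ereal \<bar>\<mu> k - \<mu> k'\<bar>)"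

definition asymptotic_gap :: "(int \<times> int \<Rightarrow> real) \<Rightarrow> (int \<times> int) set \<Rightarrow> ereal" where
  "asymptotic_gap \<mu> J = (SUP S \<in> {S. S \<subseteq> J \<and> finite S}. spectral_gap \<mu> (J - S))"

end

theory Submission
  imports Defs
begin

text \<open>On the Fourier side the control problem asks for the prescribed values of the moments
  \<open>\<integral> cis (- \<mu> k * t) * (G h)\<^sup>\<and> k t dt\<close>, \<open>\<mu> k\<close> being the eigenfrequencies. By the theorems of Ingham and Haraux
  the gap condition gives, on \<open>{0..T}\<close>, functions \<open>q\<^sub>\<mu>\<close> of bounded \<open>L\<^sup>2\<close> norm that are biorthogonal to
  these exponentials. Taking \<open>a k * q\<^bsub>\<mu> k\<^esub>\<close> as the \<open>k\<close>-th coefficient of \<open>h\<close> leaves an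
  algebraic system for \<open>a\<close> on each eigenspace, and the assumptions on coinciding frequencies decouple it
  into blocks in which only \<open>(k1, k2)\<close> and \<open>(- k1, k2)\<close> interact. The diagonal of a block is
  \<open>1 / pi\<close> and its off-diagonal entries are at most \<open>1 / (2 * pi)\<close>, whatever the profiles, so the
  blocks are uniformly invertible. As the modes are orthogonal in space, the norm of \<open>h\<close> only involves
  \<open>sup \<parallel>q\<^sub>\<mu>\<parallel>\<close>.\<close>

section \<open>Trigonometric test functions\<close>

text \<open>The frequency 0 has infinite multiplicity, since \<open>eigenfreq b\<close> vanishes on
  both coordinate axes, so decoupling the system for \<open>a\<close> depends on the shape of G.
  Multiplication by \<open>g2 y\<close> moves only the second index, multiplication by
  \<open>g1 x\<close> only the first. Along a line of fixed \<open>k1 \<noteq> 0\<close> the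
  frequencies are distinct; along a line of fixed \<open>k2 \<noteq> 0\<close> they repeat only at
  \<open>- k1\<close>. The lines \<open>k1 = 0\<close> and \<open>k2 = 0\<close>, on which all
  frequencies agree, are exactly those that the subtracted means remove from the respective term. At
  the origin both terms are removed: the mean of a solution is conserved, whence the condition on
  the end states.

  The gap over all pairs would only reach times above \<open>2 * pi / \<gamma>\<close>; restoring
  finitely many frequencies costs an arbitrarily short extra time, which brings in
  \<open>\<gamma>'\<close>.

  Sobolev spaces are sets here, not Banach types, and operators are definite descriptions.
  Everything rests on one uniqueness statement, that a distribution is determined by its Fourier
  coefficients; integrals, solutions and norms are then handled one coefficient at a time.\<close>

definition vderiv :: "(real \<Rightarrow> complex) \<Rightarrow> real \<Rightarrow> complex" where
  "vderiv f = (\<lambda>x. vector_derivative f (at x))"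

definition smooth :: "(real \<Rightarrow> complex) \<Rightarrow> bool" where
  "smooth f \<longleftrightarrow> (\<forall>n x. (vderiv ^^ n) f differentiable (at x))"

definition tensor :: "(real \<Rightarrow> complex) \<Rightarrow> (real \<Rightarrow> complex) \<Rightarrow> real \<times> real \<Rightarrow> complex" where
  "tensor \<phi> \<psi> = (\<lambda>(x, y). \<phi> x * \<psi> y)"

definition wave :: "int \<Rightarrow> real \<Rightarrow> complex" where
  "wave k = (\<lambda>x. exp (\<i> * of_real (of_int k * x)))"

definition tchar :: "int \<times> int \<Rightarrow> real \<times> real \<Rightarrow> complex" where
  "tchar k = tensor (wave (fst k)) (wave (snd k))"

lemma has_vderiv: "f differentiable (at x) \<Longrightarrow> (f has_vector_derivative vderiv f x) (at x)"
  by (simp add: vderiv_def vector_derivative_works[symmetric])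

lemma vderivI: "(\<And>x. (f has_vector_derivative g x) (at x)) \<Longrightarrow> vderiv f = g"
  by (auto simp: vderiv_def vector_derivative_at)

lemma wave_has_vector_derivative:
  "(wave k has_vector_derivative (\<i> * of_int k) * wave k x) (at x)"
proof -
  have "((\<lambda>z. exp (\<i> * (of_int k * z))) has_field_derivative \<i> * of_int k * exp (\<i> * (of_int k * of_real x)))
      (at (of_real x))"
    by (auto intro!: derivative_eq_intros)
  from has_vector_derivative_real_field[OF this] show ?thesis
    by (simp add: wave_def)
qed

lemma wave_0 [simp]: "wave 0 = (\<lambda>x. 1)"
  by (simp add: wave_def)

lemma wave_add: "wave (k + l) x = wave k x * wave l x"
  by (simp add: wave_def exp_add[symmetric] algebra_simps)

lemma norm_wave [simp]: "cmod (wave k x) = 1"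
  by (simp add: wave_def)

lemma wave_periodic [simp]: "wave k (x + 2 * pi) = wave k x"
proof -
  have "wave k (x + 2 * pi) = wave k x * exp (2 * of_int k * of_real pi * \<i>)"
    by (simp add: wave_def exp_add[symmetric] algebra_simps)
  also have "exp (2 * of_int k * of_real pi * \<i>) = (1::complex)"
    using exp_integer_2pi[of "of_int k"] by (simp add: mult_ac)
  finally show ?thesis by simp
qed

lemma wave_2pi [simp]: "wave k (2 * pi) = 1"
  using wave_periodic[of k 0] by (simp add: wave_def)

lemma wave_at_0 [simp]: "wave k 0 = 1"
  by (simp add: wave_def)

lemma cnj_wave: "cnj (wave k x) = wave (- k) x"
  by (simp add: wave_def exp_cnj)

lemma continuous_on_wave [continuous_intros]:
  "continuous_on S f \<Longrightarrow> continuous_on S (\<lambda>x. wave k (f x))"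
  unfolding wave_def by (intro continuous_intros)

text \<open>Only the shape of the derivative matters: a combination of real derivatives of
  \<open>g\<close> times the same wave is stable under \<open>vderiv\<close>, so no Leibniz
  coefficients are computed. This links the real \<open>deriv\<close> of the profile hypothesis with
  the complex derivative used for test functions.\<close>

lemma vderiv_power_modulated:
  assumes g: "\<And>n x. (deriv ^^ n) g differentiable (at x)"
  shows "\<exists>c. (vderiv ^^ j) (\<lambda>x. of_real (g x) * wave k x) =
    (\<lambda>x. (\<Sum>n\<le>j. c n * of_real ((deriv ^^ n) g x)) * wave k x)"
proof (induction j)
  case 0
  show ?case by (rule exI[of _ "\<lambda>_. 1"]) auto
next
  case (Suc j)
  then obtain c where c: "(vderiv ^^ j) (\<lambda>x. of_real (g x) * wave k x) =
    (\<lambda>x. (\<Sum>n\<le>j. c n * of_real ((deriv ^^ n) g x)) * wave k x)" by blast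
  \<comment> \<open>\<open>c (n - 1)\<close> comes from differentiating the derivative of
    \<open>g\<close>, the factor \<open>\<i> * of_int k\<close> from differentiating the
    wave.\<close>
  define c' where "c' n = (if n = 0 then 0 else c (n - 1)) + (if n \<le> j then \<i> * of_int k * c n else 0)" for n
  have d: "((\<lambda>x. of_real ((deriv ^^ n) g x) :: complex) has_vector_derivative
      of_real ((deriv ^^ Suc n) g x)) (at x)" for n x
  proof -
    have "(deriv ^^ n) g field_differentiable (at x)"
      using g[of n x] by (metis real_differentiable_def field_differentiable_def)
    then have "((deriv ^^ n) g has_field_derivative (deriv ^^ Suc n) g x) (at x)"
      by (simp add: DERIV_deriv_iff_field_differentiable)
    then show ?thesis
      by (intro has_vector_derivative_of_real) (simp add: has_real_derivative_iff_has_vector_derivative)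
  qed
  have "(vderiv ^^ Suc j) (\<lambda>x. of_real (g x) * wave k x) =
     vderiv (\<lambda>x. (\<Sum>n\<le>j. c n * of_real ((deriv ^^ n) g x)) * wave k x)"
    by (simp add: c)
  also have "\<dots> = (\<lambda>x. (\<Sum>n\<le>j. c n * of_real ((deriv ^^ n) g x)) * (\<i> * of_int k * wave k x) +
      (\<Sum>n\<le>j. c n * of_real ((deriv ^^ Suc n) g x)) * wave k x)"
    by (rule vderivI, rule has_vector_derivative_mult)
       (auto intro!: has_vector_derivative_sum has_vector_derivative_mult_right d[simplified] 
         wave_has_vector_derivative)
  also have "\<dots> = (\<lambda>x. (\<Sum>n\<le>Suc j. c' n * of_real ((deriv ^^ n) g x)) * wave k x)"
  proof
    fix x
    have "(\<Sum>n\<le>Suc j. c' n * of_real ((deriv ^^ n) g x)) =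
       (\<Sum>n\<le>Suc j. (if n = 0 then 0 else c (n - 1)) * of_real ((deriv ^^ n) g x)) +
       (\<Sum>n\<le>Suc j. (if n \<le> j then \<i> * of_int k * c n else 0) * of_real ((deriv ^^ n) g x))"
      by (simp add: c'_def sum.distrib algebra_simps del: sum.atMost_Suc)
    also have "(\<Sum>n\<le>Suc j. (if n = 0 then 0 else c (n - 1)) * of_real ((deriv ^^ n) g x) :: complex) =
       (\<Sum>n\<le>j. c n * of_real ((deriv ^^ Suc n) g x))"
      by (subst sum.atMost_Suc_shift) simp
    also have "(\<Sum>n\<le>Suc j. (if n \<le> j then \<i> * of_int k * c n else 0) * of_real ((deriv ^^ n) g x)) =
       \<i> * of_int k * (\<Sum>n\<le>j. c n * of_real ((deriv ^^ n) g x))"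
      by (simp add: sum_distrib_left algebra_simps)
    finally show "(\<Sum>n\<le>j. c n * of_real ((deriv ^^ n) g x)) * (\<i> * of_int k * wave k x) +
      (\<Sum>n\<le>j. c n * of_real ((deriv ^^ Suc n) g x)) * wave k x = 
      (\<Sum>n\<le>Suc j. c' n * of_real ((deriv ^^ n) g x)) * wave k x"
      by (simp only:) (simp add: algebra_simps)
  qed
  finally show ?case by (rule exI[of _ c'])
qed

lemma smooth_modulated:
  assumes g: "\<And>n x. (deriv ^^ n) g differentiable (at x)"
  shows "smooth (\<lambda>x. of_real (g x) * wave k x)"
  unfolding smooth_def
proof (intro allI)
  fix j x
  obtain c where c: "(vderiv ^^ j) (\<lambda>x. of_real (g x) * wave k x) =
    (\<lambda>x. (\<Sum>n\<le>j. c n * of_real ((deriv ^^ n) g x)) * wave k x)"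
    using vderiv_power_modulated[OF g] by blast
  have "(\<lambda>x. of_real ((deriv ^^ n) g x) :: complex) differentiable (at x)" for n
    using g[of n x] unfolding differentiable_def
    by (metis has_derivative_of_real)
  moreover have "wave k differentiable (at x)"
    using wave_has_vector_derivative by (rule differentiableI_vector)
  ultimately show "(vderiv ^^ j) (\<lambda>x. of_real (g x) * wave k x) differentiable (at x)"
    unfolding c by (intro differentiable_mult differentiable_sum) auto
qed

lemma smooth_wave: "smooth (wave k)"
proof -
  have "(deriv ^^ n) (\<lambda>_. 1 :: real) = (\<lambda>_. if n = 0 then 1 else 0)" for n
  proof (induction n)
    case (Suc n)
    then show ?case by (cases n) auto
  qed auto
  then have "smooth (\<lambda>x. of_real 1 * wave k x)"
    by (intro smooth_modulated) auto
  then show ?thesis by simp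
qed

section \<open>Partial derivatives of products and of linear combinations\<close>

lemma partial_x_tensor:
  assumes "\<And>x. \<phi> differentiable (at x)"
  shows "partial_x (tensor \<phi> \<psi>) = tensor (vderiv \<phi>) \<psi>"
  unfolding partial_x_def tensor_def
  by (auto simp: fun_eq_iff intro!: vector_derivative_at has_vector_derivative_mult_left has_vderiv assms)

lemma partial_y_tensor:
  assumes "\<And>x. \<psi> differentiable (at x)"
  shows "partial_y (tensor \<phi> \<psi>) = tensor \<phi> (vderiv \<psi>)"
  unfolding partial_y_def tensor_def
  by (auto simp: fun_eq_iff intro!: vector_derivative_at has_vector_derivative_mult_right has_vderiv assms)

text \<open>Each partial derivative acts on one factor, so smoothness of characters and of lifted
  profiles becomes a one-variable question.\<close>

lemma mixed_partial_tensor: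
  assumes "smooth \<phi>" "smooth \<psi>"
  shows "mixed_partial i j (tensor \<phi> \<psi>) = tensor ((vderiv ^^ i) \<phi>) ((vderiv ^^ j) \<psi>)"
proof -
  have "(partial_y ^^ j) (tensor \<phi> \<psi>) = tensor \<phi> ((vderiv ^^ j) \<psi>)"
    using assms(2) by (induction j) (auto simp: partial_y_tensor smooth_def)
  moreover have "(partial_x ^^ i) (tensor \<phi> \<psi>') = tensor ((vderiv ^^ i) \<phi>) \<psi>'" for \<psi>'
    using assms(1) by (induction i) (auto simp: partial_x_tensor smooth_def)
  ultimately show ?thesis by (simp add: mixed_partial_def)
qed

lemma differentiable_tensor:
  assumes "\<And>x. \<phi> differentiable (at x)" "\<And>x. \<psi> differentiable (at x)"
  shows "tensor \<phi> \<psi> differentiable (at p)"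
proof -
  have "(\<lambda>p. \<phi> (fst p)) differentiable (at p)"
    using differentiable_chain_at[OF bounded_linear_imp_differentiable[OF bounded_linear_fst] assms(1), of p]
    by (simp add: o_def)
  moreover have "(\<lambda>p. \<psi> (snd p)) differentiable (at p)"
    using differentiable_chain_at[OF bounded_linear_imp_differentiable[OF bounded_linear_snd] assms(2), of p]
    by (simp add: o_def)
  ultimately show ?thesis
    unfolding tensor_def case_prod_beta by (rule differentiable_mult)
qed

lemma test_function_tensor:
  assumes "smooth \<phi>" "smooth \<psi>" "\<And>x. \<phi> (x + 2 * pi) = \<phi> x" "\<And>x. \<psi> (x + 2 * pi) = \<psi> x"
  shows "test_function (tensor \<phi> \<psi>)"
  unfolding test_function_def
proof (intro conjI allI)
  show "torus_periodic (tensor \<phi> \<psi>)" using assms(3,4) by (simp add: torus_periodic_def tensor_def)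
  show "mixed_partial i j (tensor \<phi> \<psi>) differentiable (at p)" for i j p
    using assms(1,2) unfolding mixed_partial_tensor[OF assms(1,2)]
    by (intro differentiable_tensor) (auto simp: smooth_def)
qed

lemma test_function_tchar: "test_function (tchar k)"
  unfolding tchar_def by (intro test_function_tensor smooth_wave) auto

lemma vderiv_wave: "vderiv (\<lambda>x. c * wave k x) = (\<lambda>x. c * (\<i> * of_int k) * wave k x)"
  by (rule vderivI)
     (use has_vector_derivative_mult_right[OF wave_has_vector_derivative] in \<open>simp add: mult.assoc\<close>)

lemma vderiv_power_wave: "(vderiv ^^ n) (wave k) = (\<lambda>x. (\<i> * of_int k) ^ n * wave k x)"
proof (induction n)
  case (Suc n)
  have "(vderiv ^^ Suc n) (wave k) = vderiv (\<lambda>x. (\<i> * of_int k) ^ n * wave k x)"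
    by (simp add: Suc)
  then show ?case by (simp add: vderiv_wave) (simp add: mult_ac)
qed simp

lemma mixed_partial_tchar:
  "mixed_partial i j (tchar k) = (\<lambda>p. (\<i> * of_int (fst k)) ^ i * (\<i> * of_int (snd k)) ^ j * tchar k p)"
  unfolding tchar_def mixed_partial_tensor[OF smooth_wave smooth_wave] vderiv_power_wave
  by (auto simp: tensor_def)

lemma differentiable_slice_x:
  assumes "f differentiable (at (x, y))"
  shows "(\<lambda>t. f (t, y)) differentiable (at (x :: real))"
proof -
  have "(\<lambda>t. (t, y)) differentiable (at x)"
    unfolding differentiable_def by (rule exI) (rule derivative_eq_intros refl)+
  from differentiable_chain_at[OF this assms] show ?thesis by (simp add: o_def)
qed

lemma differentiable_slice_y:
  assumes "f differentiable (at (x, y))"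
  shows "(\<lambda>t. f (x, t)) differentiable (at (y :: real))"
proof -
  have "(\<lambda>t. (x, t)) differentiable (at y)"
    unfolding differentiable_def by (rule exI) (rule derivative_eq_intros refl)+
  from differentiable_chain_at[OF this assms] show ?thesis by (simp add: o_def)
qed

lemma test_function_mixed_partial_differentiable:
  "test_function f \<Longrightarrow> mixed_partial i j f differentiable (at p)"
  unfolding test_function_def by blast

lemma mixed_partial_Suc_x: "mixed_partial (Suc i) j f = partial_x (mixed_partial i j f)"
  by (simp add: mixed_partial_def)

lemma mixed_partial_Suc_y: "mixed_partial 0 (Suc j) f = partial_y (mixed_partial 0 j f)"
  by (simp add: mixed_partial_def)

lemma partial_x_linear:
  assumes "\<And>p. f differentiable (at p)" "\<And>p. g differentiable (at p)"
  shows "partial_x (\<lambda>p. c * f p + d * g p) = (\<lambda>p. c * partial_x f p + d * partial_x g p)"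
  unfolding partial_x_def case_prod_beta
  by (intro ext vector_derivative_at has_vector_derivative_add has_vector_derivative_mult_right
      vector_derivative_works[THEN iffD1] differentiable_slice_x assms)

lemma partial_y_linear:
  assumes "\<And>p. f differentiable (at p)" "\<And>p. g differentiable (at p)"
  shows "partial_y (\<lambda>p. c * f p + d * g p) = (\<lambda>p. c * partial_y f p + d * partial_y g p)"
  unfolding partial_y_def case_prod_beta
  by (intro ext vector_derivative_at has_vector_derivative_add has_vector_derivative_mult_right
      vector_derivative_works[THEN iffD1] differentiable_slice_y assms)

text \<open>\<open>vector_derivative\<close> is a choice operator and is linear only at points of
  differentiability; \<open>test_function\<close> provides these at every order, which is what the
  induction consumes.\<close>

lemma mixed_partial_linear:
  assumes "test_function f" "test_function g"
  shows "mixed_partial i j (\<lambda>p. c * f p + d * g p) = (\<lambda>p. c * mixed_partial i j f p + d * mixed_partial i j g p)"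
proof (induction i)
  case 0
  show ?case
  proof (induction j)
    case (Suc j)
    then show ?case unfolding mixed_partial_Suc_y Suc
      by (intro partial_y_linear test_function_mixed_partial_differentiable assms)
  qed (simp add: mixed_partial_def)
next
  case (Suc i)
  then show ?case unfolding mixed_partial_Suc_x Suc
    by (intro partial_x_linear test_function_mixed_partial_differentiable assms)
qed

lemma test_function_linear:
  assumes "test_function f" "test_function g"
  shows "test_function (\<lambda>p. c * f p + d * g p)"
  using assms unfolding test_function_def mixed_partial_linear[OF assms]
  by (auto simp: torus_periodic_def intro!: differentiable_add differentiable_mult)

lemma test_function_sum:
  assumes "finite A" "\<And>a. a \<in> A \<Longrightarrow> test_function (f a)"
  shows "test_function (\<lambda>p. \<Sum>a\<in>A. c a * f a p) \<and>
    mixed_partial i j (\<lambda>p. \<Sum>a\<in>A. c a * f a p) = (\<lambda>p. \<Sum>a\<in>A. c a * mixed_partial i j (f a) p)"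
  using assms
proof (induction A rule: finite_induct)
  case empty
  \<comment> \<open>The zero function is reached as a combination with zero coefficients, so that
    nothing has to be differentiated.\<close>
  have "test_function (\<lambda>p. 0)" "mixed_partial i j (\<lambda>p. 0) = (\<lambda>p. 0)"
    using test_function_linear[OF test_function_tchar test_function_tchar, of 0 undefined 0 undefined]
      mixed_partial_linear[OF test_function_tchar test_function_tchar, of i j 0 undefined 0 undefined]
    by simp_all
  then show ?case by simp
next
  case (insert a A)
  then show ?case
    using test_function_linear[of "f a" "\<lambda>p. \<Sum>a\<in>A. c a * f a p" "c a" 1]
      mixed_partial_linear[of "f a" "\<lambda>p. \<Sum>a\<in>A. c a * f a p" i j "c a" 1]
    by simp
qed

section \<open>Fourier coefficients on the torus\<close>

abbreviation circ :: "real measure" where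
  "circ \<equiv> restrict_space lborel {0..2 * pi}"

abbreviation torus :: "(real \<times> real) measure" where
  "torus \<equiv> circ \<Otimes>\<^sub>M circ"

interpretation circ: finite_measure circ
  by (rule finite_measureI) (simp add: space_restrict_space emeasure_restrict_space)

interpretation torus: pair_sigma_finite circ circ ..

interpretation torus: finite_measure torus
  by (rule finite_measure_pair_measure) (rule circ.finite_measure_axioms)+

lemma space_circ: "space circ = {0..2 * pi}"
  by (simp add: space_restrict_space)

lemma space_torus: "space torus = {0..2 * pi} \<times> {0..2 * pi}"
  by (simp add: space_pair_measure space_circ)

lemma square_borel: "{0..2 * pi} \<times> {0..2 * pi} \<in> sets (borel :: (real \<times> real) measure)"
  by (intro borel_closed closed_Times) auto

text \<open>Representation of distributions is stated with set integrals over a square in the plane,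
  while Fubini needs a product measure; this identity makes both forms available.\<close>

lemma torus_eq: "torus = restrict_space lborel ({0..2 * pi} \<times> {0..2 * pi})"
proof (rule pair_measure_eqI)
  let ?R = "restrict_space lborel ({0..2 * pi} \<times> {0..2 * pi}) :: (real \<times> real) measure"
  have R: "space ?R = {0..2 * pi} \<times> {0..2 * pi}" by (simp add: space_restrict_space)
  have 1: "(\<lambda>p. p) \<in> torus \<rightarrow>\<^sub>M ?R"
  proof (rule measurable_restrict_space2)
    have "(\<lambda>p. p) \<in> torus \<rightarrow>\<^sub>M (lborel \<Otimes>\<^sub>M lborel)"
    proof (rule measurable_pair)
      show "fst \<circ> (\<lambda>p. p) \<in> torus \<rightarrow>\<^sub>M lborel" "snd \<circ> (\<lambda>p. p) \<in> torus \<rightarrow>\<^sub>M lborel"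
        unfolding comp_def
        by (rule measurable_compose[OF measurable_fst] measurable_compose[OF measurable_snd],
            simp add: measurable_restrict_space1)+
    qed
    then show "(\<lambda>p. p) \<in> torus \<rightarrow>\<^sub>M lborel" by (simp only: lborel_prod)
  qed (auto simp: space_torus)
  have 2: "(\<lambda>p. p) \<in> ?R \<rightarrow>\<^sub>M torus"
  proof (rule measurable_pair)
    show "fst \<circ> (\<lambda>p. p) \<in> ?R \<rightarrow>\<^sub>M circ" "snd \<circ> (\<lambda>p. p) \<in> ?R \<rightarrow>\<^sub>M circ"
      unfolding comp_def
      by (intro measurable_restrict_space2 measurable_restrict_space1; force simp: R borel_prod[symmetric])+
  qed
  show "sets torus = sets ?R"
  proof (intro equalityI subsetI)
    fix A assume "A \<in> sets torus"
    with measurable_sets[OF 2 this] show "A \<in> sets ?R"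
      using sets.sets_into_space[of A torus] by (simp add: R space_torus Int_absorb2 vimage_def)
  next
    fix A assume "A \<in> sets ?R"
    with measurable_sets[OF 1 this] show "A \<in> sets torus"
      using sets.sets_into_space[of A ?R] by (simp add: R space_torus Int_absorb2 vimage_def)
  qed
  fix A B assume "A \<in> sets circ" "B \<in> sets circ"
  then have A: "A \<in> sets borel" "A \<subseteq> {0..2 * pi}" and B: "B \<in> sets borel" "B \<subseteq> {0..2 * pi}"
    by (auto simp: sets_restrict_space)
  have "emeasure circ A * emeasure circ B = emeasure lborel A * emeasure lborel B"
    using A B by (simp add: emeasure_restrict_space)
  also have "\<dots> = emeasure (lborel \<Otimes>\<^sub>M lborel) (A \<times> B)"
    using A B by (intro lborel.emeasure_pair_measure_Times[symmetric]) auto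
  also have "\<dots> = emeasure lborel (A \<times> B)" by (simp only: lborel_prod)
  also have "\<dots> = emeasure ?R (A \<times> B)"
    using A B square_borel by (intro emeasure_restrict_space[symmetric]) auto
  finally show "emeasure circ A * emeasure circ B = emeasure ?R (A \<times> B)" .
qed (rule circ.sigma_finite_measure_axioms)+

lemma set_integrable_torus:
  fixes f :: "real \<times> real \<Rightarrow> complex"
  shows "set_integrable lborel ({0..2 * pi} \<times> {0..2 * pi}) f \<longleftrightarrow> integrable torus f"
  unfolding torus_eq by (subst integrable_restrict_space) (auto simp: set_integrable_def square_borel)

lemma set_integral_torus:
  fixes f :: "real \<times> real \<Rightarrow> complex"
  shows "(LINT p:({0..2 * pi} \<times> {0..2 * pi})|lborel. f p) = integral\<^sup>L torus f"
  unfolding torus_eq by (subst integral_restrict_space) (auto simp: set_lebesgue_integral_def square_borel)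

lemma set_integral_circ:
  fixes f :: "real \<Rightarrow> complex"
  shows "(LINT x:{0..2 * pi}|lborel. f x) = integral\<^sup>L circ f"
  by (subst integral_restrict_space) (auto simp: set_lebesgue_integral_def)

lemma integrable_torus_continuous:
  fixes f :: "real \<times> real \<Rightarrow> complex"
  shows "continuous_on UNIV f \<Longrightarrow> integrable torus f"
  unfolding torus_eq
  by (subst integrable_restrict_space)
     (auto intro!: borel_integrable_compact compact_Times borel_closed closed_Times intro: continuous_on_subset)

lemma integral_torus_iterated:
  fixes f :: "real \<times> real \<Rightarrow> complex"
  assumes "integrable torus f"
  shows "integral\<^sup>L torus f = (\<integral>y. (\<integral>x. f (x, y) \<partial>circ) \<partial>circ)"
    and "integral\<^sup>L torus f = (\<integral>x. (\<integral>y. f (x, y) \<partial>circ) \<partial>circ)"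
  using torus.integral_snd[of "\<lambda>x y. f (x, y)"] torus.integral_fst'[OF assms] assms by auto

text \<open>A periodic primitive has equal end values. The same fact serves the orthogonality of
  waves and integration by parts without boundary terms.\<close>

lemma integral_circ_FTC:
  assumes "\<And>x. (F has_vector_derivative f x) (at x)" "continuous_on UNIV f" "F (2 * pi) = F 0"
  shows "integral\<^sup>L circ f = (0 :: complex)"
proof -
  have "integral\<^sup>L circ f = (\<integral>x. indicator {0..2*pi} x *\<^sub>R f x \<partial>lborel)"
    by (subst integral_restrict_space) auto
  also have "\<dots> = F (2 * pi) - F 0"
    using assms by (intro integral_FTC_Icc) (auto intro: has_vector_derivative_at_within continuous_on_subset)
  finally show ?thesis using assms(3) by simp
qed

lemma integral_wave: "integral\<^sup>L circ (wave k) = (if k = 0 then 2 * pi else 0)"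
proof (cases "k = 0")
  case True
  have "measure circ (space circ) = 2 * pi"
    by (simp add: space_circ measure_restrict_space)
  with True show ?thesis by (simp add: scaleR_conv_of_real)
next
  case False
  have "integral\<^sup>L circ (\<lambda>x. \<i> * of_int k * wave k x) = 0"
    by (rule integral_circ_FTC[of "wave k"]) (auto intro!: wave_has_vector_derivative continuous_intros)
  with False show ?thesis by simp
qed

lemma continuous_on_tchar [continuous_intros]:
  "continuous_on S f \<Longrightarrow> continuous_on S (\<lambda>x. tchar k (f x))"
  unfolding tchar_def tensor_def case_prod_beta by (intro continuous_intros)

lemma borel_measurable_tchar [measurable]: "tchar k \<in> borel_measurable borel"
  by (intro borel_measurable_continuous_onI continuous_intros)

lemma measurable_tchar_torus [measurable]: "tchar k \<in> borel_measurable torus"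
  unfolding torus_eq
  by (intro measurable_restrict_space1) simp

lemma norm_tchar [simp]: "cmod (tchar k p) = 1"
  by (cases p) (simp add: tchar_def tensor_def norm_mult)

lemma tchar_add: "tchar (k + l) p = tchar k p * tchar l p"
  by (cases p) (simp add: tchar_def tensor_def wave_add mult_ac)

lemma tchar_0 [simp]: "tchar 0 p = 1"
  by (simp add: tchar_def tensor_def)

lemma cnj_tchar: "cnj (tchar k p) = tchar (- k) p"
  by (cases p) (simp add: tchar_def tensor_def cnj_wave)

lemma tchar_periodic: "tchar k (x + 2 * pi, y) = tchar k (x, y)" "tchar k (x, y + 2 * pi) = tchar k (x, y)"
  by (auto simp: tchar_def tensor_def)

lemma integral_tchar: "integral\<^sup>L torus (tchar k) = (if k = 0 then (2 * pi)\<^sup>2 else 0)"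
proof -
  have "integral\<^sup>L torus (tchar k) = (\<integral>y. (\<integral>x. tchar k (x, y) \<partial>circ) \<partial>circ)"
    by (intro integral_torus_iterated integrable_torus_continuous continuous_intros)
  also have "\<dots> = integral\<^sup>L circ (wave (fst k)) * integral\<^sup>L circ (wave (snd k))"
    by (simp add: tchar_def tensor_def)
  finally show ?thesis by (cases k) (auto simp: integral_wave power2_eq_square zero_prod_def)
qed

section \<open>Fourier coefficients of functions and their decay\<close>

definition fcoeff :: "(real \<times> real \<Rightarrow> complex) \<Rightarrow> int \<times> int \<Rightarrow> complex" where
  "fcoeff f k = (\<integral>p. f p * tchar (- k) p \<partial>torus) / (2 * pi)\<^sup>2"

lemma integrable_times_tchar:
  "integrable torus f \<Longrightarrow> integrable torus (\<lambda>p. f p * tchar k p)"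
  by (rule Bochner_Integration.integrable_bound[where f = f]) (auto simp: norm_mult)

lemma fcoeff_tchar: "fcoeff (tchar l) k = (if k = l then 1 else 0)"
  by (simp add: fcoeff_def tchar_add[symmetric] integral_tchar)

lemma fcoeff_linear:
  assumes "integrable torus f" "integrable torus g"
  shows "fcoeff (\<lambda>p. c * f p + d * g p) k = c * fcoeff f k + d * fcoeff g k"
  using integrable_times_tchar[OF assms(1), of "-k"] integrable_times_tchar[OF assms(2), of "-k"]
  by (simp add: fcoeff_def distrib_right mult.assoc add_divide_distrib)

lemma fcoeff_bound:
  assumes "integrable torus f"
  shows "cmod (fcoeff f k) \<le> (\<integral>p. cmod (f p) \<partial>torus)"
proof -
  have "cmod (\<integral>p. f p * tchar (- k) p \<partial>torus) \<le> (\<integral>p. cmod (f p) \<partial>torus)"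
    using integral_norm_bound[of torus "\<lambda>p. f p * tchar (- k) p"] by (simp add: norm_mult)
  moreover have "1 \<le> (2 * pi)\<^sup>2" using pi_gt3 by (intro one_le_power) simp
  then have "cmod (\<integral>p. f p * tchar (- k) p \<partial>torus) / (2 * pi)\<^sup>2 \<le> cmod (\<integral>p. f p * tchar (- k) p \<partial>torus) / 1"
    by (intro divide_left_mono) auto
  ultimately show ?thesis
    by (simp add: fcoeff_def norm_divide norm_power norm_mult)
qed

text \<open>On each horizontal line the product of \<open>f\<close> with a wave is periodic, so its
  derivative integrates to zero; Fubini carries this to the torus.\<close>

lemma fcoeff_partial_x:
  assumes d: "\<And>p. f differentiable (at p)" and c: "continuous_on UNIV (partial_x f)" and p: "torus_periodic f"
  shows "fcoeff (partial_x f) k = \<i> * of_int (fst k) * fcoeff f k"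
proof -
  define k1 k2 where "k1 = fst k" and "k2 = snd k"
  have cf: "continuous_on UNIV f"
    using d by (simp add: differentiable_imp_continuous_within continuous_at_imp_continuous_on)
  have z: "(\<integral>x. partial_x f (x, y) * wave (- k1) x + f (x, y) * (- \<i> * of_int k1 * wave (- k1) x) \<partial>circ) = 0" for y
  proof (rule integral_circ_FTC)
    show "((\<lambda>x. f (x, y) * wave (- k1) x) has_vector_derivative
      partial_x f (x, y) * wave (- k1) x + f (x, y) * (- \<i> * of_int k1 * wave (- k1) x)) (at x)" for x
      unfolding add.commute[of "partial_x f (x, y) * _"]
    proof (rule has_vector_derivative_mult)
      show "((\<lambda>x. f (x, y)) has_vector_derivative partial_x f (x, y)) (at x)"
        using differentiable_slice_x[OF d] by (simp add: partial_x_def vector_derivative_works[symmetric])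
      show "(wave (- k1) has_vector_derivative - \<i> * of_int k1 * wave (- k1) x) (at x)"
        using wave_has_vector_derivative[of "- k1" x] by simp
    qed
    show "continuous_on UNIV (\<lambda>x. partial_x f (x, y) * wave (- k1) x + f (x, y) * (- \<i> * of_int k1 * wave (- k1) x))"
      by (intro continuous_intros continuous_on_compose2[OF c] continuous_on_compose2[OF cf]) auto
    show "f (2 * pi, y) * wave (- k1) (2 * pi) = f (0, y) * wave (- k1) 0"
      using p[unfolded torus_periodic_def, rule_format, of 0 y] by simp
  qed
  have I: "integrable torus (\<lambda>p. partial_x f p * tchar (- k) p + f p * (- \<i> * of_int k1 * tchar (- k) p))"
    by (intro integrable_torus_continuous continuous_intros c cf)
  have "(\<integral>p. partial_x f p * tchar (- k) p + f p * (- \<i> * of_int k1 * tchar (- k) p) \<partial>torus) =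
    (\<integral>y. (\<integral>x. (partial_x f (x, y) * wave (- k1) x + f (x, y) * (- \<i> * of_int k1 * wave (- k1) x)) * wave (- k2) y \<partial>circ) \<partial>circ)"
    unfolding integral_torus_iterated(1)[OF I]
    by (simp add: tchar_def tensor_def k1_def k2_def algebra_simps)
  also have "\<dots> = 0" using z by simp
  finally have "(\<integral>p. partial_x f p * tchar (- k) p \<partial>torus) + (\<integral>p. f p * (- \<i> * of_int k1 * tchar (- k) p) \<partial>torus) = 0"
    by (subst (asm) Bochner_Integration.integral_add)
       (auto intro!: integrable_torus_continuous continuous_intros c cf)
  then have "(\<integral>p. partial_x f p * tchar (- k) p \<partial>torus) = \<i> * of_int k1 * (\<integral>p. f p * tchar (- k) p \<partial>torus)"
    by (simp add: mult.left_commute[of "f _"] add_eq_0_iff)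
  then show ?thesis by (simp add: fcoeff_def k1_def)
qed

lemma fcoeff_partial_y:
  assumes d: "\<And>p. f differentiable (at p)" and c: "continuous_on UNIV (partial_y f)" and p: "torus_periodic f"
  shows "fcoeff (partial_y f) k = \<i> * of_int (snd k) * fcoeff f k"
proof -
  define k1 k2 where "k1 = fst k" and "k2 = snd k"
  have cf: "continuous_on UNIV f"
    using d by (simp add: differentiable_imp_continuous_within continuous_at_imp_continuous_on)
  have z: "(\<integral>y. partial_y f (x, y) * wave (- k2) y + f (x, y) * (- \<i> * of_int k2 * wave (- k2) y) \<partial>circ) = 0" for x
  proof (rule integral_circ_FTC)
    show "((\<lambda>y. f (x, y) * wave (- k2) y) has_vector_derivative
      partial_y f (x, y) * wave (- k2) y + f (x, y) * (- \<i> * of_int k2 * wave (- k2) y)) (at y)" for y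
      unfolding add.commute[of "partial_y f (x, y) * _"]
    proof (rule has_vector_derivative_mult)
      show "((\<lambda>y. f (x, y)) has_vector_derivative partial_y f (x, y)) (at y)"
        using differentiable_slice_y[OF d] by (simp add: partial_y_def vector_derivative_works[symmetric])
      show "(wave (- k2) has_vector_derivative - \<i> * of_int k2 * wave (- k2) y) (at y)"
        using wave_has_vector_derivative[of "- k2" y] by simp
    qed
    show "continuous_on UNIV (\<lambda>y. partial_y f (x, y) * wave (- k2) y + f (x, y) * (- \<i> * of_int k2 * wave (- k2) y))"
      by (intro continuous_intros continuous_on_compose2[OF c] continuous_on_compose2[OF cf]) auto
    show "f (x, 2 * pi) * wave (- k2) (2 * pi) = f (x, 0) * wave (- k2) 0"
      using p[unfolded torus_periodic_def, rule_format, of x 0] by simp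
  qed
  have I: "integrable torus (\<lambda>p. partial_y f p * tchar (- k) p + f p * (- \<i> * of_int k2 * tchar (- k) p))"
    by (intro integrable_torus_continuous continuous_intros c cf)
  have "(\<integral>p. partial_y f p * tchar (- k) p + f p * (- \<i> * of_int k2 * tchar (- k) p) \<partial>torus) =
    (\<integral>x. (\<integral>y. (partial_y f (x, y) * wave (- k2) y + f (x, y) * (- \<i> * of_int k2 * wave (- k2) y)) * wave (- k1) x \<partial>circ) \<partial>circ)"
    unfolding integral_torus_iterated(2)[OF I]
    by (simp add: tchar_def tensor_def k1_def k2_def algebra_simps)
  also have "\<dots> = 0" using z by simp
  finally have "(\<integral>p. partial_y f p * tchar (- k) p \<partial>torus) + (\<integral>p. f p * (- \<i> * of_int k2 * tchar (- k) p) \<partial>torus) = 0"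
    by (subst (asm) Bochner_Integration.integral_add)
       (auto intro!: integrable_torus_continuous continuous_intros c cf)
  then have "(\<integral>p. partial_y f p * tchar (- k) p \<partial>torus) = \<i> * of_int k2 * (\<integral>p. f p * tchar (- k) p \<partial>torus)"
    by (simp add: mult.left_commute[of "f _"] add_eq_0_iff)
  then show ?thesis by (simp add: fcoeff_def k2_def)
qed

text \<open>No differentiability is assumed: being a derivative at \<open>x + 2 * pi\<close> and
  being one at \<open>x\<close> are equivalent predicates, so the values chosen by
  \<open>vector_derivative\<close> coincide even where no derivative exists.\<close>

lemma torus_periodic_partial:
  assumes "torus_periodic f"
  shows "torus_periodic (partial_x f)" "torus_periodic (partial_y f)"
proof -
  have shift: "vector_derivative F (at (x + 2 * pi)) = vector_derivative F (at x)"
    if "\<And>x. F (x + 2 * pi) = F x" for F :: "real \<Rightarrow> complex" and x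
  proof -
    have *: "((\<lambda>t. F (t + c)) has_vector_derivative v) (at x)"
      if "(F has_vector_derivative v) (at (x + c))" for c v x
      using vector_diff_chain_at[of "\<lambda>t. t + c" 1 x F v] that
      by (simp add: o_def has_vector_derivative_add_const has_vector_derivative_id)
    have "F (x - 2 * pi) = F x" for x
      using that[of "x - 2 * pi"] by simp
    then have "(F has_vector_derivative v) (at (x + 2 * pi)) \<longleftrightarrow> (F has_vector_derivative v) (at x)" for v
      using *[of v x "2 * pi"] *[of v "x + 2 * pi" "- (2 * pi)"] that by auto
    then show ?thesis by (simp add: vector_derivative_def)
  qed
  have x: "f (x + 2 * pi, y) = f (x, y)" "f (x, y + 2 * pi) = f (x, y)" for x y
    using assms by (auto simp: torus_periodic_def)
  show "torus_periodic (partial_x f)" "torus_periodic (partial_y f)"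
    unfolding torus_periodic_def partial_x_def partial_y_def prod.case
    by (simp_all add: x shift[of "\<lambda>t. f (t, _)"] shift[of "\<lambda>t. f (_, t)"])
qed

lemma torus_periodic_mixed_partial:
  "torus_periodic f \<Longrightarrow> torus_periodic (mixed_partial i j f)"
proof -
  assume f: "torus_periodic f"
  have "torus_periodic ((partial_y ^^ j) f)" by (induction j) (auto simp: f torus_periodic_partial)
  then show ?thesis by (induction i) (auto simp: mixed_partial_def torus_periodic_partial)
qed

lemma continuous_on_mixed_partial:
  "test_function f \<Longrightarrow> continuous_on S (mixed_partial i j f)"
  by (intro continuous_at_imp_continuous_on ballI differentiable_imp_continuous_within
      test_function_mixed_partial_differentiable)

lemma test_function_periodic: "test_function f \<Longrightarrow> torus_periodic f"
  by (simp add: test_function_def)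

lemma test_function_continuous: "test_function f \<Longrightarrow> continuous_on S f"
  using continuous_on_mixed_partial[of f S 0 0] by (simp add: mixed_partial_def)

lemma fcoeff_mixed_partial:
  assumes f: "test_function f"
  shows "fcoeff (mixed_partial i j f) k = (\<i> * of_int (fst k)) ^ i * (\<i> * of_int (snd k)) ^ j * fcoeff f k"
proof (induction i)
  case 0
  show ?case
  proof (induction j)
    case (Suc j)
    have "fcoeff (mixed_partial 0 (Suc j) f) k = \<i> * of_int (snd k) * fcoeff (mixed_partial 0 j f) k"
      unfolding mixed_partial_Suc_y
      by (intro fcoeff_partial_y test_function_mixed_partial_differentiable torus_periodic_mixed_partial
          test_function_periodic f) (fold mixed_partial_Suc_y, rule continuous_on_mixed_partial[OF f])
    then show ?case using Suc by simp
  qed (simp add: mixed_partial_def)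
next
  case (Suc i)
  have "fcoeff (mixed_partial (Suc i) j f) k = \<i> * of_int (fst k) * fcoeff (mixed_partial i j f) k"
    unfolding mixed_partial_Suc_x
    by (intro fcoeff_partial_x test_function_mixed_partial_differentiable torus_periodic_mixed_partial
          test_function_periodic f) (fold mixed_partial_Suc_x, rule continuous_on_mixed_partial[OF f])
  then show ?case using Suc by simp
qed

text \<open>A product weight, so that summability of its inverse square over the lattice reduces to
  one variable; it dominates \<open>1 + freq_abs k\<close>.\<close>

definition box_weight :: "int \<times> int \<Rightarrow> real" where
  "box_weight k = (1 + \<bar>of_int (fst k)\<bar>) * (1 + \<bar>of_int (snd k)\<bar>)"

lemma box_weight_ge_1: "1 \<le> box_weight k"
  using mult_mono[of 1 "1 + \<bar>real_of_int (fst k)\<bar>" 1 "1 + \<bar>real_of_int (snd k)\<bar>"]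
  by (simp add: box_weight_def)

lemma continuous_torus_bounded:
  fixes f :: "real \<times> real \<Rightarrow> complex"
  assumes "continuous_on UNIV f"
  obtains M where "0 \<le> M" "\<And>p. p \<in> space torus \<Longrightarrow> cmod (f p) \<le> M"
proof -
  have "compact (f ` ({0..2 * pi} \<times> {0..2 * pi}))"
    by (intro compact_continuous_image compact_Times continuous_on_subset[OF assms]) auto
  then obtain M where "\<forall>x\<in>f ` ({0..2 * pi} \<times> {0..2 * pi}). cmod x \<le> M"
    using compact_imp_bounded bounded_iff by metis
  then show ?thesis
    by (intro that[of "max 0 M"]) (auto simp: space_torus intro: max.coboundedI2)
qed

lemma one_plus_power_le:
  assumes "0 \<le> (a :: real)"
  shows "(1 + a) ^ N \<le> 2 ^ N * (1 + a ^ N)"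
proof (cases "a \<le> 1")
  case True
  then have "(1 + a) ^ N \<le> 2 ^ N" using assms by (intro power_mono) auto
  also have "\<dots> \<le> 2 ^ N * (1 + a ^ N)" using assms by simp
  finally show ?thesis .
next
  case False
  then have "(1 + a) ^ N \<le> (2 * a) ^ N" by (intro power_mono) auto
  also have "\<dots> \<le> 2 ^ N * (1 + a ^ N)" by (simp add: power_mult_distrib)
  finally show ?thesis .
qed

text \<open>The coefficient of a mixed partial is that of \<open>f\<close> times a monomial in the
  frequency, and an integral of the modulus bounds it. Expanding
  \<open>(1 + a ^ N) * (1 + b ^ N)\<close> leaves the four monomials with exponents 0 or N;
  \<open>4 ^ N\<close> is the product of the two constants from
  \<open>one_plus_power_le\<close>.\<close>

lemma fcoeff_decay:
  assumes f: "test_function f"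
  obtains C where "\<And>k. cmod (fcoeff f k) * box_weight k ^ N \<le> C"
proof -
  define B where "B i j = (\<integral>p. cmod (mixed_partial i j f p) \<partial>torus)" for i j
  have b: "\<bar>real_of_int (fst k)\<bar> ^ i * \<bar>real_of_int (snd k)\<bar> ^ j * cmod (fcoeff f k) \<le> B i j" for i j k
    using fcoeff_bound[OF integrable_torus_continuous[OF continuous_on_mixed_partial[OF f]], of i j k]
    by (simp add: fcoeff_mixed_partial[OF f] norm_mult norm_power B_def)
  show ?thesis
  proof (rule that[of "4 ^ N * (B 0 0 + B N 0 + B 0 N + B N N)"])
    fix k
    let ?a = "\<bar>real_of_int (fst k)\<bar>" and ?b = "\<bar>real_of_int (snd k)\<bar>" and ?c = "cmod (fcoeff f k)"
    have "box_weight k ^ N = (1 + ?a) ^ N * (1 + ?b) ^ N"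
      by (simp add: box_weight_def power_mult_distrib)
    also have "\<dots> \<le> (2 ^ N * (1 + ?a ^ N)) * (2 ^ N * (1 + ?b ^ N))"
      by (intro mult_mono one_plus_power_le) auto
    also have "\<dots> = 4 ^ N * ((1 + ?a ^ N) * (1 + ?b ^ N))"
      by (simp add: power_mult_distrib[symmetric])
    finally have "?c * box_weight k ^ N \<le> ?c * (4 ^ N * ((1 + ?a ^ N) * (1 + ?b ^ N)))"
      by (intro mult_left_mono) auto
    also have "\<dots> = 4 ^ N * (?a ^ 0 * ?b ^ 0 * ?c + ?a ^ N * ?b ^ 0 * ?c + ?a ^ 0 * ?b ^ N * ?c + ?a ^ N * ?b ^ N * ?c)"
      by (simp add: algebra_simps)
    also have "\<dots> \<le> 4 ^ N * (B 0 0 + B N 0 + B 0 N + B N N)"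
      by (intro mult_left_mono add_mono b) auto
    finally show "?c * box_weight k ^ N \<le> 4 ^ N * (B 0 0 + B N 0 + B 0 N + B N N)" .
  qed
qed

lemma summable_inverse_square_int: "(\<lambda>n::int. 1 / (1 + \<bar>real_of_int n\<bar>) ^ 2) summable_on UNIV"
proof -
  let ?g = "\<lambda>n::int. 1 / (1 + \<bar>real_of_int n\<bar>) ^ 2"
  have s: "(\<lambda>n. 1 / real (Suc n) ^ 2) summable_on UNIV"
    using inverse_power_summable[of 2, where 'a = real]
    by (intro norm_summable_imp_summable_on)
       (simp add: summable_Suc_iff[of "\<lambda>n. inverse (real n ^ 2)"] divide_inverse del: of_nat_Suc)
  have "?g summable_on range int"
    using s by (subst summable_on_reindex) (auto simp: o_def add_ac inj_on_def)
  moreover have "?g summable_on range (\<lambda>n. - int (Suc n))"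
  proof (subst summable_on_reindex)
    show "?g \<circ> (\<lambda>n. - int (Suc n)) summable_on UNIV"
      by (rule summable_on_comparison_test[OF s]) (auto simp: o_def intro!: divide_left_mono power_mono)
  qed (auto simp: inj_on_def)
  ultimately have "?g summable_on (range int \<union> range (\<lambda>n. - int (Suc n)))"
    by (rule summable_on_Un_disjoint) auto
  moreover have "x \<in> range int \<union> range (\<lambda>n. - int (Suc n))" for x
    by (cases x rule: int_cases) auto
  then have "range int \<union> range (\<lambda>n. - int (Suc n)) = UNIV"
    by auto
  ultimately show ?thesis by simp
qed

lemma summable_box_weight: "(\<lambda>k. 1 / box_weight k ^ 2) summable_on UNIV"
proof -
  let ?g = "\<lambda>n::int. 1 / (1 + \<bar>real_of_int n\<bar>) ^ 2"
  have "(\<lambda>k. 1 / box_weight k ^ 2) summable_on (UNIV \<times> UNIV)"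
  proof (rule summable_on_SigmaI)
    show "((\<lambda>y. 1 / box_weight (x, y) ^ 2) has_sum (?g x * infsum ?g UNIV)) UNIV" for x
      using has_sum_cmult_right[OF has_sum_infsum[OF summable_inverse_square_int], of "?g x"]
      by (simp add: box_weight_def power_mult_distrib)
    show "(\<lambda>x. ?g x * infsum ?g UNIV) summable_on UNIV"
      by (intro summable_on_cmult_left summable_inverse_square_int)
  qed auto
  then show ?thesis by simp
qed

lemma summable_fcoeff_weighted:
  assumes f: "test_function f"
  shows "(\<lambda>k. box_weight k ^ N * cmod (fcoeff f k)) summable_on UNIV"
proof -
  \<comment> \<open>Two of the powers of decay are kept to pay for summability over the
    lattice.\<close>
  obtain C where C: "\<And>k. cmod (fcoeff f k) * box_weight k ^ (N + 2) \<le> C"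
    using fcoeff_decay[OF f] by blast
  show ?thesis
  proof (rule summable_on_comparison_test)
    show "(\<lambda>k. C * (1 / box_weight k ^ 2)) summable_on UNIV"
      by (intro summable_on_cmult_right summable_box_weight)
    show "box_weight k ^ N * cmod (fcoeff f k) \<le> C * (1 / box_weight k ^ 2)" for k
      using C[of k] box_weight_ge_1[of k] by (simp add: power_add field_simps power2_eq_square)
    show "0 \<le> box_weight k ^ N * cmod (fcoeff f k)" for k
      using box_weight_ge_1[of k] by simp
  qed
qed

section \<open>Uniqueness and convergence of Fourier series\<close>

definition freq_box :: "nat \<Rightarrow> (int \<times> int) set" where
  "freq_box n = {- int n..int n} \<times> {- int n..int n}"

lemma finite_freq_box [simp]: "finite (freq_box n)"
  by (simp add: freq_box_def)

lemma freq_box_exhaust: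
  assumes "finite F"
  shows "\<forall>\<^sub>F n in sequentially. F \<subseteq> freq_box n"
proof -
  have "\<forall>\<^sub>F n in sequentially. k \<in> freq_box n" for k
    unfolding eventually_sequentially
    by (rule exI[of _ "nat (max \<bar>fst k\<bar> \<bar>snd k\<bar>)"]) (auto simp: freq_box_def mem_Times_iff)
  then show ?thesis
    using eventually_ball_finite[OF assms, of "\<lambda>n k. k \<in> freq_box n"]
    by (simp add: subset_eq)
qed

text \<open>Squares are cofinal among finite sets, so unordered sums can be replaced with limits of
  sequences; dominated convergence and the continuity of distributions are sequential.\<close>

lemma filterlim_freq_box: "filterlim freq_box (finite_subsets_at_top UNIV) sequentially"
  unfolding filterlim_finite_subsets_at_top using freq_box_exhaust by auto

lemma fcoeff_uniform_limit:
  assumes "uniform_limit UNIV S F sequentially" and S: "\<And>n. continuous_on UNIV (S n)"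
  shows "(\<lambda>n. fcoeff (S n) k) \<longlonglongrightarrow> fcoeff F k" and "continuous_on UNIV F"
proof -
  show F: "continuous_on UNIV F"
    by (rule uniform_limit_theorem[OF _ assms(1)]) (auto simp: S)
  show "(\<lambda>n. fcoeff (S n) k) \<longlonglongrightarrow> fcoeff F k"
    unfolding fcoeff_def
  proof (intro tendsto_divide tendsto_const)
    obtain M where M: "\<And>p. p \<in> space torus \<Longrightarrow> cmod (F p) \<le> M"
      using continuous_torus_bounded[OF F] by blast
    obtain N where N: "\<And>n p. n \<ge> N \<Longrightarrow> dist (S n p) (F p) < 1"
      using assms(1)[unfolded uniform_limit_iff, rule_format, of 1] by (auto simp: eventually_sequentially)
    have "(\<lambda>n. \<integral>p. S (n + N) p * tchar (- k) p \<partial>torus) \<longlonglongrightarrow> (\<integral>p. F p * tchar (- k) p \<partial>torus)"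
    proof (rule integral_dominated_convergence[where w = "\<lambda>p. M + 1"])
      show "AE p in torus. cmod (S (n + N) p * tchar (- k) p) \<le> M + 1" for n
      proof (rule AE_I2)
        fix p assume "p \<in> space torus"
        then show "cmod (S (n + N) p * tchar (- k) p) \<le> M + 1"
          using M[of p] N[of "n + N" p] norm_triangle_sub[of "S (n + N) p" "F p"]
          by (simp add: norm_mult dist_norm)
      qed
      show "AE p in torus. (\<lambda>n. S (n + N) p * tchar (- k) p) \<longlonglongrightarrow> F p * tchar (- k) p"
        by (intro AE_I2 tendsto_mult tendsto_const LIMSEQ_ignore_initial_segment tendsto_uniform_limitI[OF assms(1)]) auto
    qed (auto intro!: borel_measurable_integrable integrable_torus_continuous continuous_intros S F)
    then show "(\<lambda>n. \<integral>p. S n p * tchar (- k) p \<partial>torus) \<longlonglongrightarrow> (\<integral>p. F p * tchar (- k) p \<partial>torus)"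
      by (rule LIMSEQ_offset)
  qed auto
qed

text \<open>If \<open>f\<close> did not vanish at \<open>(x\<^sub>0, y\<^sub>0)\<close>, integrating it against large powers of the
  trigonometric polynomial \<open>\<epsilon> + (1 + cos (x - x\<^sub>0)) (1 + cos (y - y\<^sub>0)) / 4\<close>, which exceeds 1 only
  near that point, would give arbitrarily large values.\<close>

lemma fcoeff_zero_imp_zero_interior:
  assumes c: "continuous_on UNIV f" and z: "\<And>k. fcoeff f k = 0"
    and x0: "x0 \<in> {0<..<2 * pi}" and y0: "y0 \<in> {0<..<2 * pi}"
  shows "f (x0, y0) = 0"
proof (rule ccontr)
  assume nz: "f (x0, y0) \<noteq> 0"
  define w where "w = (\<lambda>(x, y). (1 + cos (x - x0)) * (1 + cos (y - y0)) / 4)"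
  \<comment> \<open>Multiplying \<open>f\<close> by the conjugate of its value at the base point
    makes the value there real and positive.\<close>
  define \<phi> where "\<phi> p = Re (cnj (f (x0, y0)) * f p)" for p
  define a where "a = \<phi> (x0, y0) / 2"
  have "\<phi> (x0, y0) = (cmod (f (x0, y0)))\<^sup>2"
    by (simp add: \<phi>_def cmod_power2) (simp add: power2_eq_square)
  then have a: "0 < a" using nz by (simp add: a_def)
  have c\<phi>: "continuous_on UNIV \<phi>" unfolding \<phi>_def by (intro continuous_intros c)
  have cw: "continuous_on S w" for S unfolding w_def case_prod_beta by (intro continuous_intros) auto
  have cos2: "0 \<le> 1 + cos z" "1 + cos z \<le> 2" for z :: real
    using cos_ge_minus_one[of z] cos_le_one[of z] by linarith+
  have w0: "0 \<le> w p" for p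
    unfolding w_def case_prod_beta by (intro divide_nonneg_pos mult_nonneg_nonneg cos2) auto
  let ?Q = "{0..2 * pi} \<times> {0..2 * pi}"
  define U where "U = {p. a < \<phi> p} \<inter> ({0<..<2 * pi} \<times> {0<..<2 * pi})"
  have oU: "open U" unfolding U_def
    by (intro open_Int open_Times open_Collect_less c\<phi> continuous_intros)
  \<comment> \<open>\<open>U\<close> avoids the boundary of the square, so the complement contains
    the corner and \<open>w\<close> attains a maximum on it.\<close>
  have "compact (?Q - U)" "(0, 0) \<in> ?Q - U"
    by (intro compact_diff compact_Times oU) (auto simp: U_def)
  then obtain q where q: "q \<in> ?Q - U" "\<And>p. p \<in> ?Q - U \<Longrightarrow> w p \<le> w q"
    using continuous_attains_sup[OF _ _ cw, of "?Q - U"] by blast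
  \<comment> \<open>The value 1 forces both cosines to be 1. Because the base point is interior, the
    differences of coordinates stay below one period, and only the base point itself
    qualifies.\<close>
  have "w q < 1"
  proof (rule ccontr)
    assume "\<not> w q < 1"
    then have "(1 + cos (fst q - x0)) * (1 + cos (snd q - y0)) \<ge> 4"
      by (simp add: w_def case_prod_beta)
    moreover have "(1 + cos (fst q - x0)) * (1 + cos (snd q - y0)) \<le> (1 + cos (fst q - x0)) * 2"
      "(1 + cos (fst q - x0)) * (1 + cos (snd q - y0)) \<le> 2 * (1 + cos (snd q - y0))"
      by (intro mult_left_mono mult_right_mono cos2)+
    ultimately have "4 \<le> (1 + cos (fst q - x0)) * 2" "4 \<le> 2 * (1 + cos (snd q - y0))"
      by (blast intro: order_trans)+
    then have "cos (fst q - x0) = 1 \<and> cos (snd q - y0) = 1"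
      using cos_le_one[of "fst q - x0"] cos_le_one[of "snd q - y0"] by auto
    moreover have "z = 0" if z: "cos z = 1" "\<bar>z\<bar> < 2 * pi" for z :: real
    proof -
      obtain n :: int where n: "z = of_int n * (2 * pi)"
        using z(1) unfolding cos_one_2pi_int by auto
      with z(2) have "\<bar>real_of_int n\<bar> < 1" by (simp add: abs_mult)
      then show ?thesis using n by simp
    qed
    ultimately have "fst q = x0 \<and> snd q = y0"
      using q(1) x0 y0 by (force simp: mem_Times_iff)
    then have "q = (x0, y0)" by (cases q) auto
    then have "q \<in> U" using a x0 y0 by (simp add: U_def a_def)
    with q(1) show False by simp
  qed
  \<comment> \<open>With this \<epsilon> the kernel \<open>K\<close> is at most 1 outside
    \<open>U\<close> within the square and equals \<open>1 + \<epsilon>\<close> at the base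
    point.\<close>
  define \<epsilon> where "\<epsilon> = 1 - w q"
  have \<epsilon>: "0 < \<epsilon>" using \<open>w q < 1\<close> by (simp add: \<epsilon>_def)
  define K where "K p = \<epsilon> + w p" for p
  have cK: "continuous_on UNIV K" unfolding K_def by (intro continuous_intros cw)
  define V where "V = U \<inter> {p. 1 + \<epsilon> / 2 < K p}"
  have oV: "open V" unfolding V_def by (intro open_Int oU open_Collect_less continuous_intros cK)
  have "(x0, y0) \<in> V" using a x0 y0 \<epsilon> by (simp add: V_def U_def K_def w_def a_def)
  then have "\<not> negligible V" using oV open_not_negligible by blast
  then have "emeasure lborel V \<noteq> 0"
    using oV by (auto simp: negligible_iff_null_sets null_sets_completion_iff null_sets_def)
  moreover have VQ: "V \<subseteq> ?Q"
    by (auto simp: V_def U_def)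
  moreover have V: "V \<in> sets torus"
    using oV VQ unfolding torus_eq sets_restrict_space by (intro image_eqI[of _ _ V]) auto
  moreover have "emeasure torus V = emeasure lborel V"
    using oV VQ unfolding torus_eq by (intro emeasure_restrict_space) (auto simp: square_borel)
  ultimately have "measure torus V \<noteq> 0"
    by (metis ennreal_0 torus.emeasure_eq_measure)
  then have mV: "0 < measure torus V"
    by (simp add: zero_less_measure_iff)
  obtain M where M: "0 \<le> M" "\<And>p. p \<in> space torus \<Longrightarrow> \<bar>\<phi> p\<bar> \<le> M"
    using continuous_torus_bounded[of "\<lambda>p. of_real (\<phi> p)"] c\<phi> by (auto intro: continuous_intros)
  \<comment> \<open>The Fourier coefficients of \<open>1 + cos (x - z)\<close>, a trigonometric
    polynomial with frequencies -1, 0 and 1.\<close>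
  define \<alpha> where "\<alpha> z n = (if n = 0 then 1 else wave (- n) z / 2)" for z and n :: int
  have cos_wave: "of_real (1 + cos (x - z)) = (\<Sum>n\<in>{-1, 0, 1}. \<alpha> z n * wave n x)" for x z
    by (simp add: \<alpha>_def wave_def cos_of_real[symmetric] cos_exp_eq exp_add[symmetric] algebra_simps add_divide_distrib)
  define L :: "(int \<times> int) set" where "L = {-1, 0, 1} \<times> {-1, 0, 1}"
  define \<beta> where "\<beta> l = \<alpha> x0 (fst l) * \<alpha> y0 (snd l) / 4" for l
  have K_eq: "of_real (K p) = of_real \<epsilon> * tchar 0 p + (\<Sum>l\<in>L. \<beta> l * tchar l p)" for p
  proof (cases p)
    case (Pair x y)
    have "complex_of_real (K p) = of_real \<epsilon> + of_real (1 + cos (x - x0)) * of_real (1 + cos (y - y0)) / 4"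
      by (simp add: K_def w_def Pair)
    also have "of_real (1 + cos (x - x0)) * of_real (1 + cos (y - y0)) / 4 = (\<Sum>l\<in>L. \<beta> l * tchar l p)"
      unfolding cos_wave sum_product L_def sum.cartesian_product sum_divide_distrib
      by (intro sum.cong) (auto simp: \<beta>_def tchar_def tensor_def Pair)
    finally show ?thesis by simp
  qed
  have int: "integrable torus (\<lambda>p. f p * of_real (K p ^ n) * tchar k p)" for n k
    by (intro integrable_torus_continuous continuous_intros c cK)
  \<comment> \<open>Multiplication by the kernel only shifts characters by elements of
    \<open>L\<close>; the induction therefore quantifies over all characters.\<close>
  have zero: "(\<integral>p. f p * of_real (K p ^ n) * tchar k p \<partial>torus) = 0" for n k
  proof (induction n arbitrary: k)
    case 0
    then show ?case using z[of "- k"] by (simp add: fcoeff_def)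
  next
    case (Suc n)
    have "(\<lambda>p. f p * of_real (K p ^ Suc n) * tchar k p) =
      (\<lambda>p. of_real \<epsilon> * (f p * of_real (K p ^ n) * tchar k p) +
        (\<Sum>l\<in>L. \<beta> l * (f p * of_real (K p ^ n) * tchar (l + k) p)))"
      by (auto simp: K_eq tchar_add sum_distrib_left sum_distrib_right algebra_simps intro!: sum.cong)
    then show ?case
      using Suc int by (simp add: Bochner_Integration.integral_add Bochner_Integration.integral_sum)
  qed
  have intR: "integrable torus (\<lambda>p. \<phi> p * K p ^ n)" for n
  proof -
    have "integrable torus (\<lambda>p. Re (cnj (f (x0, y0)) * (f p * of_real (K p ^ n) * tchar 0 p)))"
      by (intro integrable_Re integrable_mult_right int)
    then show ?thesis by (simp add: \<phi>_def algebra_simps)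
  qed
  have iV: "integrable torus (\<lambda>p. a * (1 + \<epsilon> / 2) ^ n * indicator V p)" for n
    by (intro integrable_mult_right integrable_real_indicator V) (simp add: torus.emeasure_eq_measure)
  \<comment> \<open>The integrand is at least \<open>a * (1 + \<epsilon> / 2) ^ n\<close> on
    \<open>V\<close>, nonnegative on the rest of \<open>U\<close> and at least \<open>- M\<close>
    elsewhere, while its integral is 0.\<close>
  have "a * (1 + \<epsilon> / 2) ^ n * measure torus V \<le> M * measure torus (space torus)" for n
  proof -
    have "0 = Re (cnj (f (x0, y0)) * (\<integral>p. f p * of_real (K p ^ n) * tchar 0 p \<partial>torus))"
      by (simp only: zero) simp
    also have "\<dots> = (\<integral>p. Re (cnj (f (x0, y0)) * (f p * of_real (K p ^ n) * tchar 0 p)) \<partial>torus)"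
      using int[of n 0] by (subst integral_Re) auto
    also have "\<dots> = (\<integral>p. \<phi> p * K p ^ n \<partial>torus)"
      by (intro Bochner_Integration.integral_cong) (auto simp: \<phi>_def algebra_simps)
    also have "\<dots> \<ge> (\<integral>p. a * (1 + \<epsilon> / 2) ^ n * indicator V p - M \<partial>torus)"
    proof (rule integral_mono[OF _ intR])
      fix p assume p: "p \<in> space torus"
      have K0: "0 \<le> K p" using w0[of p] \<epsilon> by (simp add: K_def)
      consider "p \<in> V" | "p \<in> U" "p \<notin> V" | "p \<notin> U" by (auto simp: V_def)
      then show "a * (1 + \<epsilon> / 2) ^ n * indicator V p - M \<le> \<phi> p * K p ^ n"
      proof cases
        case 1
        then have "a * (1 + \<epsilon> / 2) ^ n \<le> \<phi> p * K p ^ n"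
          using a \<epsilon> by (intro mult_mono power_mono) (auto simp: V_def U_def)
        then show ?thesis using 1 M(1) by simp
      next
        case 2
        then have "0 \<le> \<phi> p * K p ^ n" using a K0 by (intro mult_nonneg_nonneg) (auto simp: U_def)
        then show ?thesis using 2 M(1) by simp
      next
        case 3
        then have "K p \<le> 1" using q(2)[of p] p by (simp add: K_def \<epsilon>_def space_torus)
        then have "\<bar>\<phi> p * K p ^ n\<bar> \<le> M * 1"
          unfolding abs_mult using K0 M(2)[OF p] by (intro mult_mono) (auto simp: power_le_one)
        then show ?thesis using 3 by (auto simp: V_def)
      qed
    qed (intro Bochner_Integration.integrable_diff torus.integrable_const iV)
    also have "(\<integral>p. a * (1 + \<epsilon> / 2) ^ n * indicator V p - M \<partial>torus) =
      a * (1 + \<epsilon> / 2) ^ n * measure torus V - M * measure torus (space torus)"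
      using V by (subst Bochner_Integration.integral_diff[OF iV torus.integrable_const]) simp
    finally show ?thesis by simp
  qed
  then have *: "(1 + \<epsilon> / 2) ^ n \<le> M * measure torus (space torus) / (a * measure torus V)" for n
    using a mV by (simp add: field_simps)
  obtain n where "M * measure torus (space torus) / (a * measure torus V) < (1 + \<epsilon> / 2) ^ n"
    using real_arch_pow[of "1 + \<epsilon> / 2"] \<epsilon> by auto
  with * show False by (meson not_le)
qed

text \<open>The interior case passes to the closed square by continuity and to the plane by
  periodicity.\<close>

lemma fcoeff_zero_imp_zero:
  assumes c: "continuous_on UNIV f" and p: "torus_periodic f" and z: "\<And>k. fcoeff f k = 0"
  shows "f p = 0"
proof -
  let ?I = "{0<..<2 * pi} \<times> {0<..<2 * pi}"
  have *: "f (x, y) = 0" if "x \<in> {0..2 * pi}" "y \<in> {0..2 * pi}" for x y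
  proof -
    have "f q = 0" if "q \<in> closure ?I" for q
    proof (rule continuous_constant_on_closure[OF _ _ that])
      show "continuous_on (closure ?I) f" using c continuous_on_subset by blast
      show "f q = 0" if "q \<in> ?I" for q
        using fcoeff_zero_imp_zero_interior[OF c z] that by (cases q) auto
    qed
    then show ?thesis using that by (simp add: closure_Times)
  qed
  have per: "g (x + 2 * pi * of_int n) = g x" if "\<And>x. g (x + 2 * pi) = g x" for g :: "real \<Rightarrow> complex" and n x
  proof (induction n rule: int_induct[where k = 0])
    case (step1 i)
    then show ?case using that[of "x + 2 * pi * of_int i"] by (simp add: algebra_simps)
  next
    case (step2 i)
    then show ?case using that[of "x + 2 * pi * of_int (i - 1)"] by (simp add: algebra_simps)
  qed simp
  have rep: "\<exists>n::int. x + 2 * pi * of_int n \<in> {0..2 * pi}" for x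
  proof
    have "of_int \<lfloor>x / (2 * pi)\<rfloor> \<le> x / (2 * pi)" "x / (2 * pi) \<le> of_int \<lfloor>x / (2 * pi)\<rfloor> + 1"
      by linarith+
    then have "of_int \<lfloor>x / (2 * pi)\<rfloor> * (2 * pi) \<le> x" "x \<le> (of_int \<lfloor>x / (2 * pi)\<rfloor> + 1) * (2 * pi)"
      by (simp_all only: pos_le_divide_eq pos_divide_le_eq pi_gt_zero mult_pos_pos zero_less_numeral)
    then show "x + 2 * pi * of_int (- \<lfloor>x / (2 * pi)\<rfloor>) \<in> {0..2 * pi}"
      by (simp add: algebra_simps)
  qed
  obtain x y where xy: "p = (x, y)" by (cases p)
  obtain m n where "x + 2 * pi * of_int m \<in> {0..2 * pi}" "y + 2 * pi * of_int n \<in> {0..2 * pi}"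
    using rep by metis
  then show ?thesis
    using * per[of "\<lambda>x. f (x, y)" x m] per[of "\<lambda>y. f (x + 2 * pi * of_int m, y)" y n] p
    unfolding xy torus_periodic_def by metis
qed

text \<open>The Weierstrass test gives a continuous limit with the coefficients of \<open>f\<close>;
  that the limit is \<open>f\<close> is the uniqueness result applied to the difference.\<close>

lemma fourier_series_uniform:
  assumes c: "continuous_on UNIV f" and p: "torus_periodic f"
    and s: "(\<lambda>k. cmod (fcoeff f k)) summable_on UNIV"
  shows "uniform_limit UNIV (\<lambda>n p. \<Sum>k\<in>freq_box n. fcoeff f k * tchar k p) f sequentially"
proof -
  define F where "F p = (\<Sum>\<^sub>\<infinity>k. fcoeff f k * tchar k p)" for p
  define S where "S n p = (\<Sum>k\<in>freq_box n. fcoeff f k * tchar k p)" for n p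
  have "uniform_limit UNIV (\<lambda>X p. \<Sum>k\<in>X. fcoeff f k * tchar k p) F (finite_subsets_at_top UNIV)"
    unfolding F_def by (rule Weierstrass_m_test_general[OF _ s]) (simp add: norm_mult)
  then have u: "uniform_limit UNIV S F sequentially"
    unfolding S_def uniform_limit_iff using filterlim_freq_box
    by (auto simp: filterlim_iff simp del: split_paired_All)
  have cS: "continuous_on UNIV (S n)" for n unfolding S_def by (intro continuous_intros)
  note cF = fcoeff_uniform_limit(2)[OF u cS]
  have lin: "fcoeff (\<lambda>p. \<Sum>l\<in>A. a l * tchar l p) k = (\<Sum>l\<in>A. a l * fcoeff (tchar l) k)" if "finite A" for A a k
    using that
  proof (induction A rule: finite_induct)
    case (insert l A)
    then show ?case
      using fcoeff_linear[of "tchar l" "\<lambda>p. \<Sum>l\<in>A. a l * tchar l p" "a l" 1 k]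
      by (simp add: integrable_torus_continuous continuous_intros)
  qed (simp add: fcoeff_def)
  have "fcoeff F k = fcoeff f k" for k
  proof (rule LIMSEQ_unique[OF fcoeff_uniform_limit(1)[OF u cS]])
    have "\<forall>\<^sub>F n in sequentially. fcoeff (S n) k = fcoeff f k"
      using freq_box_exhaust[of "{k}", simplified]
      by (rule eventually_mono) (simp add: S_def[abs_def] lin fcoeff_tchar mult_delta_right)
    then show "(\<lambda>n. fcoeff (S n) k) \<longlonglongrightarrow> fcoeff f k" by (rule tendsto_eventually)
  qed
  then have "fcoeff (\<lambda>p. 1 * F p + (-1) * f p) k = 0" for k
    by (subst fcoeff_linear) (auto intro!: integrable_torus_continuous c cF)
  moreover have "torus_periodic F"
    unfolding torus_periodic_def F_def by (simp add: tchar_periodic)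
  ultimately have "1 * F p + (-1) * f p = 0" for p
    using p by (intro fcoeff_zero_imp_zero[of "\<lambda>p. 1 * F p + (-1) * f p"]) 
       (auto intro!: continuous_intros c cF simp: torus_periodic_def)
  then have "F = f" by (simp add: fun_eq_iff)
  with u show ?thesis by (simp add: S_def[abs_def])
qed

text \<open>Convergence is needed for all mixed partials, because that is the topology in which
  distributions are continuous. Differentiation costs polynomial factors, which the decay of the
  coefficients absorbs.\<close>

lemma test_tendsto_fourier:
  assumes f: "test_function f"
  shows "test_tendsto (\<lambda>n p. \<Sum>k\<in>freq_box n. fcoeff f k * tchar k p) f"
  unfolding test_tendsto_def
proof (intro allI)
  fix i j
  have "(\<lambda>k. cmod (fcoeff (mixed_partial i j f) k)) summable_on UNIV"
  proof (rule summable_on_comparison_test[OF summable_fcoeff_weighted[OF f, of "i + j"]])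
    fix k
    have "\<bar>real_of_int (fst k)\<bar> ^ i * \<bar>real_of_int (snd k)\<bar> ^ j \<le> box_weight k ^ i * box_weight k ^ j"
      by (intro mult_mono power_mono) 
         (auto simp: box_weight_def algebra_simps intro!: add_nonneg_nonneg mult_nonneg_nonneg)
    then show "cmod (fcoeff (mixed_partial i j f) k) \<le> box_weight k ^ (i + j) * cmod (fcoeff f k)"
      by (auto simp: fcoeff_mixed_partial[OF f] norm_mult norm_power power_add intro!: mult_right_mono)
  qed auto
  then have "uniform_limit UNIV (\<lambda>n p. \<Sum>k\<in>freq_box n. fcoeff (mixed_partial i j f) k * tchar k p)
      (mixed_partial i j f) sequentially"
    by (intro fourier_series_uniform continuous_on_mixed_partial f torus_periodic_mixed_partial test_function_periodic)
  moreover have "mixed_partial i j (\<lambda>p. \<Sum>k\<in>freq_box n. fcoeff f k * tchar k p) =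
      (\<lambda>p. \<Sum>k\<in>freq_box n. fcoeff (mixed_partial i j f) k * tchar k p)" for n
    using test_function_sum[of "freq_box n" "\<lambda>k. tchar k" "fcoeff f" i j] test_function_tchar
    by (simp add: mixed_partial_tchar fcoeff_mixed_partial[OF f] mult_ac)
  ultimately show "uniform_limit UNIV (\<lambda>n. mixed_partial i j (\<lambda>p. \<Sum>k\<in>freq_box n. fcoeff f k * tchar k p))
      (mixed_partial i j f) sequentially"
    by simp
qed

section \<open>Distributions and their Fourier coefficients\<close>

lemma pairing_linear:
  assumes "test_function f" "test_function g"
  shows "pairing u (\<lambda>p. c * f p + d * g p) = c * pairing u f + d * pairing u g"
proof -
  have "test_function (\<lambda>p. c * f p)" "test_function (\<lambda>p. d * g p)"
    using test_function_linear[OF assms(1) assms(1), of c 0] test_function_linear[OF assms(2) assms(2), of d 0]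
    by simp_all
  moreover have "\<forall>f g. test_function f \<longrightarrow> test_function g \<longrightarrow>
      pairing u (\<lambda>p. f p + g p) = pairing u f + pairing u g"
    "\<forall>c f. test_function f \<longrightarrow> pairing u (\<lambda>p. c * f p) = c * pairing u f"
    using is_distribution_pairing[of u] unfolding is_distribution_def by blast+
  ultimately show ?thesis
    using assms by metis
qed

lemma pairing_sum:
  assumes "finite A" "\<And>a. a \<in> A \<Longrightarrow> test_function (f a)"
  shows "pairing u (\<lambda>p. \<Sum>a\<in>A. c a * f a p) = (\<Sum>a\<in>A. c a * pairing u (f a))"
  using assms
proof (induction A rule: finite_induct)
  case empty
  show ?case using pairing_linear[OF test_function_tchar test_function_tchar, of u 0 undefined 0 undefined] by simp
next
  case (insert a A)
  then show ?case
    using pairing_linear[of "f a" "\<lambda>p. \<Sum>a\<in>A. c a * f a p" u "c a" 1] test_function_sum[of A f c]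
    by simp
qed

lemma fourier_coeff_eq: "fourier_coeff u k = pairing u (tchar (- k)) / (2 * pi)\<^sup>2"
proof -
  have "(\<lambda>(x, y). exp (- \<i> * of_real (of_int (fst k) * x + of_int (snd k) * y))) = tchar (- k)"
    by (auto simp: tchar_def tensor_def wave_def exp_add[symmetric] algebra_simps)
  then show ?thesis by (simp add: fourier_coeff_def)
qed

lemma pairing_fourier:
  assumes f: "test_function f"
  shows "(\<lambda>n. \<Sum>k\<in>freq_box n. fcoeff f k * ((2 * pi)\<^sup>2 * fourier_coeff u (- k))) \<longlonglongrightarrow> pairing u f"
proof -
  have "\<forall>F f. (\<forall>n. test_function (F n)) \<longrightarrow> test_function f \<longrightarrow> test_tendsto F f
      \<longrightarrow> (\<lambda>n. pairing u (F n)) \<longlonglongrightarrow> pairing u f"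
    using is_distribution_pairing[of u] unfolding is_distribution_def by blast
  moreover have "test_function (\<lambda>p. \<Sum>k\<in>freq_box n. fcoeff f k * tchar k p)" for n
    using test_function_sum[of "freq_box n" "\<lambda>k. tchar k" "fcoeff f"] test_function_tchar by simp
  ultimately have "(\<lambda>n. pairing u (\<lambda>p. \<Sum>k\<in>freq_box n. fcoeff f k * tchar k p)) \<longlonglongrightarrow> pairing u f"
    using test_tendsto_fourier[OF f] f by (elim allE impE) auto
  then show ?thesis
    by (simp add: pairing_sum test_function_tchar fourier_coeff_eq)
qed

text \<open>Trigonometric polynomials are dense in the test functions, and off the test functions
  distributions vanish by convention. The definite descriptions of multipliers and of the control
  operator are resolved through this lemma.\<close>

lemma distribution_eqI:
  assumes "\<And>k. fourier_coeff u k = fourier_coeff v k"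
  shows "u = v"
proof -
  have "pairing u f = pairing v f" for f
  proof (cases "test_function f")
    case True
    show ?thesis
      using LIMSEQ_unique[OF pairing_fourier[OF True, of u]] pairing_fourier[OF True, of v] by (simp add: assms)
  next
    case False
    then have "pairing u f = 0" for u
      using is_distribution_pairing[of u] unfolding is_distribution_def by blast
    then show ?thesis by simp
  qed
  then show ?thesis by (simp add: pairing_inject[symmetric] fun_eq_iff)
qed

lemma fourier_coeff_simps [simp]:
  "fourier_coeff 0 k = 0"
  "fourier_coeff (u + v) k = fourier_coeff u k + fourier_coeff v k"
  "fourier_coeff (r *\<^sub>R u) k = r *\<^sub>R fourier_coeff u k"
  "fourier_coeff (u - v) k = fourier_coeff u k - fourier_coeff v k"
  by (simp_all add: fourier_coeff_def pairing_zero pairing_add pairing_scaleR pairing_diff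
      add_divide_distrib diff_divide_distrib scaleR_conv_of_real)

section \<open>Square-integrable functions and distributions\<close>

text \<open>Completeness in mean square. The limit is exported as a pointwise \<open>lim\<close>
  along a subsequence, not just as some function, so that exact periodicity of the approximants is
  inherited everywhere.\<close>

lemma L2_complete:
  fixes f :: "nat \<Rightarrow> 'a \<Rightarrow> complex"
  assumes [measurable]: "\<And>n. f n \<in> borel_measurable M"
    and cauchy: "\<And>e. 0 < e \<Longrightarrow> \<exists>N. \<forall>m\<ge>N. \<forall>n\<ge>N. (\<integral>\<^sup>+x. ennreal ((cmod (f m x - f n x))\<^sup>2) \<partial>M) \<le> ennreal e"
  obtains r F where "F = (\<lambda>x. lim (\<lambda>n. f (r n) x))" "F \<in> borel_measurable M"
    "(\<lambda>n. \<integral>\<^sup>+x. ennreal ((cmod (f n x - F x))\<^sup>2) \<partial>M) \<longlonglongrightarrow> 0"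
proof -
  \<comment> \<open>Tolerances \<open>(1 / 4) ^ k\<close> stay summable after multiplication with
    the weights \<open>2 ^ k\<close> used below.\<close>
  define P where "P k N \<longleftrightarrow> (\<forall>m\<ge>N. \<forall>n\<ge>N. (\<integral>\<^sup>+x. ennreal ((cmod (f m x - f n x))\<^sup>2) \<partial>M) \<le> ennreal ((1 / 4) ^ k))" for k N
  have P: "\<exists>N. P k N" for k unfolding P_def by (rule cauchy) simp
  have P_mono: "P k N \<Longrightarrow> N \<le> N' \<Longrightarrow> P k N'" for k N N' unfolding P_def by auto
  have "\<exists>r. \<forall>n. P n (r n) \<and> r n < r (Suc n)"
  proof (rule dependent_nat_choice)
    show "\<exists>x. P 0 x" by (rule P)
    fix x n
    obtain N where "P (Suc n) N" using P by blast
    then show "\<exists>y. P (Suc n) y \<and> x < y"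
      using P_mono[of "Suc n" N "max N (Suc x)"] by (intro exI[of _ "max N (Suc x)"]) auto
  qed
  then obtain r where r: "\<And>n. P n (r n)" "\<And>n. r n < r (Suc n)" by blast
  then have mono: "strict_mono r" by (simp add: strict_mono_Suc_iff)
  define F where "F x = lim (\<lambda>n. f (r n) x)" for x
  have F [measurable]: "F \<in> borel_measurable M"
    unfolding F_def by (rule borel_measurable_lim_metric) simp
  define D where "D n x = (cmod (f (r (Suc n)) x - f (r n) x))\<^sup>2" for n x
  have [measurable]: "D n \<in> borel_measurable M" for n unfolding D_def by measurable
  have "(\<integral>\<^sup>+x. (\<Sum>n. ennreal (2 ^ n * D n x)) \<partial>M) = (\<Sum>n. \<integral>\<^sup>+x. ennreal (2 ^ n * D n x) \<partial>M)"
    by (intro nn_integral_suminf) measurable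
  also have "\<dots> \<le> (\<Sum>n. ennreal ((1 / 2) ^ n))"
  proof (rule suminf_le)
    fix n
    have "(\<integral>\<^sup>+x. ennreal (2 ^ n * D n x) \<partial>M) = ennreal (2 ^ n) * (\<integral>\<^sup>+x. ennreal (D n x) \<partial>M)"
      by (simp add: ennreal_mult' nn_integral_cmult)
    also have "\<dots> \<le> ennreal (2 ^ n) * ennreal ((1 / 4) ^ n)"
      using r(1)[of n] r(2)[of n] unfolding P_def D_def by (intro mult_left_mono) auto
    also have "\<dots> = ennreal ((1 / 2) ^ n)"
      by (simp add: ennreal_mult'[symmetric] power_mult_distrib[symmetric])
    finally show "(\<integral>\<^sup>+x. ennreal (2 ^ n * D n x) \<partial>M) \<le> ennreal ((1 / 2) ^ n)" .
  qed auto
  also have "\<dots> < \<infinity>"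
    by (subst suminf_ennreal_eq[of _ 2]) (use power_half_series geometric_sums[of "1/2 :: real"] in auto)
  finally have "AE x in M. (\<Sum>n. ennreal (2 ^ n * D n x)) \<noteq> \<infinity>"
    by (intro nn_integral_noteq_infinite) auto
  then have conv: "AE x in M. (\<lambda>n. f (r n) x) \<longlonglongrightarrow> F x"
  proof eventually_elim
    fix x assume "(\<Sum>n. ennreal (2 ^ n * D n x)) \<noteq> \<infinity>"
    then have "summable (\<lambda>n. 2 ^ n * D n x)"
      by (intro summable_suminf_not_top) (auto simp: D_def)
    then obtain C where "\<forall>n. norm (2 ^ n * D n x) \<le> C"
      using summable_imp_Bseq unfolding Bseq_def by blast
    then have C: "2 ^ n * D n x \<le> C" for n
      by (metis abs_le_D1 real_norm_def)
    \<comment> \<open>Bounded weighted squares force geometric decay of the increments, hence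
      convergence at this point.\<close>
    have "cmod (f (r (Suc n)) x - f (r n) x) \<le> sqrt C * (1 / sqrt 2) ^ n" for n
    proof -
      have "D n x \<le> C * (1 / 2) ^ n" using C[of n] by (simp add: field_simps)
      then have "sqrt (D n x) \<le> sqrt (C * (1 / 2) ^ n)" by simp
      then show ?thesis by (simp add: D_def real_sqrt_mult real_sqrt_power real_sqrt_divide)
    qed
    moreover have "summable (\<lambda>n. sqrt C * (1 / sqrt 2) ^ n)"
      by (intro summable_mult summable_geometric) simp
    ultimately have "summable (\<lambda>n. f (r (Suc n)) x - f (r n) x)"
      by (rule summable_comparison_test'[rotated, where N = 0])
    then have "(\<lambda>n. (\<Sum>i<n. f (r (Suc i)) x - f (r i) x) + f (r 0) x) \<longlonglongrightarrow> suminf (\<lambda>n. f (r (Suc n)) x - f (r n) x) + f (r 0) x"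
      by (intro tendsto_add summable_LIMSEQ tendsto_const)
    then have "convergent (\<lambda>n. f (r n) x)"
      by (auto simp: sum_lessThan_telescope[of "\<lambda>n. f (r n) x"] convergent_def)
    then show "(\<lambda>n. f (r n) x) \<longlonglongrightarrow> F x"
      by (simp add: F_def convergent_LIMSEQ_iff)
  qed
  have "(\<lambda>n. \<integral>\<^sup>+x. ennreal ((cmod (f n x - F x))\<^sup>2) \<partial>M) \<longlonglongrightarrow> 0"
  proof (rule tendsto_zero_ennreal)
    fix e :: real assume "0 < e"
    then obtain N where N: "\<And>m n. m \<ge> N \<Longrightarrow> n \<ge> N \<Longrightarrow>
        (\<integral>\<^sup>+x. ennreal ((cmod (f m x - f n x))\<^sup>2) \<partial>M) \<le> ennreal (e / 2)"
      using cauchy[of "e / 2"] by auto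
    have "(\<integral>\<^sup>+x. ennreal ((cmod (f m x - F x))\<^sup>2) \<partial>M) < ennreal e" if "m \<ge> N" for m
    proof -
      have "(\<integral>\<^sup>+x. ennreal ((cmod (f m x - F x))\<^sup>2) \<partial>M) =
        (\<integral>\<^sup>+x. liminf (\<lambda>n. ennreal ((cmod (f m x - f (r n) x))\<^sup>2)) \<partial>M)"
      proof (rule nn_integral_cong_AE, use conv in eventually_elim)
        fix x assume "(\<lambda>n. f (r n) x) \<longlonglongrightarrow> F x"
        then have "(\<lambda>n. ennreal ((cmod (f m x - f (r n) x))\<^sup>2)) \<longlonglongrightarrow> ennreal ((cmod (f m x - F x))\<^sup>2)"
          by (intro tendsto_intros) auto
        then show "ennreal ((cmod (f m x - F x))\<^sup>2) = liminf (\<lambda>n. ennreal ((cmod (f m x - f (r n) x))\<^sup>2))"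
          by (intro lim_imp_Liminf[symmetric]) auto
      qed
      \<comment> \<open>Fatou's lemma along the subsequence turns the Cauchy estimate into an
        estimate against the limit.\<close>
      also have "\<dots> \<le> liminf (\<lambda>n. \<integral>\<^sup>+x. ennreal ((cmod (f m x - f (r n) x))\<^sup>2) \<partial>M)"
        by (rule nn_integral_liminf) measurable
      also have "\<dots> \<le> ennreal (e / 2)"
      proof (rule order_trans[OF Liminf_le_Limsup Limsup_bounded])
        show "\<forall>\<^sub>F n in sequentially. (\<integral>\<^sup>+x. ennreal ((cmod (f m x - f (r n) x))\<^sup>2) \<partial>M) \<le> ennreal (e / 2)"
          unfolding eventually_sequentially
          by (rule exI[of _ N]) (use that N seq_suble[OF mono] in \<open>meson le_trans\<close>)
      qed simp
      also have "\<dots> < ennreal e" using \<open>0 < e\<close> by (simp add: ennreal_less_iff)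
      finally show ?thesis .
    qed
    then show "\<forall>\<^sub>F n in sequentially. (\<integral>\<^sup>+x. ennreal ((cmod (f n x - F x))\<^sup>2) \<partial>M) < ennreal e"
      by (auto simp: eventually_sequentially)
  qed
  then show ?thesis using F F_def[abs_def] that by blast
qed

text \<open>On a finite measure space mean-square convergence gives convergence in mean by
  Cauchy-Schwarz, and bounded multipliers such as characters preserve it.\<close>

lemma (in finite_measure) L2_tendsto_integral:
  fixes f :: "nat \<Rightarrow> 'a \<Rightarrow> complex"
  assumes [measurable]: "\<And>n. f n \<in> borel_measurable M" "F \<in> borel_measurable M" "g \<in> borel_measurable M"
    and lim: "(\<lambda>n. \<integral>\<^sup>+x. ennreal ((cmod (f n x - F x))\<^sup>2) \<partial>M) \<longlonglongrightarrow> 0"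
    and sq: "\<And>n. integrable M (\<lambda>x. (cmod (f n x))\<^sup>2)"
    and g: "\<And>x. x \<in> space M \<Longrightarrow> cmod (g x) \<le> 1"
  shows "integrable M (\<lambda>x. (cmod (F x))\<^sup>2)" "integrable M F"
    "(\<lambda>n. \<integral>x. f n x * g x \<partial>M) \<longlonglongrightarrow> (\<integral>x. F x * g x \<partial>M)"
proof -
  have sq_int: "integrable M h" if "integrable M (\<lambda>x. (cmod (h x))\<^sup>2)" "h \<in> borel_measurable M" for h :: "'a \<Rightarrow> complex"
  proof -
    have "integrable M (\<lambda>x. cmod (h x))"
      by (rule square_integrable_imp_integrable) (use that in auto)
    then show ?thesis using that(2) by (simp add: integrable_norm_iff)
  qed
  obtain n where n: "(\<integral>\<^sup>+x. ennreal ((cmod (f n x - F x))\<^sup>2) \<partial>M) < ennreal 1"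
    using order_tendstoD(2)[OF lim, of "ennreal 1"] by (auto simp: eventually_sequentially)
  then have i: "integrable M (\<lambda>x. (cmod (f n x - F x))\<^sup>2)"
    by (intro integrableI_bounded) (auto intro: less_trans)
  show Fsq: "integrable M (\<lambda>x. (cmod (F x))\<^sup>2)"
  proof (rule Bochner_Integration.integrable_bound)
    show "integrable M (\<lambda>x. 2 * (cmod (f n x - F x))\<^sup>2 + 2 * (cmod (f n x))\<^sup>2)"
      using i sq by simp
    have "(cmod z)\<^sup>2 \<le> 2 * (cmod (w - z))\<^sup>2 + 2 * (cmod w)\<^sup>2" for w z
    proof -
      have "(cmod z)\<^sup>2 \<le> (cmod (w - z) + cmod w)\<^sup>2"
        using norm_triangle_ineq4[of w "w - z"] by (intro power_mono) (auto simp: algebra_simps)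
      also have "\<dots> \<le> 2 * (cmod (w - z))\<^sup>2 + 2 * (cmod w)\<^sup>2"
        using sum_squares_bound[of "cmod (w - z)" "cmod w"] by (simp add: power2_sum)
      finally show ?thesis .
    qed
    then show "AE x in M. norm ((cmod (F x))\<^sup>2) \<le> norm (2 * (cmod (f n x - F x))\<^sup>2 + 2 * (cmod (f n x))\<^sup>2)"
      by simp
  qed measurable
  show Fi: "integrable M F" by (rule sq_int[OF Fsq]) measurable
  have bd: "integrable M (\<lambda>x. h x * g x)" if "integrable M h" for h
    by (rule Bochner_Integration.integrable_bound[OF that])
       (use that g in \<open>auto simp: norm_mult intro!: AE_I2 mult_left_le\<close>)
  show "(\<lambda>n. \<integral>x. f n x * g x \<partial>M) \<longlonglongrightarrow> (\<integral>x. F x * g x \<partial>M)"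
  proof (rule tendsto_L1_int)
    show "integrable M (\<lambda>x. f n x * g x)" for n by (intro bd sq_int sq) measurable
    show "integrable M (\<lambda>x. F x * g x)" by (intro bd Fi)
    show "((\<lambda>n. \<integral>\<^sup>+x. ennreal (cmod (f n x * g x - F x * g x)) \<partial>M) \<longlongrightarrow> 0) sequentially"
    proof (rule tendsto_zero_ennreal)
      fix e :: real assume e: "0 < e"
      \<comment> \<open>The added 1 keeps the divisor positive when the space is null.\<close>
      define c where "c = measure M (space M) + 1"
      have c: "0 < c" "emeasure M (space M) \<le> ennreal c"
        by (auto simp: c_def emeasure_eq_measure add_nonneg_pos)
      have "\<forall>\<^sub>F n in sequentially. (\<integral>\<^sup>+x. ennreal ((cmod (f n x - F x))\<^sup>2) \<partial>M) < ennreal (e\<^sup>2 / c)"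
        using e c by (intro order_tendstoD(2)[OF lim]) auto
      then show "\<forall>\<^sub>F n in sequentially. (\<integral>\<^sup>+x. ennreal (cmod (f n x * g x - F x * g x)) \<partial>M) < ennreal e"
      proof eventually_elim
        fix n assume n: "(\<integral>\<^sup>+x. ennreal ((cmod (f n x - F x))\<^sup>2) \<partial>M) < ennreal (e\<^sup>2 / c)"
        have "(\<integral>\<^sup>+x. ennreal (cmod (f n x * g x - F x * g x)) \<partial>M) \<le> (\<integral>\<^sup>+x. ennreal (cmod (f n x - F x)) \<partial>M)"
          using g by (intro nn_integral_mono) (auto simp: left_diff_distrib[symmetric] norm_mult intro!: ennreal_leI mult_left_le)
        moreover have "(\<integral>\<^sup>+x. ennreal (cmod (f n x - F x)) \<partial>M) < ennreal e"
        proof (rule ccontr)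
          assume "\<not> ?thesis"
          then have "(ennreal e)\<^sup>2 \<le> (\<integral>\<^sup>+x. ennreal (cmod (f n x - F x)) \<partial>M)\<^sup>2"
            by (intro power_mono) auto
          also have "\<dots> \<le> (\<integral>\<^sup>+x. ennreal ((cmod (f n x - F x))\<^sup>2) \<partial>M) * emeasure M (space M)"
            using Cauchy_Schwarz_nn_integral[of "\<lambda>x. ennreal (cmod (f n x - F x))" M "\<lambda>_. 1"]
            by (simp add: ennreal_power)
          also have "\<dots> \<le> (\<integral>\<^sup>+x. ennreal ((cmod (f n x - F x))\<^sup>2) \<partial>M) * ennreal c"
            using c by (intro mult_left_mono) auto
          also have "\<dots> < ennreal (e\<^sup>2 / c) * ennreal c"
            using n c by (intro ennreal_mult_strict_right_mono) auto
          also have "\<dots> = (ennreal e)\<^sup>2"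
            using c e by (simp add: ennreal_mult'[symmetric] ennreal_power)
          finally show False by simp
        qed
        ultimately show "(\<integral>\<^sup>+x. ennreal (cmod (f n x * g x - F x * g x)) \<partial>M) < ennreal e"
          by (rule le_less_trans)
      qed
    qed
  qed
qed

section \<open>Distributions given by functions, and square-summable coefficients\<close>

lemma represents_iff:
  "represents f u \<longleftrightarrow> torus_periodic f \<and> integrable torus f \<and>
     (\<forall>\<theta>. test_function \<theta> \<longrightarrow> pairing u \<theta> = (\<integral>p. f p * \<theta> p \<partial>torus))"
  by (simp add: represents_def set_integrable_torus set_integral_torus)

lemma fourier_coeff_represents:
  assumes "represents f u"
  shows "fourier_coeff u k = fcoeff f k"
  using assms test_function_tchar by (simp add: fourier_coeff_eq fcoeff_def represents_iff)

lemma integrable_times_continuous: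
  fixes f g :: "real \<times> real \<Rightarrow> complex"
  assumes "integrable torus f" "continuous_on UNIV g"
  shows "integrable torus (\<lambda>p. f p * g p)"
proof -
  obtain M where M: "\<And>p. p \<in> space torus \<Longrightarrow> cmod (g p) \<le> M" "0 \<le> M"
    using continuous_torus_bounded[OF assms(2)] by blast
  have [measurable]: "f \<in> borel_measurable torus" "g \<in> borel_measurable torus"
    using assms integrable_torus_continuous by auto
  show ?thesis
  proof (rule Bochner_Integration.integrable_bound)
    show "integrable torus (\<lambda>p. M * cmod (f p))" using assms by simp
    show "AE p in torus. cmod (f p * g p) \<le> norm (M * cmod (f p))"
    proof (rule AE_I2)
      fix p assume "p \<in> space torus"
      then have "cmod (g p) * cmod (f p) \<le> M * cmod (f p)" by (intro mult_right_mono M) auto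
      then show "cmod (f p * g p) \<le> norm (M * cmod (f p))"
        using M(2) by (simp add: norm_mult mult.commute)
    qed
  qed measurable
qed

text \<open>Continuity rests on the zeroth-order part of \<open>test_tendsto\<close>: uniform
  convergence allows dominated convergence against the integrable \<open>f\<close>.\<close>

lemma represents_ex:
  assumes p: "torus_periodic f" and i: "integrable torus f"
  shows "\<exists>u. represents f u"
proof -
  define v where "v \<theta> = (if test_function \<theta> then \<integral>p. f p * \<theta> p \<partial>torus else 0)" for \<theta>
  note it = integrable_times_continuous[OF i test_function_continuous]
  have "is_distribution v"
    unfolding is_distribution_def
  proof (intro conjI allI impI)
    fix \<theta> \<eta> assume t: "test_function \<theta>" "test_function \<eta>"
    then show "v (\<lambda>p. \<theta> p + \<eta> p) = v \<theta> + v \<eta>"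
      using test_function_linear[OF t, of 1 1] it by (simp add: v_def distrib_left)
  next
    fix c \<theta> assume t: "test_function \<theta>"
    then show "v (\<lambda>p. c * \<theta> p) = c * v \<theta>"
      using test_function_linear[OF t t, of c 0] it by (simp add: v_def mult.left_commute)
  next
    fix S \<theta> assume S: "\<forall>n. test_function (S n)" and t: "test_function \<theta>" and l: "test_tendsto S \<theta>"
    have u: "uniform_limit UNIV S \<theta> sequentially"
      using l[unfolded test_tendsto_def, rule_format, of 0 0] by (simp add: mixed_partial_def)
    obtain M where M: "\<And>p. p \<in> space torus \<Longrightarrow> cmod (\<theta> p) \<le> M"
      using continuous_torus_bounded[OF test_function_continuous[OF t]] by blast
    \<comment> \<open>The bound by \<open>M + 1\<close> holds from this index on, so the sequence is
      shifted before dominated convergence is applied.\<close>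
    obtain N where N: "\<And>n p. n \<ge> N \<Longrightarrow> dist (S n p) (\<theta> p) < 1"
      using u[unfolded uniform_limit_iff, rule_format, of 1] by (auto simp: eventually_sequentially)
    have "(\<lambda>n. \<integral>p. f p * S (n + N) p \<partial>torus) \<longlonglongrightarrow> (\<integral>p. f p * \<theta> p \<partial>torus)"
    proof (rule integral_dominated_convergence[where w = "\<lambda>p. cmod (f p) * (M + 1)"])
      show "AE p in torus. cmod (f p * S (n + N) p) \<le> cmod (f p) * (M + 1)" for n
      proof (rule AE_I2)
        fix p assume "p \<in> space torus"
        then have "cmod (S (n + N) p) \<le> M + 1"
          using M[of p] N[of "n + N" p] norm_triangle_sub[of "S (n + N) p" "\<theta> p"] by (simp add: dist_norm)
        then show "cmod (f p * S (n + N) p) \<le> cmod (f p) * (M + 1)"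
          unfolding norm_mult by (intro mult_left_mono) auto
      qed
      show "AE p in torus. (\<lambda>n. f p * S (n + N) p) \<longlonglongrightarrow> f p * \<theta> p"
        by (intro AE_I2 tendsto_mult tendsto_const LIMSEQ_ignore_initial_segment tendsto_uniform_limitI[OF u]) auto
    qed (use S t i it in auto)
    then have "(\<lambda>n. \<integral>p. f p * S n p \<partial>torus) \<longlonglongrightarrow> (\<integral>p. f p * \<theta> p \<partial>torus)" by (rule LIMSEQ_offset)
    then show "(\<lambda>n. v (S n)) \<longlonglongrightarrow> v \<theta>" using S t by (simp add: v_def)
  next
    show "v f = 0" if "\<not> test_function f" for f using that by (simp add: v_def)
  qed
  then have "pairing (Abs_torus_distribution v) = v" by (simp add: Abs_torus_distribution_inverse)
  then show ?thesis using p i by (intro exI[of _ "Abs_torus_distribution v"]) (simp add: represents_iff v_def)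
qed

lemma parseval_finite:
  assumes "finite A"
  shows "(\<integral>\<^sup>+p. ennreal ((cmod (\<Sum>k\<in>A. c k * tchar k p))\<^sup>2) \<partial>torus) = ennreal ((2 * pi)\<^sup>2 * (\<Sum>k\<in>A. (cmod (c k))\<^sup>2))"
proof -
  have sq: "complex_of_real ((cmod (\<Sum>k\<in>A. c k * tchar k p))\<^sup>2) =
      (\<Sum>k\<in>A. \<Sum>l\<in>A. c k * cnj (c l) * tchar (k - l) p)" for p
    using tchar_add[of _ "- _" p]
    by (simp only: complex_norm_square cnj_sum sum_product complex_cnj_mult cnj_tchar)
       (simp add: mult_ac)
  have int: "integrable torus (tchar k)" for k by (intro integrable_torus_continuous continuous_intros)
  have ci: "integrable torus (\<lambda>p. complex_of_real ((cmod (\<Sum>k\<in>A. c k * tchar k p))\<^sup>2))"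
    by (intro integrable_torus_continuous continuous_intros)
  have "complex_of_real (\<integral>p. (cmod (\<Sum>k\<in>A. c k * tchar k p))\<^sup>2 \<partial>torus) =
      (\<integral>p. (\<Sum>k\<in>A. \<Sum>l\<in>A. c k * cnj (c l) * tchar (k - l) p) \<partial>torus)"
    by (simp only: integral_complex_of_real[symmetric] sq)
  also have "\<dots> = (\<Sum>k\<in>A. \<Sum>l\<in>A. c k * cnj (c l) * (if k = l then of_real ((2 * pi)\<^sup>2) else 0))"
    using int by (simp add: Bochner_Integration.integral_sum integral_tchar if_distrib[of complex_of_real] cong: if_cong)
  also have "\<dots> = (\<Sum>k\<in>A. c k * cnj (c k) * of_real ((2 * pi)\<^sup>2))"
    using assms by (simp add: mult_delta_right)
  also have "\<dots> = complex_of_real ((2 * pi)\<^sup>2 * (\<Sum>k\<in>A. (cmod (c k))\<^sup>2))"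
    by (simp only: complex_norm_square[symmetric]) (simp add: sum_distrib_left mult_ac)
  finally have "(\<integral>p. (cmod (\<Sum>k\<in>A. c k * tchar k p))\<^sup>2 \<partial>torus) = (2 * pi)\<^sup>2 * (\<Sum>k\<in>A. (cmod (c k))\<^sup>2)"
    by (simp only: of_real_eq_iff)
  moreover have "integrable torus (\<lambda>p. (cmod (\<Sum>k\<in>A. c k * tchar k p))\<^sup>2)"
    using integrable_Re[OF ci] by simp
  ultimately show ?thesis by (subst nn_integral_eq_integral) auto
qed

text \<open>Partial sums over the squares are Cauchy in mean square by Parseval's identity. The
  pointwise \<open>lim\<close> makes the limit function exactly periodic, as
  \<open>represents\<close> requires. Distributions with prescribed coefficients are obtained from
  here.\<close>

lemma riesz_fischer:
  assumes s: "(\<lambda>k. (cmod (c k))\<^sup>2) summable_on UNIV"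
  obtains f u where "represents f u" "\<And>k. fourier_coeff u k = c k"
proof -
  define S where "S n p = (\<Sum>k\<in>freq_box n. c k * tchar k p)" for n p
  have cS: "continuous_on UNIV (S n)" for n unfolding S_def by (intro continuous_intros)
  have [measurable]: "S n \<in> borel_measurable torus" for n
    using integrable_torus_continuous[OF cS] by auto
  have box_mono: "freq_box m \<subseteq> freq_box n" if "m \<le> n" for m n using that by (auto simp: freq_box_def)
  have diff: "(\<integral>\<^sup>+p. ennreal ((cmod (S n p - S m p))\<^sup>2) \<partial>torus) =
      ennreal ((2 * pi)\<^sup>2 * (\<Sum>k\<in>freq_box n - freq_box m. (cmod (c k))\<^sup>2))" if "m \<le> n" for m n
    using parseval_finite[of "freq_box n - freq_box m" c] box_mono[OF that]
    by (simp add: S_def sum_diff[symmetric])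
  have cauchy: "\<exists>N. \<forall>m\<ge>N. \<forall>n\<ge>N. (\<integral>\<^sup>+p. ennreal ((cmod (S m p - S n p))\<^sup>2) \<partial>torus) \<le> ennreal e" if "0 < e" for e
  proof -
    have "(\<lambda>n. \<Sum>k\<in>freq_box n. (cmod (c k))\<^sup>2) \<longlonglongrightarrow> (\<Sum>\<^sub>\<infinity>k. (cmod (c k))\<^sup>2)"
      using filterlim_compose[OF infsum_tendsto[OF s] filterlim_freq_box] .
    then have "Cauchy (\<lambda>n. \<Sum>k\<in>freq_box n. (cmod (c k))\<^sup>2)"
      by (rule LIMSEQ_imp_Cauchy)
    then obtain N where N: "\<And>m n. m \<ge> N \<Longrightarrow> n \<ge> N \<Longrightarrow>
        dist (\<Sum>k\<in>freq_box m. (cmod (c k))\<^sup>2) (\<Sum>k\<in>freq_box n. (cmod (c k))\<^sup>2) < e / (2 * pi)\<^sup>2"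
      using \<open>0 < e\<close> unfolding Cauchy_def by (metis divide_pos_pos pi_gt_zero zero_less_mult_iff zero_less_numeral zero_less_power)
    have "(\<integral>\<^sup>+p. ennreal ((cmod (S n p - S m p))\<^sup>2) \<partial>torus) \<le> ennreal e" if "m \<ge> N" "m \<le> n" for m n
    proof -
      have "(\<Sum>k\<in>freq_box n - freq_box m. (cmod (c k))\<^sup>2) \<le> e / (2 * pi)\<^sup>2"
        using N[of n m] that box_mono[OF that(2)] by (simp add: sum_diff dist_real_def)
      then have "(2 * pi)\<^sup>2 * (\<Sum>k\<in>freq_box n - freq_box m. (cmod (c k))\<^sup>2) \<le> e"
        by (simp add: field_simps)
      then show ?thesis using diff[OF that(2)] by (simp add: ennreal_leI)
    qed
    note * = this
    have "(\<integral>\<^sup>+p. ennreal ((cmod (S m p - S n p))\<^sup>2) \<partial>torus) \<le> ennreal e" if "m \<ge> N" "n \<ge> N" for m n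
      using *[of m n] *[of n m] that by (cases "m \<le> n") (simp_all add: norm_minus_commute[of "S m _"])
    then show ?thesis by blast
  qed
  obtain r F where F: "F = (\<lambda>x. lim (\<lambda>n. S (r n) x))" and [measurable]: "F \<in> borel_measurable torus"
    and lim: "(\<lambda>n. \<integral>\<^sup>+x. ennreal ((cmod (S n x - F x))\<^sup>2) \<partial>torus) \<longlonglongrightarrow> 0"
  proof (rule L2_complete[of S torus])
    show "S n \<in> borel_measurable torus" for n by measurable
    show "\<exists>N. \<forall>m\<ge>N. \<forall>n\<ge>N. (\<integral>\<^sup>+p. ennreal ((cmod (S m p - S n p))\<^sup>2) \<partial>torus) \<le> ennreal e" if "0 < e" for e
      using that by (rule cauchy)
  qed
  have sq: "integrable torus (\<lambda>x. (cmod (S n x))\<^sup>2)" for n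
    using parseval_finite[of "freq_box n" c] by (intro integrableI_bounded) (auto simp: S_def)
  note L = torus.L2_tendsto_integral[of S F, OF _ _ _ lim sq]
  have "integrable torus F" using L(2)[of "\<lambda>_. 0"] by simp
  moreover have "torus_periodic F"
    unfolding F torus_periodic_def S_def by (simp add: tchar_periodic)
  ultimately obtain u where u: "represents F u" using represents_ex by blast
  have "fcoeff F k = c k" for k
  proof -
    have "(\<lambda>n. \<integral>p. S n p * tchar (- k) p \<partial>torus) \<longlonglongrightarrow> (\<integral>p. F p * tchar (- k) p \<partial>torus)"
      by (rule L(3)) auto
    moreover have "\<forall>\<^sub>F n in sequentially. (\<integral>p. S n p * tchar (- k) p \<partial>torus) = c k * (2 * pi)\<^sup>2"
      using freq_box_exhaust[of "{k}", simplified]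
    proof (rule eventually_mono)
      fix n assume k: "k \<in> freq_box n"
      have "(\<integral>p. S n p * tchar (- k) p \<partial>torus) = (\<integral>p. (\<Sum>l\<in>freq_box n. c l * tchar (l - k) p) \<partial>torus)"
        using tchar_add[of _ "- k"] by (simp add: S_def sum_distrib_right mult.assoc)
      also have "\<dots> = (\<Sum>l\<in>freq_box n. c l * (if l = k then of_real ((2 * pi)\<^sup>2) else 0))"
        by (subst Bochner_Integration.integral_sum)
           (auto intro!: integrable_torus_continuous continuous_intros sum.cong simp: integral_tchar)
      finally show "(\<integral>p. S n p * tchar (- k) p \<partial>torus) = c k * (2 * pi)\<^sup>2"
        using k by (simp add: mult_delta_right)
    qed
    then have "(\<lambda>n. \<integral>p. S n p * tchar (- k) p \<partial>torus) \<longlonglongrightarrow> c k * (2 * pi)\<^sup>2"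
      by (rule tendsto_eventually)
    ultimately have "(\<integral>p. F p * tchar (- k) p \<partial>torus) = c k * (2 * pi)\<^sup>2"
      by (rule LIMSEQ_unique)
    then show ?thesis by (simp add: fcoeff_def)
  qed
  then show ?thesis using u that[OF u] by (simp add: fourier_coeff_represents)
qed

text \<open>The convolution theorem: the uniformly convergent series of \<open>w\<close> is inserted
  and integrated term by term, the sum of the moduli of its coefficients giving the dominating
  constant.\<close>

lemma fcoeff_mult:
  assumes f: "integrable torus f" and w: "continuous_on UNIV w" "torus_periodic w"
    and s: "(\<lambda>k. cmod (fcoeff w k)) summable_on UNIV"
  shows "(\<lambda>n. \<Sum>j\<in>freq_box n. fcoeff w j * fcoeff f (k - j)) \<longlonglongrightarrow> fcoeff (\<lambda>p. w p * f p) k"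
proof -
  define S where "S n p = (\<Sum>j\<in>freq_box n. fcoeff w j * tchar j p)" for n p
  have u: "uniform_limit UNIV S w sequentially"
    unfolding S_def by (rule fourier_series_uniform[OF w s])
  have cS: "continuous_on UNIV (S n)" for n unfolding S_def by (intro continuous_intros)
  define M where "M = (\<Sum>\<^sub>\<infinity>k. cmod (fcoeff w k))"
  have M: "cmod (S n p) \<le> M" for n p
  proof -
    have "cmod (S n p) \<le> (\<Sum>j\<in>freq_box n. cmod (fcoeff w j))"
      unfolding S_def by (rule sum_norm_le) (simp add: norm_mult)
    also have "\<dots> \<le> M" unfolding M_def by (intro finite_sum_le_infsum s) auto
    finally show ?thesis .
  qed
  have [measurable]: "f \<in> borel_measurable torus" "w \<in> borel_measurable torus"
    "S n \<in> borel_measurable torus" for n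
    using f integrable_torus_continuous[OF w(1)] integrable_torus_continuous[OF cS] by auto
  have "(\<lambda>n. \<integral>p. S n p * f p * tchar (- k) p \<partial>torus) \<longlonglongrightarrow> (\<integral>p. w p * f p * tchar (- k) p \<partial>torus)"
  proof (rule integral_dominated_convergence[where w = "\<lambda>p. M * cmod (f p)"])
    show "AE p in torus. (\<lambda>n. S n p * f p * tchar (- k) p) \<longlonglongrightarrow> w p * f p * tchar (- k) p"
      by (intro AE_I2 tendsto_mult tendsto_const tendsto_uniform_limitI[OF u]) auto
    show "AE p in torus. cmod (S n p * f p * tchar (- k) p) \<le> M * cmod (f p)" for n
      using M by (auto simp: norm_mult intro!: AE_I2 mult_right_mono)
  qed (use f in auto)
  moreover have "(\<integral>p. S n p * f p * tchar (- k) p \<partial>torus) = (\<Sum>j\<in>freq_box n. fcoeff w j * (\<integral>p. f p * tchar (- (k - j)) p \<partial>torus))" for n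
  proof -
    have "(\<integral>p. S n p * f p * tchar (- k) p \<partial>torus) =
      (\<integral>p. (\<Sum>j\<in>freq_box n. fcoeff w j * (f p * tchar (- (k - j)) p)) \<partial>torus)"
      using tchar_add[of _ "- k"] by (simp add: S_def sum_distrib_left mult_ac)
    then show ?thesis
      using integrable_times_tchar[OF f] by (simp add: Bochner_Integration.integral_sum)
  qed
  ultimately show ?thesis
    unfolding fcoeff_def times_divide_eq_right sum_divide_distrib[symmetric]
    by (intro tendsto_divide tendsto_const) auto
qed

section \<open>The control operator on Sobolev spaces\<close>

lemma freq_abs_triangle: "freq_abs (j + k) \<le> freq_abs j + freq_abs k"
proof -
  have "freq_abs k = cmod (Complex (of_int (fst k)) (of_int (snd k)))" for k
    by (simp add: freq_abs_def cmod_def)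
  then show ?thesis
    using norm_triangle_ineq[of "Complex (of_int (fst j)) (of_int (snd j))" "Complex (of_int (fst k)) (of_int (snd k))"]
    by (simp add: plus_complex.ctr)
qed

lemma freq_abs_nonneg: "0 \<le> freq_abs k"
  by (simp add: freq_abs_def)

lemma freq_abs_le_box_weight: "1 + freq_abs k \<le> box_weight k"
proof -
  have "freq_abs k \<le> \<bar>of_int (fst k)\<bar> + \<bar>of_int (snd k)\<bar>"
    unfolding freq_abs_def using sqrt_sum_squares_le_sum_abs by blast
  then show ?thesis
    unfolding box_weight_def distrib_right distrib_left
    using mult_nonneg_nonneg[OF abs_ge_zero abs_ge_zero, of "real_of_int (fst k)" "real_of_int (snd k)"] by linarith
qed

lemma summable_on_weighted_fcoeff:
  assumes "test_function f"
  shows "(\<lambda>k. (1 + freq_abs k) powr s * cmod (fcoeff f k)) summable_on UNIV"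
proof (rule summable_on_comparison_test[OF summable_fcoeff_weighted[OF assms, of "nat \<lceil>s\<rceil>"]])
  fix k
  have "(1 + freq_abs k) powr s \<le> (1 + freq_abs k) powr real (nat \<lceil>s\<rceil>)"
    by (intro powr_mono) (auto simp: freq_abs_nonneg, linarith)
  also have "\<dots> = (1 + freq_abs k) ^ nat \<lceil>s\<rceil>"
    using freq_abs_nonneg[of k] by (simp add: powr_realpow)
  also have "\<dots> \<le> box_weight k ^ nat \<lceil>s\<rceil>"
    using freq_abs_nonneg[of k] by (intro power_mono freq_abs_le_box_weight) auto
  finally show "(1 + freq_abs k) powr s * cmod (fcoeff f k) \<le> box_weight k ^ nat \<lceil>s\<rceil> * cmod (fcoeff f k)"
    by (intro mult_right_mono) auto
qed auto

lemma powr_double: "(1 + freq_abs k) powr (2 * s) = ((1 + freq_abs k) powr s)\<^sup>2"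
  by (simp add: power2_eq_square powr_add[symmetric])

text \<open>Young's inequality for weighted sequences, the weight being submultiplicative.\<close>

lemma weighted_convolution_bound:
  fixes a b c :: "int \<times> int \<Rightarrow> complex"
  assumes s: "0 \<le> s" and a: "(\<lambda>j. (1 + freq_abs j) powr s * cmod (a j)) summable_on UNIV"
    and c: "(\<lambda>k. (1 + freq_abs k) powr (2 * s) * (cmod (c k))\<^sup>2) summable_on UNIV"
    and b: "\<And>k. (\<lambda>n. \<Sum>j\<in>freq_box n. a j * c (k - j)) \<longlonglongrightarrow> b k"
  defines "A \<equiv> \<Sum>\<^sub>\<infinity>j. (1 + freq_abs j) powr s * cmod (a j)"
    and "D \<equiv> \<Sum>\<^sub>\<infinity>k. (1 + freq_abs k) powr (2 * s) * (cmod (c k))\<^sup>2"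
  assumes K: "finite K"
  shows "(\<Sum>k\<in>K. (1 + freq_abs k) powr (2 * s) * (cmod (b k))\<^sup>2) \<le> A\<^sup>2 * D"
proof -
  define w where "w k = (1 + freq_abs k) powr s" for k
  define \<alpha> where "\<alpha> j = w j * cmod (a j)" for j
  define d where "d k = w k * cmod (c k)" for k
  have w0: "0 \<le> w k" for k by (simp add: w_def)
  have \<alpha>0: "0 \<le> \<alpha> j" and d0: "0 \<le> d k" for j k by (simp_all add: \<alpha>_def d_def w0)
  have w: "w k \<le> w j * w (k - j)" for j k
  proof -
    have "1 + freq_abs k \<le> (1 + freq_abs j) * (1 + freq_abs (k - j))"
      using freq_abs_triangle[of j "k - j"] mult_nonneg_nonneg[OF freq_abs_nonneg freq_abs_nonneg, of j "k - j"]
      by (simp add: algebra_simps)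
    then have "w k \<le> ((1 + freq_abs j) * (1 + freq_abs (k - j))) powr s"
      unfolding w_def using s freq_abs_nonneg[of k] by (intro powr_mono2) auto
    then show ?thesis
      using freq_abs_nonneg[of j] freq_abs_nonneg[of "k - j"] by (simp add: w_def powr_mult)
  qed
  have A: "(\<Sum>j\<in>J. \<alpha> j) \<le> A" if "finite J" for J
    unfolding A_def \<alpha>_def w_def using that a by (intro finite_sum_le_infsum) auto
  have D: "(\<Sum>k\<in>K. (d k)\<^sup>2) \<le> D" if "finite K" for K
  proof -
    have "(\<Sum>k\<in>K. (d k)\<^sup>2) = (\<Sum>k\<in>K. (1 + freq_abs k) powr (2 * s) * (cmod (c k))\<^sup>2)"
      by (simp add: d_def w_def powr_double power_mult_distrib)
    also have "\<dots> \<le> D" unfolding D_def using that c by (intro finite_sum_le_infsum) auto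
    finally show ?thesis .
  qed
  have A0: "0 \<le> A" and D0: "0 \<le> D" using A[of "{}"] D[of "{}"] by simp_all
  have fin: "(\<Sum>k\<in>K. (w k)\<^sup>2 * (cmod (\<Sum>j\<in>J. a j * c (k - j)))\<^sup>2) \<le> A\<^sup>2 * D" if J: "finite J" for J
  proof -
    have "(w k)\<^sup>2 * (cmod (\<Sum>j\<in>J. a j * c (k - j)))\<^sup>2 \<le> A * (\<Sum>j\<in>J. \<alpha> j * (d (k - j))\<^sup>2)" for k
    proof -
      have "w k * cmod (\<Sum>j\<in>J. a j * c (k - j)) \<le> w k * (\<Sum>j\<in>J. cmod (a j) * cmod (c (k - j)))"
        using norm_sum[of "\<lambda>j. a j * c (k - j)" J] by (intro mult_left_mono w0) (simp add: norm_mult)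
      also have "\<dots> \<le> (\<Sum>j\<in>J. \<alpha> j * d (k - j))"
        unfolding sum_distrib_left
      proof (rule sum_mono)
        fix j
        have "w k * (cmod (a j) * cmod (c (k - j))) \<le> (w j * w (k - j)) * (cmod (a j) * cmod (c (k - j)))"
          by (intro mult_right_mono w) auto
        then show "w k * (cmod (a j) * cmod (c (k - j))) \<le> \<alpha> j * d (k - j)"
          by (simp add: \<alpha>_def d_def mult_ac)
      qed
      \<comment> \<open>Splitting off \<open>sqrt (\<alpha> j)\<close> lets Cauchy-Schwarz leave one
        factor that is summable by itself.\<close>
      also have "\<dots> = (\<Sum>j\<in>J. sqrt (\<alpha> j) * (sqrt (\<alpha> j) * d (k - j)))"
        using \<alpha>0 by (simp add: mult.assoc[symmetric] real_sqrt_mult[symmetric])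
      finally have "(w k * cmod (\<Sum>j\<in>J. a j * c (k - j)))\<^sup>2 \<le> (\<Sum>j\<in>J. sqrt (\<alpha> j) * (sqrt (\<alpha> j) * d (k - j)))\<^sup>2"
        by (intro power_mono) (auto simp: w0)
      also have "\<dots> \<le> (\<Sum>j\<in>J. (sqrt (\<alpha> j))\<^sup>2) * (\<Sum>j\<in>J. (sqrt (\<alpha> j) * d (k - j))\<^sup>2)"
        by (rule Cauchy_Schwarz_ineq_sum)
      also have "\<dots> = (\<Sum>j\<in>J. \<alpha> j) * (\<Sum>j\<in>J. \<alpha> j * (d (k - j))\<^sup>2)"
        using \<alpha>0 by (simp add: power_mult_distrib)
      also have "\<dots> \<le> A * (\<Sum>j\<in>J. \<alpha> j * (d (k - j))\<^sup>2)"
        using J by (intro mult_right_mono A sum_nonneg) (auto simp: \<alpha>0)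
      finally show ?thesis by (simp add: power_mult_distrib)
    qed
    then have "(\<Sum>k\<in>K. (w k)\<^sup>2 * (cmod (\<Sum>j\<in>J. a j * c (k - j)))\<^sup>2) \<le>
        (\<Sum>k\<in>K. A * (\<Sum>j\<in>J. \<alpha> j * (d (k - j))\<^sup>2))" by (rule sum_mono)
    also have "\<dots> = A * (\<Sum>j\<in>J. \<alpha> j * (\<Sum>k\<in>K. (d (k - j))\<^sup>2))"
      by (subst sum_distrib_left[symmetric], subst sum.swap) (simp add: sum_distrib_left)
    also have "\<dots> \<le> A * (\<Sum>j\<in>J. \<alpha> j * D)"
    proof (intro mult_left_mono sum_mono \<alpha>0 A0)
      fix j
      have "(\<Sum>k\<in>K. (d (k - j))\<^sup>2) = (\<Sum>k\<in>(\<lambda>k. k - j) ` K. (d k)\<^sup>2)"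
        by (subst sum.reindex) (auto simp: inj_on_def)
      also have "\<dots> \<le> D" using K by (intro D) auto
      finally show "(\<Sum>k\<in>K. (d (k - j))\<^sup>2) \<le> D" .
    qed
    also have "\<dots> = A * ((\<Sum>j\<in>J. \<alpha> j) * D)" by (simp add: sum_distrib_right)
    also have "\<dots> \<le> A * (A * D)"
      using J by (intro mult_left_mono mult_right_mono A A0 D0)
    finally show ?thesis by (simp add: power2_eq_square mult.assoc)
  qed
  \<comment> \<open>The bound for finite \<open>J\<close> does not depend on \<open>J\<close>, and
    for a finite set \<open>K\<close> of modes it survives the limit that defines
    \<open>b\<close>.\<close>
  have "(\<lambda>n. \<Sum>k\<in>K. (w k)\<^sup>2 * (cmod (\<Sum>j\<in>freq_box n. a j * c (k - j)))\<^sup>2) \<longlonglongrightarrow> (\<Sum>k\<in>K. (w k)\<^sup>2 * (cmod (b k))\<^sup>2)"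
    by (intro tendsto_intros b)
  then have "(\<Sum>k\<in>K. (w k)\<^sup>2 * (cmod (b k))\<^sup>2) \<le> A\<^sup>2 * D"
    by (rule LIMSEQ_le_const2) (use fin in auto)
  then show ?thesis by (simp add: w_def powr_double)
qed

section \<open>Profiles and the control operator on the Fourier side\<close>

lemma fcoeff_tensor:
  assumes "continuous_on UNIV \<phi>" "continuous_on UNIV \<psi>"
  shows "fcoeff (tensor \<phi> \<psi>) k =
    (\<integral>x. \<phi> x * wave (- fst k) x \<partial>circ) / (2 * pi) * ((\<integral>y. \<psi> y * wave (- snd k) y \<partial>circ) / (2 * pi))"
proof -
  have I: "integrable torus (\<lambda>p. tensor \<phi> \<psi> p * tchar (- k) p)"
    unfolding tensor_def case_prod_beta
    by (intro integrable_torus_continuous continuous_intros continuous_on_compose2[OF assms(1)]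
        continuous_on_compose2[OF assms(2)]) auto
  have "(\<integral>p. tensor \<phi> \<psi> p * tchar (- k) p \<partial>torus) =
    (\<integral>y. (\<integral>x. (\<phi> x * wave (- fst k) x) * (\<psi> y * wave (- snd k) y) \<partial>circ) \<partial>circ)"
    unfolding integral_torus_iterated(1)[OF I] by (simp add: tensor_def tchar_def mult_ac)
  then show ?thesis by (simp add: fcoeff_def power2_eq_square)
qed

definition profile_coeff :: "(real \<Rightarrow> real) \<Rightarrow> int \<Rightarrow> complex" where
  "profile_coeff g n = (\<integral>x. of_real (g x) * wave (- n) x \<partial>circ) / (2 * pi)"

definition lift_x :: "(real \<Rightarrow> real) \<Rightarrow> real \<times> real \<Rightarrow> complex" where
  "lift_x g = tensor (\<lambda>x. of_real (g x)) (\<lambda>_. 1)"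

definition lift_y :: "(real \<Rightarrow> real) \<Rightarrow> real \<times> real \<Rightarrow> complex" where
  "lift_y g = tensor (\<lambda>_. 1) (\<lambda>y. of_real (g y))"

context
  fixes g assumes g: "control_profile g"
begin

lemma control_profile_continuous: "continuous_on S g"
proof -
  have "g differentiable (at x)" for x
    using g unfolding control_profile_def by (metis funpow_0)
  then show ?thesis
    by (simp add: differentiable_imp_continuous_within continuous_at_imp_continuous_on)
qed

lemma smooth_control_profile: "smooth (\<lambda>x. of_real (g x))"
  using smooth_modulated[of g 0] g unfolding control_profile_def by simp

lemma test_function_lift: "test_function (lift_x g)" "test_function (lift_y g)"
  unfolding lift_x_def lift_y_def
  using g smooth_wave[of 0] by (auto intro!: test_function_tensor smooth_control_profile simp: control_profile_def)

lemma profile_coeff_0: "profile_coeff g 0 = 1 / (2 * pi)"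
proof -
  have "(\<integral>x. of_real (g x) \<partial>circ) = complex_of_real (\<integral>x. g x \<partial>circ)" by simp
  also have "(\<integral>x. g x \<partial>circ) = 1"
    using g by (subst integral_restrict_space) (auto simp: control_profile_def set_lebesgue_integral_def)
  finally show ?thesis by (simp add: profile_coeff_def)
qed

text \<open>Positivity and unit mass bound every coefficient by the mean. The bound is the same for
  all profiles, which makes the later blocks invertible with a universal constant.\<close>

lemma norm_profile_coeff_le: "cmod (profile_coeff g n) \<le> 1 / (2 * pi)"
proof -
  have "cmod (\<integral>x. of_real (g x) * wave (- n) x \<partial>circ) \<le> (\<integral>x. cmod (of_real (g x) * wave (- n) x) \<partial>circ)"
    by (rule integral_norm_bound)
  also have "\<dots> = (\<integral>x. g x \<partial>circ)"
    using g by (simp add: norm_mult control_profile_def)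
  also have "\<dots> = 1"
    using g by (subst integral_restrict_space) (auto simp: control_profile_def set_lebesgue_integral_def)
  finally show ?thesis by (simp add: profile_coeff_def norm_divide norm_mult divide_right_mono)
qed

lemma fcoeff_lift_x: "fcoeff (lift_x g) k = (if snd k = 0 then profile_coeff g (fst k) else 0)"
  unfolding lift_x_def
  by (subst fcoeff_tensor) (auto intro!: continuous_intros control_profile_continuous simp: integral_wave profile_coeff_def)

lemma fcoeff_lift_y: "fcoeff (lift_y g) k = (if fst k = 0 then profile_coeff g (snd k) else 0)"
  unfolding lift_y_def
  by (subst fcoeff_tensor) (auto intro!: continuous_intros control_profile_continuous simp: integral_wave profile_coeff_def)

lemma fcoeff_lift_tendsto:
  assumes "integrable torus f"
  shows "(\<lambda>n. \<Sum>j\<in>freq_box n. fcoeff (lift_x g) j * fcoeff f (k - j)) \<longlonglongrightarrow> fcoeff (\<lambda>p. lift_x g p * f p) k"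
    "(\<lambda>n. \<Sum>j\<in>freq_box n. fcoeff (lift_y g) j * fcoeff f (k - j)) \<longlonglongrightarrow> fcoeff (\<lambda>p. lift_y g p * f p) k"
  using test_function_lift summable_fcoeff_weighted[of "lift_x g" 0] summable_fcoeff_weighted[of "lift_y g" 0]
  by (auto intro!: fcoeff_mult assms test_function_continuous test_function_periodic)

end

lemma integrable_torus_marginal:
  assumes f: "integrable torus f"
  shows "integrable torus (\<lambda>p. \<integral>x'. f (x', snd p) \<partial>circ :: complex)"
    "integrable torus (\<lambda>p. \<integral>y'. f (fst p, y') \<partial>circ :: complex)"
proof -
  have 1: "integrable circ (\<lambda>y. \<integral>x'. f (x', y) \<partial>circ)" using f by (intro torus.integrable_snd) simp
  have 2: "integrable circ (\<lambda>x. \<integral>y'. f (x, y') \<partial>circ)" using f by (intro torus.integrable_fst) simp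
  note [measurable] = borel_measurable_integrable[OF 1] borel_measurable_integrable[OF 2]
  show "integrable torus (\<lambda>p. \<integral>x'. f (x', snd p) \<partial>circ)"
    using 1 by (intro torus.Fubini_integrable) auto
  show "integrable torus (\<lambda>p. \<integral>y'. f (fst p, y') \<partial>circ)"
    using 2 by (intro torus.Fubini_integrable) auto
qed

lemma G_fun_eq:
  "G_fun g1 g2 f p =
     (1 / (2 * pi)) * (lift_y g2 p * f p) - (1 / (2 * pi)\<^sup>2) * (lift_y g2 p * (\<integral>x'. f (x', snd p) \<partial>circ)) +
     ((1 / (2 * pi)) * (lift_x g1 p * f p) - (1 / (2 * pi)\<^sup>2) * (lift_x g1 p * (\<integral>y'. f (fst p, y') \<partial>circ)))"
  unfolding G_fun_def G1_fun_def G2_fun_def set_integral_circ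
  by (cases p) (simp add: lift_x_def lift_y_def tensor_def algebra_simps)

context
  fixes f :: "real \<times> real \<Rightarrow> complex" and g1 g2 :: "real \<Rightarrow> real"
  assumes f: "integrable torus f" and g: "control_profile g1" "control_profile g2"
begin

lemma integrable_lift:
  "integrable torus (\<lambda>p. lift_y g2 p * f p)" "integrable torus (\<lambda>p. lift_x g1 p * f p)"
  "integrable torus (\<lambda>p. lift_y g2 p * (\<integral>x'. f (x', snd p) \<partial>circ))"
  "integrable torus (\<lambda>p. lift_x g1 p * (\<integral>y'. f (fst p, y') \<partial>circ))"
  using integrable_torus_marginal[OF f] f test_function_continuous[OF test_function_lift(1)[OF g(1)]]
     test_function_continuous[OF test_function_lift(2)[OF g(2)]]
  by (auto intro!: integrable_times_continuous simp: mult.commute[of "lift_x _ _"] mult.commute[of "lift_y _ _"])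

text \<open>The averaged product depends on y alone, so it only has modes with first index 0; there
  the average merely repeats the integration in x, with a factor \<open>2 * pi\<close>.\<close>

lemma fcoeff_marginal_x:
  "fcoeff (\<lambda>p. lift_y g2 p * (\<integral>x'. f (x', snd p) \<partial>circ)) k =
    (if fst k = 0 then 2 * pi else 0) * fcoeff (\<lambda>p. lift_y g2 p * f p) k"
proof -
  define m where "m y = (\<integral>x'. f (x', y) \<partial>circ)" for y
  have "(\<integral>p. lift_y g2 p * m (snd p) * tchar (- k) p \<partial>torus) =
    (\<integral>y. (\<integral>x. (of_real (g2 y) * m y * wave (- snd k) y) * wave (- fst k) x \<partial>circ) \<partial>circ)"
    using integrable_times_tchar[OF integrable_lift(3), of "- k"]
    by (subst integral_torus_iterated(1)) (auto simp: lift_y_def tensor_def tchar_def m_def mult_ac)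
  also have "\<dots> = (if fst k = 0 then 2 * pi else 0) * (\<integral>y. of_real (g2 y) * m y * wave (- snd k) y \<partial>circ)"
    by (simp add: integral_wave)
  also have "\<dots> = (if fst k = 0 then 2 * pi else 0) * (\<integral>p. lift_y g2 p * f p * tchar (- k) p \<partial>torus)"
  proof (cases "fst k = 0")
    case True
    have "(\<integral>p. lift_y g2 p * f p * tchar (- k) p \<partial>torus) =
      (\<integral>y. (\<integral>x. (of_real (g2 y) * wave (- snd k) y) * f (x, y) \<partial>circ) \<partial>circ)"
      using integrable_times_tchar[OF integrable_lift(1), of "- k"] True
      by (subst integral_torus_iterated(1)) (auto simp: lift_y_def tensor_def tchar_def mult_ac)
    also have "\<dots> = (\<integral>y. of_real (g2 y) * m y * wave (- snd k) y \<partial>circ)"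
      by (simp add: m_def mult_ac)
    finally show ?thesis by simp
  qed simp
  finally show ?thesis by (simp add: fcoeff_def m_def)
qed

lemma fcoeff_marginal_y:
  "fcoeff (\<lambda>p. lift_x g1 p * (\<integral>y'. f (fst p, y') \<partial>circ)) k =
    (if snd k = 0 then 2 * pi else 0) * fcoeff (\<lambda>p. lift_x g1 p * f p) k"
proof -
  define m where "m x = (\<integral>y'. f (x, y') \<partial>circ)" for x
  have "(\<integral>p. lift_x g1 p * m (fst p) * tchar (- k) p \<partial>torus) =
    (\<integral>x. (\<integral>y. (of_real (g1 x) * m x * wave (- fst k) x) * wave (- snd k) y \<partial>circ) \<partial>circ)"
    using integrable_times_tchar[OF integrable_lift(4), of "- k"]
    by (subst integral_torus_iterated(2)) (auto simp: lift_x_def tensor_def tchar_def m_def mult_ac)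
  also have "\<dots> = (if snd k = 0 then 2 * pi else 0) * (\<integral>x. of_real (g1 x) * m x * wave (- fst k) x \<partial>circ)"
    by (simp add: integral_wave)
  also have "\<dots> = (if snd k = 0 then 2 * pi else 0) * (\<integral>p. lift_x g1 p * f p * tchar (- k) p \<partial>torus)"
  proof (cases "snd k = 0")
    case True
    have "(\<integral>p. lift_x g1 p * f p * tchar (- k) p \<partial>torus) =
      (\<integral>x. (\<integral>y. (of_real (g1 x) * wave (- fst k) x) * f (x, y) \<partial>circ) \<partial>circ)"
      using integrable_times_tchar[OF integrable_lift(2), of "- k"] True
      by (subst integral_torus_iterated(2)) (auto simp: lift_x_def tensor_def tchar_def mult_ac)
    also have "\<dots> = (\<integral>x. of_real (g1 x) * m x * wave (- fst k) x \<partial>circ)"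
      by (simp add: m_def mult_ac)
    finally show ?thesis by simp
  qed simp
  finally show ?thesis by (simp add: fcoeff_def m_def)
qed

lemma integrable_G_fun: "integrable torus (G_fun g1 g2 f)"
  unfolding G_fun_eq[abs_def]
  by (intro Bochner_Integration.integrable_add Bochner_Integration.integrable_diff integrable_mult_right integrable_lift)

text \<open>The factor \<open>2 * pi\<close> of the marginals matches the normalisation of the
  subtracted means: \<open>1 / (2 * pi)\<close> and \<open>2 * pi / (2 * pi)^2\<close> cancel on
  precisely those lines on which a marginal contributes.\<close>

lemma fcoeff_G_fun:
  "fcoeff (G_fun g1 g2 f) k = (1 / (2 * pi)) *
    ((if fst k = 0 then 0 else fcoeff (\<lambda>p. lift_y g2 p * f p) k) +
     (if snd k = 0 then 0 else fcoeff (\<lambda>p. lift_x g1 p * f p) k))"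
proof -
  let ?a = "\<lambda>p. lift_y g2 p * f p" and ?b = "\<lambda>p. lift_x g1 p * f p"
  let ?c = "\<lambda>p. lift_y g2 p * (\<integral>x'. f (x', snd p) \<partial>circ)"
  let ?d = "\<lambda>p. lift_x g1 p * (\<integral>y'. f (fst p, y') \<partial>circ)"
  let ?A = "\<lambda>p. (1 / (2 * pi)) * ?a p + (- 1 / (2 * pi)\<^sup>2) * ?c p"
  let ?B = "\<lambda>p. (1 / (2 * pi)) * ?b p + (- 1 / (2 * pi)\<^sup>2) * ?d p"
  have i: "integrable torus ?A" "integrable torus ?B"
    by (intro Bochner_Integration.integrable_add integrable_mult_right integrable_lift)+
  have "G_fun g1 g2 f = (\<lambda>p. 1 * ?A p + 1 * ?B p)"
    by (simp add: G_fun_eq fun_eq_iff)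
  then have "fcoeff (G_fun g1 g2 f) k = 1 * fcoeff ?A k + 1 * fcoeff ?B k"
    by (simp only: fcoeff_linear[OF i])
  also have "fcoeff ?A k = (1 / (2 * pi)) * fcoeff ?a k + (- 1 / (2 * pi)\<^sup>2) * fcoeff ?c k"
    by (rule fcoeff_linear) (rule integrable_lift)+
  also have "fcoeff ?B k = (1 / (2 * pi)) * fcoeff ?b k + (- 1 / (2 * pi)\<^sup>2) * fcoeff ?d k"
    by (rule fcoeff_linear) (rule integrable_lift)+
  finally show ?thesis
    unfolding fcoeff_marginal_x fcoeff_marginal_y
    by (cases "fst k = 0"; cases "snd k = 0") (simp_all add: field_simps power2_eq_square)
qed

end

text \<open>Truncations of the control operator to finitely many shifts. As finite linear
  combinations of coefficients they are measurable in time and commute with time integrals.\<close>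

definition control_coeff :: "(real \<Rightarrow> real) \<Rightarrow> (real \<Rightarrow> real) \<Rightarrow> (int \<times> int \<Rightarrow> complex) \<Rightarrow> nat \<Rightarrow> int \<times> int \<Rightarrow> complex" where
  "control_coeff g1 g2 c n k = (1 / (2 * pi)) *
    ((if fst k = 0 then 0 else (\<Sum>j\<in>freq_box n. fcoeff (lift_y g2) j * c (k - j))) +
     (if snd k = 0 then 0 else (\<Sum>j\<in>freq_box n. fcoeff (lift_x g1) j * c (k - j))))"

lemma control_coeff_tendsto:
  assumes g: "control_profile g1" "control_profile g2" and f: "represents f u" and v: "represents (G_fun g1 g2 f) v"
  shows "(\<lambda>n. control_coeff g1 g2 (fourier_coeff u) n k) \<longlonglongrightarrow> fourier_coeff v k"
proof -
  have i: "integrable torus f" using f by (simp add: represents_iff)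
  have fu: "fourier_coeff u = fcoeff f" using f by (simp add: fun_eq_iff fourier_coeff_represents)
  show ?thesis
    using fcoeff_lift_tendsto(1)[OF g(1) i, of k] fcoeff_lift_tendsto(2)[OF g(2) i, of k]
    unfolding fourier_coeff_represents[OF v] fcoeff_G_fun[OF i g] control_coeff_def fu
    by (auto intro!: tendsto_intros)
qed

text \<open>Limits of \<open>control_coeff\<close> depend on the coefficients of \<open>u\<close>
  only, so every representing function yields the same distribution and the description in
  \<open>G_op\<close> denotes.\<close>

lemma G_op_coeff:
  assumes g: "control_profile g1" "control_profile g2" and f: "represents f u"
  shows "(\<lambda>n. control_coeff g1 g2 (fourier_coeff u) n k) \<longlonglongrightarrow> fourier_coeff (G_op g1 g2 u) k"
proof -
  have i: "integrable torus f" and p: "torus_periodic f" using f by (auto simp: represents_iff)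
  have "torus_periodic (G_fun g1 g2 f)"
    using p test_function_periodic[OF test_function_lift(1)[OF g(1)]] test_function_periodic[OF test_function_lift(2)[OF g(2)]]
    by (simp add: torus_periodic_def G_fun_eq)
  then obtain v where v: "represents (G_fun g1 g2 f) v"
    using represents_ex[OF _ integrable_G_fun[OF i g]] by blast
  have "G_op g1 g2 u = v"
    unfolding G_op_def
  proof (rule the_equality)
    show "\<exists>f. represents f u \<and> represents (G_fun g1 g2 f) v" using f v by blast
    fix v' assume "\<exists>f. represents f u \<and> represents (G_fun g1 g2 f) v'"
    then show "v' = v"
      using control_coeff_tendsto[OF g] f v by (blast intro: distribution_eqI LIMSEQ_unique)
  qed
  then show ?thesis using control_coeff_tendsto[OF g f v] by simp
qed

section \<open>Sobolev membership and norms through coefficients\<close>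

lemma one_le_weight: "0 \<le> s \<Longrightarrow> 1 \<le> (1 + freq_abs k) powr s"
  using freq_abs_nonneg[of k] by (intro ge_one_powr_ge_zero) auto

lemma summable_square_if_weighted:
  assumes "0 \<le> s" "(\<lambda>k. (1 + freq_abs k) powr (2 * s) * (cmod (c k))\<^sup>2) summable_on UNIV"
  shows "(\<lambda>k. (cmod (c k))\<^sup>2) summable_on UNIV"
  by (rule summable_on_comparison_test[OF assms(2)])
     (use one_le_weight[of "2 * s"] assms(1) in \<open>auto simp: mult_le_cancel_right1\<close>)

lemma sobolev_ex:
  assumes "0 \<le> s" "(\<lambda>k. (1 + freq_abs k) powr (2 * s) * (cmod (c k))\<^sup>2) summable_on UNIV"
  obtains u where "u \<in> sobolev s" "\<And>k. fourier_coeff u k = c k"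
proof -
  obtain f u where u: "represents f u" "\<And>k. fourier_coeff u k = c k"
    using riesz_fischer[OF summable_square_if_weighted[OF assms]] by blast
  with assms(2) have "u \<in> sobolev s" by (simp add: sobolev_def)
  with u that show ?thesis by blast
qed

lemma sobolev_represents:
  assumes "0 \<le> s" "u \<in> sobolev s"
  obtains f where "represents f u"
proof -
  obtain f v where v: "represents f v" "\<And>k. fourier_coeff v k = fourier_coeff u k"
    using riesz_fischer[OF summable_square_if_weighted[OF assms(1)]] assms(2) unfolding sobolev_def by blast
  then have "v = u" by (intro distribution_eqI)
  with v that show ?thesis by blast
qed

lemma sobolev_summable:
  "u \<in> sobolev s \<Longrightarrow> (\<lambda>k. (1 + freq_abs k) powr (2 * s) * (cmod (fourier_coeff u k))\<^sup>2) summable_on UNIV"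
  by (simp add: sobolev_def)

lemma sobolev_norm_square:
  "(sobolev_norm s u)\<^sup>2 = (2 * pi)\<^sup>2 * (\<Sum>\<^sub>\<infinity>k. (1 + freq_abs k) powr (2 * s) * (cmod (fourier_coeff u k))\<^sup>2)"
  unfolding sobolev_norm_def by (intro real_sqrt_pow2 mult_nonneg_nonneg infsum_nonneg) auto

lemma sobolev_norm_nonneg: "0 \<le> sobolev_norm s u"
  unfolding sobolev_norm_def by (intro real_sqrt_ge_zero mult_nonneg_nonneg infsum_nonneg) auto

lemma sobolevI:
  assumes "\<And>K. finite K \<Longrightarrow> (2 * pi)\<^sup>2 * (\<Sum>k\<in>K. (1 + freq_abs k) powr (2 * s) * (cmod (fourier_coeff u k))\<^sup>2) \<le> C\<^sup>2"
    and "0 \<le> C"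
  shows "u \<in> sobolev s" "sobolev_norm s u \<le> C"
proof -
  let ?F = "\<lambda>k. (1 + freq_abs k) powr (2 * s) * (cmod (fourier_coeff u k))\<^sup>2"
  have b: "sum ?F K \<le> C\<^sup>2 / (2 * pi)\<^sup>2" if "finite K" for K
    using assms(1)[OF that] by (simp add: field_simps)
  have s: "?F summable_on UNIV"
    by (rule nonneg_bdd_above_summable_on) (auto intro!: bdd_aboveI[of _ "C\<^sup>2 / (2 * pi)\<^sup>2"] b)
  then show "u \<in> sobolev s" by (simp add: sobolev_def)
  have "infsum ?F UNIV \<le> C\<^sup>2 / (2 * pi)\<^sup>2"
    by (rule infsum_le_finite_sums[OF s]) (use b in auto)
  then have "(sobolev_norm s u)\<^sup>2 \<le> C\<^sup>2"
    unfolding sobolev_norm_square by (simp add: field_simps)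
  then show "sobolev_norm s u \<le> C" using assms(2) by (rule power2_le_imp_le)
qed

lemma sobolev_norm_finite_sum:
  assumes "u \<in> sobolev s" "finite K"
  shows "(2 * pi)\<^sup>2 * (\<Sum>k\<in>K. (1 + freq_abs k) powr (2 * s) * (cmod (fourier_coeff u k))\<^sup>2) \<le> (sobolev_norm s u)\<^sup>2"
  unfolding sobolev_norm_square
  by (intro mult_left_mono finite_sum_le_infsum sobolev_summable assms) auto

text \<open>Young's inequality for the convolution with the rapidly decaying coefficients of the
  lifted profiles; the constant is the sum of the two weighted coefficient sums.\<close>

lemma G_op_sobolev:
  assumes s: "0 \<le> s" and g: "control_profile g1" "control_profile g2"
  obtains C where "0 \<le> C" "\<And>u. u \<in> sobolev s \<Longrightarrow> G_op g1 g2 u \<in> sobolev s"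
    "\<And>u. u \<in> sobolev s \<Longrightarrow> sobolev_norm s (G_op g1 g2 u) \<le> C * sobolev_norm s u"
proof -
  \<comment> \<open>Absorbs the factor 2 that arises from squaring a sum of two terms.\<close>
  have four_pi: "2 \<le> (2 * pi)\<^sup>2"
    using mult_mono[of 2 "2 * pi" 1 "2 * pi"] pi_gt3 by (simp add: power2_eq_square)
  define A where "A h = (\<Sum>\<^sub>\<infinity>j. (1 + freq_abs j) powr s * cmod (fcoeff h j))" for h
  have A0: "0 \<le> A h" for h unfolding A_def by (intro infsum_nonneg) auto
  have *: "G_op g1 g2 u \<in> sobolev s \<and> sobolev_norm s (G_op g1 g2 u) \<le> (A (lift_y g2) + A (lift_x g1)) * sobolev_norm s u"
    if u: "u \<in> sobolev s" for u
  proof -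
    obtain f where f: "represents f u" using sobolev_represents[OF s u] .
    have i: "integrable torus f" using f by (simp add: represents_iff)
    have fu: "fcoeff f = fourier_coeff u" using f by (simp add: fun_eq_iff fourier_coeff_represents)
    define D where "D = (\<Sum>\<^sub>\<infinity>k. (1 + freq_abs k) powr (2 * s) * (cmod (fourier_coeff u k))\<^sup>2)"
    have D0: "0 \<le> D" unfolding D_def by (intro infsum_nonneg) auto
    define B1 where "B1 = fcoeff (\<lambda>p. lift_x g1 p * f p)"
    define B2 where "B2 = fcoeff (\<lambda>p. lift_y g2 p * f p)"
    have b1: "(\<Sum>k\<in>K. (1 + freq_abs k) powr (2 * s) * (cmod (B1 k))\<^sup>2) \<le> (A (lift_x g1))\<^sup>2 * D" if "finite K" for K
      unfolding A_def D_def B1_def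
      by (rule weighted_convolution_bound[OF s summable_on_weighted_fcoeff[OF test_function_lift(1)[OF g(1)]] sobolev_summable[OF u]
          fcoeff_lift_tendsto(1)[OF g(1) i, unfolded fu] that])
    have b2: "(\<Sum>k\<in>K. (1 + freq_abs k) powr (2 * s) * (cmod (B2 k))\<^sup>2) \<le> (A (lift_y g2))\<^sup>2 * D" if "finite K" for K
      unfolding A_def D_def B2_def
      by (rule weighted_convolution_bound[OF s summable_on_weighted_fcoeff[OF test_function_lift(2)[OF g(2)]] sobolev_summable[OF u]
          fcoeff_lift_tendsto(2)[OF g(2) i, unfolded fu] that])
    have G: "cmod (fourier_coeff (G_op g1 g2 u) k) \<le> (1 / (2 * pi)) * (cmod (B2 k) + cmod (B1 k))" for k
    proof -
      have "(\<lambda>n. control_coeff g1 g2 (fourier_coeff u) n k) \<longlonglongrightarrow> (1 / (2 * pi)) *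
          ((if fst k = 0 then 0 else B2 k) + (if snd k = 0 then 0 else B1 k))"
        using fcoeff_lift_tendsto(1)[OF g(1) i, of k] fcoeff_lift_tendsto(2)[OF g(2) i, of k]
        unfolding control_coeff_def fu B1_def B2_def by (auto intro!: tendsto_intros)
      then have "fourier_coeff (G_op g1 g2 u) k = (1 / (2 * pi)) * ((if fst k = 0 then 0 else B2 k) + (if snd k = 0 then 0 else B1 k))"
        using G_op_coeff[OF g f, of k] LIMSEQ_unique by blast
      then show ?thesis
        using norm_triangle_ineq[of "B2 k" "B1 k"]
        by (auto simp: norm_mult norm_divide intro!: divide_right_mono)
    qed
    have "(2 * pi)\<^sup>2 * (\<Sum>k\<in>K. (1 + freq_abs k) powr (2 * s) * (cmod (fourier_coeff (G_op g1 g2 u) k))\<^sup>2)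
        \<le> ((A (lift_y g2) + A (lift_x g1)) * sobolev_norm s u)\<^sup>2" if K: "finite K" for K
    proof -
      have cancel: "(2 * pi)\<^sup>2 * (x * ((1 / (2 * pi)\<^sup>2) * y)) = x * y" for x y :: real
        by simp
      have "(2 * pi)\<^sup>2 * (\<Sum>k\<in>K. (1 + freq_abs k) powr (2 * s) * (cmod (fourier_coeff (G_op g1 g2 u) k))\<^sup>2)
        \<le> (2 * pi)\<^sup>2 * (\<Sum>k\<in>K. (1 + freq_abs k) powr (2 * s) * ((1 / (2 * pi)\<^sup>2) * (2 * (cmod (B2 k))\<^sup>2 + 2 * (cmod (B1 k))\<^sup>2)))"
      proof (intro mult_left_mono sum_mono)
        fix k
        have "(cmod (fourier_coeff (G_op g1 g2 u) k))\<^sup>2 \<le> ((1 / (2 * pi)) * (cmod (B2 k) + cmod (B1 k)))\<^sup>2"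
          by (intro power_mono G) auto
        also have "\<dots> = (1 / (2 * pi)\<^sup>2) * (cmod (B2 k) + cmod (B1 k))\<^sup>2"
          by (simp add: power_mult_distrib power_divide)
        also have "\<dots> \<le> (1 / (2 * pi)\<^sup>2) * (2 * (cmod (B2 k))\<^sup>2 + 2 * (cmod (B1 k))\<^sup>2)"
          using sum_squares_bound[of "cmod (B2 k)" "cmod (B1 k)"] by (intro mult_left_mono) (auto simp: power2_sum)
        finally show "(cmod (fourier_coeff (G_op g1 g2 u) k))\<^sup>2 \<le> (1 / (2 * pi)\<^sup>2) * (2 * (cmod (B2 k))\<^sup>2 + 2 * (cmod (B1 k))\<^sup>2)" .
      qed auto
      also have "\<dots> = 2 * (\<Sum>k\<in>K. (1 + freq_abs k) powr (2 * s) * (cmod (B2 k))\<^sup>2)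
          + 2 * (\<Sum>k\<in>K. (1 + freq_abs k) powr (2 * s) * (cmod (B1 k))\<^sup>2)"
        by (simp only: sum_distrib_left cancel) (simp add: sum.distrib algebra_simps)
      also have "\<dots> \<le> 2 * ((A (lift_y g2))\<^sup>2 * D) + 2 * ((A (lift_x g1))\<^sup>2 * D)"
        using b1[OF K] b2[OF K] by linarith
      also have "\<dots> \<le> ((A (lift_y g2))\<^sup>2 + (A (lift_x g1))\<^sup>2) * ((2 * pi)\<^sup>2 * D)"
        using mult_right_mono[of 2 "(2 * pi)\<^sup>2" "((A (lift_y g2))\<^sup>2 + (A (lift_x g1))\<^sup>2) * D"] D0 four_pi
        by (simp add: algebra_simps)
      also have "\<dots> \<le> (A (lift_y g2) + A (lift_x g1))\<^sup>2 * ((2 * pi)\<^sup>2 * D)"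
        using D0 A0 by (intro mult_right_mono) (auto simp: power2_sum)
      also have "\<dots> = ((A (lift_y g2) + A (lift_x g1)) * sobolev_norm s u)\<^sup>2"
        by (simp only: power_mult_distrib sobolev_norm_square D_def)
      finally show ?thesis .
    qed
    then show ?thesis
      using sobolevI[of s "G_op g1 g2 u" "(A (lift_y g2) + A (lift_x g1)) * sobolev_norm s u"] A0 sobolev_norm_nonneg by simp
  qed
  show ?thesis by (rule that[of "A (lift_y g2) + A (lift_x g1)"]) (use * A0 in auto)
qed

section \<open>Bochner integrals in Sobolev spaces\<close>

text \<open>Dominated convergence for series. A general filter is allowed, since both sequences and
  limits within a time interval occur.\<close>

lemma infsum_dominated_tendsto_0:
  fixes f :: "'b \<Rightarrow> 'a \<Rightarrow> real"
  assumes g: "g summable_on UNIV" and le: "\<And>t k. 0 \<le> f t k" "\<forall>\<^sub>F t in F. \<forall>k. f t k \<le> g k"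
    and lim: "\<And>k. ((\<lambda>t. f t k) \<longlongrightarrow> 0) F"
  shows "((\<lambda>t. \<Sum>\<^sub>\<infinity>k. f t k) \<longlongrightarrow> 0) F"
proof (rule tendstoI)
  fix e :: real assume e: "0 < e"
  have "\<forall>\<^sub>F K in finite_subsets_at_top UNIV. dist (sum g K) (infsum g UNIV) < e / 2"
    using infsum_tendsto[OF g] e by (intro tendstoD) auto
  then obtain K where K: "finite K" "dist (sum g K) (infsum g UNIV) < e / 2"
    unfolding eventually_finite_subsets_at_top by blast
  have gK: "g summable_on (- K)" using summable_on_subset_banach[OF g] by auto
  have "infsum g UNIV = infsum g K + infsum g (- K)"
    using K(1) by (subst infsum_Un_disjoint[symmetric]) (auto simp: gK Compl_partition)
  then have tail: "infsum g (- K) < e / 2"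
    using K by (simp add: dist_real_def)
  have "((\<lambda>t. \<Sum>k\<in>K. f t k) \<longlongrightarrow> 0) F"
    by (rule tendsto_null_sum) (rule lim)
  then have "\<forall>\<^sub>F t in F. dist (\<Sum>k\<in>K. f t k) 0 < e / 2"
    using e by (intro tendstoD) auto
  then show "\<forall>\<^sub>F t in F. dist (\<Sum>\<^sub>\<infinity>k. f t k) 0 < e"
    using le(2)
  proof eventually_elim
    fix t assume t: "dist (\<Sum>k\<in>K. f t k) 0 < e / 2" "\<forall>k. f t k \<le> g k"
    have s: "f t summable_on A" for A
      by (rule summable_on_subset_banach[of _ UNIV], rule summable_on_comparison_test[OF g]) (use t(2) le(1) in auto)
    have "infsum (f t) UNIV = infsum (f t) K + infsum (f t) (- K)"
      using K(1) by (subst infsum_Un_disjoint[symmetric]) (auto simp: s Compl_partition)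
    also have "infsum (f t) (- K) \<le> infsum g (- K)"
      using t(2) by (intro infsum_mono s gK) auto
    finally have "infsum (f t) UNIV < e" using t(1) tail K(1) by (simp add: dist_real_def)
    moreover have "0 \<le> infsum (f t) UNIV" by (intro infsum_nonneg le(1))
    ultimately show "dist (infsum (f t) UNIV) 0 < e" by simp
  qed
qed

lemma sobolev_dominated:
  assumes u: "u \<in> sobolev s" and C: "0 \<le> C" "\<And>k. cmod (fourier_coeff v k) \<le> C * cmod (fourier_coeff u k)"
  shows "v \<in> sobolev s" "sobolev_norm s v \<le> C * sobolev_norm s u"
proof -
  have "(2 * pi)\<^sup>2 * (\<Sum>k\<in>K. (1 + freq_abs k) powr (2 * s) * (cmod (fourier_coeff v k))\<^sup>2) \<le> (C * sobolev_norm s u)\<^sup>2"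
    if K: "finite K" for K
  proof -
    have "(2 * pi)\<^sup>2 * (\<Sum>k\<in>K. (1 + freq_abs k) powr (2 * s) * (cmod (fourier_coeff v k))\<^sup>2) \<le>
      (2 * pi)\<^sup>2 * (\<Sum>k\<in>K. (1 + freq_abs k) powr (2 * s) * (C * cmod (fourier_coeff u k))\<^sup>2)"
      by (intro mult_left_mono sum_mono power_mono C) auto
    also have "\<dots> = C\<^sup>2 * ((2 * pi)\<^sup>2 * (\<Sum>k\<in>K. (1 + freq_abs k) powr (2 * s) * (cmod (fourier_coeff u k))\<^sup>2))"
      by (simp add: sum_distrib_left power_mult_distrib mult_ac)
    also have "\<dots> \<le> C\<^sup>2 * (sobolev_norm s u)\<^sup>2"
      by (intro mult_left_mono sobolev_norm_finite_sum u K) auto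
    finally show ?thesis by (simp add: power_mult_distrib)
  qed
  then show "v \<in> sobolev s" "sobolev_norm s v \<le> C * sobolev_norm s u"
    using sobolevI[of s v "C * sobolev_norm s u"] C sobolev_norm_nonneg by simp_all
qed

lemma cmod_add_square_le: "(cmod (a + b))\<^sup>2 \<le> 2 * (cmod a)\<^sup>2 + 2 * (cmod b)\<^sup>2"
proof -
  have "(cmod (a + b))\<^sup>2 \<le> (cmod a + cmod b)\<^sup>2" by (intro power_mono norm_triangle_ineq) auto
  also have "\<dots> \<le> 2 * (cmod a)\<^sup>2 + 2 * (cmod b)\<^sup>2"
    using sum_squares_bound[of "cmod a" "cmod b"] by (simp add: power2_sum)
  finally show ?thesis .
qed

lemma sobolev_add:
  assumes "u \<in> sobolev s" "v \<in> sobolev s"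
  shows "u + v \<in> sobolev s"
  unfolding sobolev_def mem_Collect_eq
proof (rule summable_on_comparison_test)
  show "(\<lambda>k. 2 * ((1 + freq_abs k) powr (2 * s) * (cmod (fourier_coeff u k))\<^sup>2) +
      2 * ((1 + freq_abs k) powr (2 * s) * (cmod (fourier_coeff v k))\<^sup>2)) summable_on UNIV"
    by (intro summable_on_add summable_on_cmult_right sobolev_summable assms)
  show "(1 + freq_abs k) powr (2 * s) * (cmod (fourier_coeff (u + v) k))\<^sup>2 \<le>
      2 * ((1 + freq_abs k) powr (2 * s) * (cmod (fourier_coeff u k))\<^sup>2) +
      2 * ((1 + freq_abs k) powr (2 * s) * (cmod (fourier_coeff v k))\<^sup>2)" for k
    using mult_left_mono[OF cmod_add_square_le[of "fourier_coeff u k" "fourier_coeff v k"], of "(1 + freq_abs k) powr (2 * s)"]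
    by (simp add: algebra_simps)
qed auto

lemma sobolev_scaleR: "u \<in> sobolev s \<Longrightarrow> r *\<^sub>R u \<in> sobolev s"
  by (rule sobolev_dominated(1)[where C = "\<bar>r\<bar>"]) auto

lemma sobolev_diff: "u \<in> sobolev s \<Longrightarrow> v \<in> sobolev s \<Longrightarrow> u - v \<in> sobolev s"
  using sobolev_add[of u s "(-1) *\<^sub>R v"] sobolev_scaleR[of v s "-1"] by simp

lemma sobolev_zero: "0 \<in> sobolev s"
  by (simp add: sobolev_def)

lemma sobolev_sum: "(\<And>i. i \<in> A \<Longrightarrow> f i \<in> sobolev s) \<Longrightarrow> sum f A \<in> sobolev s"
  by (induction A rule: infinite_finite_induct) (auto intro: sobolev_add sobolev_zero)

lemma linear_fourier_coeff: "linear (\<lambda>u. fourier_coeff u k)"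
  by (rule linearI) simp_all

lemma fourier_coeff_le_norm:
  assumes "0 \<le> s" "u \<in> sobolev s"
  shows "cmod (fourier_coeff u k) \<le> sobolev_norm s u"
proof -
  have "(cmod (fourier_coeff u k))\<^sup>2 \<le> (2 * pi)\<^sup>2 * ((1 + freq_abs k) powr (2 * s) * (cmod (fourier_coeff u k))\<^sup>2)"
  proof -
    have "1 * (1 * (cmod (fourier_coeff u k))\<^sup>2) \<le> (2 * pi)\<^sup>2 * ((1 + freq_abs k) powr (2 * s) * (cmod (fourier_coeff u k))\<^sup>2)"
      using one_le_weight[of "2 * s" k] assms(1) pi_gt3 by (intro mult_mono one_le_power) auto
    then show ?thesis by simp
  qed
  also have "\<dots> \<le> (sobolev_norm s u)\<^sup>2"
    using sobolev_norm_finite_sum[OF assms(2), of "{k}"] by simp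
  finally show ?thesis by (rule power2_le_imp_le) (rule sobolev_norm_nonneg)
qed

text \<open>The norm is a limit of finite sums over the squares, so measurability can be checked one
  coefficient at a time.\<close>

lemma borel_measurable_sobolev_norm:
  assumes f: "\<And>t. t \<in> space M \<Longrightarrow> f t \<in> sobolev s"
    and [measurable]: "\<And>k. (\<lambda>t. fourier_coeff (f t) k) \<in> borel_measurable M"
  shows "(\<lambda>t. sobolev_norm s (f t)) \<in> borel_measurable M"
proof -
  have "(\<lambda>t. \<Sum>\<^sub>\<infinity>k. (1 + freq_abs k) powr (2 * s) * (cmod (fourier_coeff (f t) k))\<^sup>2) \<in> borel_measurable M"
  proof (rule borel_measurable_LIMSEQ_real)
    show "(\<lambda>n. \<Sum>k\<in>freq_box n. (1 + freq_abs k) powr (2 * s) * (cmod (fourier_coeff (f t) k))\<^sup>2)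
      \<longlonglongrightarrow> (\<Sum>\<^sub>\<infinity>k. (1 + freq_abs k) powr (2 * s) * (cmod (fourier_coeff (f t) k))\<^sup>2)" if "t \<in> space M" for t
      using filterlim_compose[OF infsum_tendsto[OF sobolev_summable[OF f[OF that]]] filterlim_freq_box] .
  qed measurable
  then show ?thesis unfolding sobolev_norm_def by measurable
qed

lemma sobolev_norm_dominated_tendsto:
  assumes u: "u \<in> sobolev s" and C: "\<forall>\<^sub>F n in F. \<forall>k. cmod (fourier_coeff (v n) k) \<le> C * cmod (fourier_coeff u k)"
    and lim: "\<And>k. ((\<lambda>n. fourier_coeff (v n) k) \<longlongrightarrow> 0) F"
  shows "((\<lambda>n. sobolev_norm s (v n)) \<longlongrightarrow> 0) F"
proof -
  have le: "\<forall>\<^sub>F n in F. \<forall>k. (1 + freq_abs k) powr (2 * s) * (cmod (fourier_coeff (v n) k))\<^sup>2 \<le>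
      C\<^sup>2 * ((1 + freq_abs k) powr (2 * s) * (cmod (fourier_coeff u k))\<^sup>2)"
    using C
  proof eventually_elim
    fix n assume n: "\<forall>k. cmod (fourier_coeff (v n) k) \<le> C * cmod (fourier_coeff u k)"
    show "\<forall>k. (1 + freq_abs k) powr (2 * s) * (cmod (fourier_coeff (v n) k))\<^sup>2 \<le>
      C\<^sup>2 * ((1 + freq_abs k) powr (2 * s) * (cmod (fourier_coeff u k))\<^sup>2)"
    proof
      fix k
      show "(1 + freq_abs k) powr (2 * s) * (cmod (fourier_coeff (v n) k))\<^sup>2 \<le>
        C\<^sup>2 * ((1 + freq_abs k) powr (2 * s) * (cmod (fourier_coeff u k))\<^sup>2)"
        using mult_left_mono[OF power_mono[OF n[rule_format, of k] norm_ge_zero, of 2], of "(1 + freq_abs k) powr (2 * s)"]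
        by (simp add: power_mult_distrib mult_ac)
    qed
  qed
  have "((\<lambda>n. \<Sum>\<^sub>\<infinity>k. (1 + freq_abs k) powr (2 * s) * (cmod (fourier_coeff (v n) k))\<^sup>2) \<longlongrightarrow> 0) F"
  proof (rule infsum_dominated_tendsto_0[OF summable_on_cmult_right[OF sobolev_summable[OF u], of "C\<^sup>2"]])
    show "((\<lambda>n. (1 + freq_abs k) powr (2 * s) * (cmod (fourier_coeff (v n) k))\<^sup>2) \<longlongrightarrow> 0) F" for k
    proof (rule tendsto_mult_right_zero)
      show "((\<lambda>n. (cmod (fourier_coeff (v n) k))\<^sup>2) \<longlongrightarrow> 0) F"
        using tendsto_power[OF tendsto_norm_zero[OF lim], of k 2] by simp
    qed
  qed (use le in auto)
  then have "((\<lambda>n. sqrt ((2 * pi)\<^sup>2 * (\<Sum>\<^sub>\<infinity>k. (1 + freq_abs k) powr (2 * s) * (cmod (fourier_coeff (v n) k))\<^sup>2))) \<longlongrightarrow> sqrt ((2 * pi)\<^sup>2 * 0)) F"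
    by (intro tendsto_intros)
  then show ?thesis by (simp add: sobolev_norm_def)
qed

text \<open>Each coefficient is approximated by simple functions dominated by twice its modulus, and
  finitely many modes are assembled at a time. The error is then at most three times the
  coefficient, 1 from the function and 2 from its approximation; this domination is used both for
  sums over modes and for integrals over time.\<close>

lemma sobolev_simple_approx:
  assumes s: "0 \<le> s" and f: "\<And>t. t \<in> space M \<Longrightarrow> f t \<in> sobolev s"
    and m: "\<And>k. (\<lambda>t. fourier_coeff (f t) k) \<in> borel_measurable M"
  shows "\<exists>S. (\<forall>n. sobolev_simple s M (S n)) \<and>
    (\<forall>t\<in>space M. (\<lambda>n. sobolev_norm s (f t - S n t)) \<longlonglongrightarrow> 0) \<and>
    (\<forall>n. \<forall>t\<in>space M. sobolev_norm s (f t - S n t) \<le> 3 * sobolev_norm s (f t))"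
proof -
  \<comment> \<open>Single-mode distributions with a complex amplitude are chosen through their
    coefficients, because distributions are a real vector space here.\<close>
  have "\<exists>e. \<forall>l. fourier_coeff e l = (if l = k then z else 0)" for k z
  proof -
    have "finite {l \<in> UNIV. (cmod (if l = k then z else 0))\<^sup>2 \<noteq> 0}"
      by (rule finite_subset[of _ "{k}"]) (auto split: if_splits)
    then have "(\<lambda>l. (cmod (if l = k then z else 0))\<^sup>2) summable_on UNIV"
      by (rule finite_nonzero_values_imp_summable_on)
    from riesz_fischer[OF this] show ?thesis by metis
  qed
  then obtain e where e: "\<And>k z l. fourier_coeff (e k z) l = (if l = k then z else 0)" by metis
  have "\<exists>F. (\<forall>i. simple_function M (F i)) \<and> (\<forall>t\<in>space M. (\<lambda>i. F i t) \<longlonglongrightarrow> fourier_coeff (f t) k) \<and>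
      (\<forall>i. \<forall>t\<in>space M. dist (F i t) 0 \<le> 2 * dist (fourier_coeff (f t) k) 0)" for k
    by (rule borel_measurable_implies_sequence_metric[OF m])
  then obtain \<sigma> where \<sigma>': "\<And>k. (\<forall>i. simple_function M (\<sigma> k i)) \<and>
      (\<forall>t\<in>space M. (\<lambda>i. \<sigma> k i t) \<longlonglongrightarrow> fourier_coeff (f t) k) \<and>
      (\<forall>i. \<forall>t\<in>space M. dist (\<sigma> k i t) 0 \<le> 2 * dist (fourier_coeff (f t) k) 0)"
    using choice[of "\<lambda>k F. (\<forall>i. simple_function M (F i)) \<and> (\<forall>t\<in>space M. (\<lambda>i. F i t) \<longlonglongrightarrow> fourier_coeff (f t) k) \<and>
      (\<forall>i. \<forall>t\<in>space M. dist (F i t) 0 \<le> 2 * dist (fourier_coeff (f t) k) 0)"] by blast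
  have \<sigma>: "simple_function M (\<sigma> k i)"
    "t \<in> space M \<Longrightarrow> (\<lambda>i. \<sigma> k i t) \<longlonglongrightarrow> fourier_coeff (f t) k"
    "t \<in> space M \<Longrightarrow> cmod (\<sigma> k i t) \<le> 2 * cmod (fourier_coeff (f t) k)" for k i t
    using \<sigma>'[of k] by auto
  define S where "S n t = (\<Sum>k\<in>freq_box n. e k (\<sigma> k n t))" for n t
  have coeff: "fourier_coeff (S n t) k = (if k \<in> freq_box n then \<sigma> k n t else 0)" for n t k
    unfolding S_def linear_sum[OF linear_fourier_coeff] by (simp add: e)
  have sob: "S n t \<in> sobolev s" if "t \<in> space M" for n t
    by (rule sobolev_dominated(1)[OF f[OF that], of 2]) (use \<sigma>(3)[OF that] in \<open>auto simp: coeff\<close>)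
  have "simple_function M (\<lambda>t. \<Sum>k\<in>A. e k (\<sigma> k n t))" if "finite A" for A n
    using that
  proof (induction A rule: finite_induct)
    case (insert k A)
    have "simple_function M (\<lambda>t. e k (\<sigma> k n t) + (\<Sum>k\<in>A. e k (\<sigma> k n t)))"
      by (intro simple_function_compose2[where h = "(+)"] simple_function_compose1[where g = "e k"] \<sigma> insert)
    then show ?case using insert by simp
  qed simp
  then have simple: "sobolev_simple s M (S n)" for n
    using sob by (auto simp: sobolev_simple_def S_def[abs_def])
  have diff: "cmod (fourier_coeff (f t - S n t) k) \<le> 3 * cmod (fourier_coeff (f t) k)" if "t \<in> space M" for t n k
    using \<sigma>(3)[OF that, of k n] norm_triangle_ineq4[of "fourier_coeff (f t) k" "\<sigma> k n t"] by (auto simp: coeff)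
  show ?thesis
  proof (intro exI[of _ S] conjI allI ballI simple)
    fix t assume t: "t \<in> space M"
    show "sobolev_norm s (f t - S n t) \<le> 3 * sobolev_norm s (f t)" for n
      by (rule sobolev_dominated(2)[OF f[OF t]]) (use diff[OF t] in auto)
    show "(\<lambda>n. sobolev_norm s (f t - S n t)) \<longlonglongrightarrow> 0"
    proof (rule sobolev_norm_dominated_tendsto[OF f[OF t], where C = 3])
      show "\<forall>\<^sub>F n in sequentially. \<forall>k. cmod (fourier_coeff (f t - S n t) k) \<le> 3 * cmod (fourier_coeff (f t) k)"
        using diff[OF t] by simp
    next
      fix k
      have "\<forall>\<^sub>F n in sequentially. fourier_coeff (f t) k - \<sigma> k n t = fourier_coeff (f t - S n t) k"
        using freq_box_exhaust[of "{k}", simplified] by (rule eventually_mono) (simp add: coeff)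
      moreover have "(\<lambda>n. fourier_coeff (f t) k - \<sigma> k n t) \<longlonglongrightarrow> 0"
        using tendsto_diff[OF tendsto_const \<sigma>(2)[OF t, of k], of "fourier_coeff (f t) k"] by simp
      ultimately show "(\<lambda>n. fourier_coeff (f t - S n t) k) \<longlonglongrightarrow> 0"
        by (rule Lim_transform_eventually[rotated])
    qed
  qed
qed

lemma sobolev_measurableI:
  assumes "0 \<le> s" "\<And>t. t \<in> space M \<Longrightarrow> f t \<in> sobolev s" "\<And>k. (\<lambda>t. fourier_coeff (f t) k) \<in> borel_measurable M"
  shows "sobolev_measurable s M f"
proof -
  show ?thesis
    using sobolev_simple_approx[OF assms] assms(2) unfolding sobolev_measurable_def by (auto intro!: AE_I2)
qed

lemma integrable_fourier_coeff:
  assumes "0 \<le> s" "\<And>t. t \<in> space M \<Longrightarrow> f t \<in> sobolev s"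
    "\<And>k. (\<lambda>t. fourier_coeff (f t) k) \<in> borel_measurable M" "integrable M (\<lambda>t. sobolev_norm s (f t))"
  shows "integrable M (\<lambda>t. fourier_coeff (f t) k)"
  by (rule Bochner_Integration.integrable_bound[OF assms(4,3)])
     (use fourier_coeff_le_norm[OF assms(1,2)] sobolev_norm_nonneg in auto)

text \<open>Minkowski's integral inequality by duality: the sum of weighted squares is the integral
  of a pairing with its own coefficients, and Cauchy-Schwarz in the modes bounds the pairing at each
  time by the norm.\<close>

lemma sobolev_integral_bound:
  assumes s: "0 \<le> s" and f: "\<And>t. t \<in> space M \<Longrightarrow> f t \<in> sobolev s"
    and m: "\<And>k. (\<lambda>t. fourier_coeff (f t) k) \<in> borel_measurable M"
    and i: "integrable M (\<lambda>t. sobolev_norm s (f t))" and K: "finite K"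
  shows "(2 * pi)\<^sup>2 * (\<Sum>k\<in>K. (1 + freq_abs k) powr (2 * s) * (cmod (\<integral>t. fourier_coeff (f t) k \<partial>M))\<^sup>2)
      \<le> (\<integral>t. sobolev_norm s (f t) \<partial>M)\<^sup>2"
proof -
  define w where "w k = (1 + freq_abs k) powr s" for k
  define c where "c k = (\<integral>t. fourier_coeff (f t) k \<partial>M)" for k
  define N where "N = (\<Sum>k\<in>K. (w k * cmod (c k))\<^sup>2)"
  define I where "I = (\<integral>t. sobolev_norm s (f t) \<partial>M)"
  have N0: "0 \<le> N" unfolding N_def by (intro sum_nonneg) auto
  have I0: "0 \<le> I" unfolding I_def using sobolev_norm_nonneg by (intro Bochner_Integration.integral_nonneg)
  note ic = integrable_fourier_coeff[OF s f m i]
  have "complex_of_real N = (\<Sum>k\<in>K. of_real ((w k)\<^sup>2) * (cnj (c k) * c k))"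
    unfolding N_def of_real_sum
    by (intro sum.cong refl) (simp only: power_mult_distrib of_real_mult complex_norm_square mult.commute[of "cnj _"])
  also have "\<dots> = (\<Sum>k\<in>K. (\<integral>t. of_real ((w k)\<^sup>2) * (cnj (c k) * fourier_coeff (f t) k) \<partial>M))"
    by (simp add: c_def)
  also have "\<dots> = (\<integral>t. (\<Sum>k\<in>K. of_real ((w k)\<^sup>2) * (cnj (c k) * fourier_coeff (f t) k)) \<partial>M)"
    by (intro Bochner_Integration.integral_sum[symmetric] integrable_mult_right ic)
  finally have "N = cmod (\<integral>t. (\<Sum>k\<in>K. of_real ((w k)\<^sup>2) * (cnj (c k) * fourier_coeff (f t) k)) \<partial>M)"
    using N0 by (metis abs_of_nonneg norm_of_real)
  also have "\<dots> \<le> (\<integral>t. cmod (\<Sum>k\<in>K. of_real ((w k)\<^sup>2) * (cnj (c k) * fourier_coeff (f t) k)) \<partial>M)"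
    by (rule integral_norm_bound)
  also have "\<dots> \<le> (\<integral>t. sqrt N * (sobolev_norm s (f t) / (2 * pi)) \<partial>M)"
  proof (rule integral_mono)
    show "integrable M (\<lambda>t. cmod (\<Sum>k\<in>K. of_real ((w k)\<^sup>2) * (cnj (c k) * fourier_coeff (f t) k)))"
      by (intro integrable_norm Bochner_Integration.integrable_sum integrable_mult_right ic)
    show "integrable M (\<lambda>t. sqrt N * (sobolev_norm s (f t) / (2 * pi)))"
      using i by simp
    fix t assume t: "t \<in> space M"
    have "cmod (\<Sum>k\<in>K. of_real ((w k)\<^sup>2) * (cnj (c k) * fourier_coeff (f t) k)) \<le>
        (\<Sum>k\<in>K. (w k * cmod (c k)) * (w k * cmod (fourier_coeff (f t) k)))"
      by (rule order_trans[OF norm_sum]) (simp add: norm_mult power2_eq_square mult_ac w_def)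
    also have "\<dots> \<le> sqrt N * sqrt (\<Sum>k\<in>K. (w k * cmod (fourier_coeff (f t) k))\<^sup>2)"
    proof -
      have "(\<Sum>k\<in>K. (w k * cmod (c k)) * (w k * cmod (fourier_coeff (f t) k))) \<le>
        sqrt ((\<Sum>k\<in>K. (w k * cmod (c k)) * (w k * cmod (fourier_coeff (f t) k)))\<^sup>2)" by simp
      also have "\<dots> \<le> sqrt (N * (\<Sum>k\<in>K. (w k * cmod (fourier_coeff (f t) k))\<^sup>2))"
        unfolding N_def real_sqrt_le_iff by (rule Cauchy_Schwarz_ineq_sum)
      finally show ?thesis by (simp add: real_sqrt_mult)
    qed
    also have "sqrt (\<Sum>k\<in>K. (w k * cmod (fourier_coeff (f t) k))\<^sup>2) \<le> sobolev_norm s (f t) / (2 * pi)"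
    proof (rule real_le_lsqrt)
      show "(\<Sum>k\<in>K. (w k * cmod (fourier_coeff (f t) k))\<^sup>2) \<le> (sobolev_norm s (f t) / (2 * pi))\<^sup>2"
        using sobolev_norm_finite_sum[OF f[OF t] K] unfolding w_def power_mult_distrib powr_double[symmetric] power_divide
        by (subst pos_le_divide_eq) (auto simp: mult.commute power_mult_distrib)
    qed (use sobolev_norm_nonneg in \<open>auto intro: sum_nonneg\<close>)
    finally show "cmod (\<Sum>k\<in>K. of_real ((w k)\<^sup>2) * (cnj (c k) * fourier_coeff (f t) k)) \<le> sqrt N * (sobolev_norm s (f t) / (2 * pi))"
      using N0 by (simp add: mult_left_mono)
  qed
  also have "\<dots> = sqrt N * (I / (2 * pi))" by (simp add: I_def)
  \<comment> \<open>One factor \<open>sqrt N\<close> cancels; the case \<open>N = 0\<close> is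
    separate.\<close>
  finally have "sqrt N * sqrt N \<le> sqrt N * (I / (2 * pi))" using N0 by simp
  then have "sqrt N \<le> I / (2 * pi)"
  proof (cases "N = 0")
    case False
    then have "0 < sqrt N" using N0 by simp
    with \<open>sqrt N * sqrt N \<le> sqrt N * (I / (2 * pi))\<close> show ?thesis by (rule mult_left_le_imp_le)
  qed (use I0 in simp)
  then have "(sqrt N)\<^sup>2 \<le> (I / (2 * pi))\<^sup>2" using N0 by (intro power_mono) auto
  then have "(2 * pi)\<^sup>2 * N \<le> I\<^sup>2" using N0 by (simp add: power_divide field_simps)
  then show ?thesis by (simp add: N_def I_def c_def w_def powr_double power_mult_distrib)
qed

lemma simple_bochner_integrable_coeff:
  assumes "finite_measure M" "simple_function M S"
  shows "Bochner_Integration.simple_bochner_integrable M S" "Bochner_Integration.simple_bochner_integrable M (\<lambda>t. fourier_coeff (S t) k)"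
  using assms(2) finite_measure.emeasure_finite[OF assms(1)]
  by (auto intro!: simple_bochner_integrable.intros simple_function_compose1[where g = "\<lambda>u. fourier_coeff u k"])

lemma fourier_coeff_simple_integral:
  assumes "finite_measure M" "simple_function M S"
  shows "fourier_coeff (Bochner_Integration.simple_bochner_integral M S) k =
    (\<integral>t. fourier_coeff (S t) k \<partial>M)"
  using simple_bochner_integral_linear[OF linear_fourier_coeff simple_bochner_integrable_coeff(1)[OF assms]]
  by (simp add: simple_bochner_integrable_eq_integral[OF simple_bochner_integrable_coeff(2)[OF assms]])

text \<open>Coefficients are linear functionals bounded by the norm, so they pass through the
  approximation by simple functions. Vector integrals are thereby read off one mode at a
  time.\<close>

lemma has_sobolev_integral_coeff:
  assumes M: "finite_measure M" and s: "0 \<le> s" and h: "has_sobolev_integral s M f v"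
    and m: "(\<lambda>t. fourier_coeff (f t) k) \<in> borel_measurable M"
  shows "fourier_coeff v k = (\<integral>t. fourier_coeff (f t) k \<partial>M)"
proof -
  obtain S where S: "\<And>n. sobolev_simple s M (S n)"
    and 1: "(\<lambda>n. \<integral>\<^sup>+ t. ennreal (sobolev_norm s (f t - S n t)) \<partial>M) \<longlonglongrightarrow> 0"
    and 2: "(\<lambda>n. sobolev_norm s (Bochner_Integration.simple_bochner_integral M (S n) - v)) \<longlonglongrightarrow> 0"
    using h unfolding has_sobolev_integral_def by blast
  have f: "f t \<in> sobolev s" if "t \<in> space M" for t
    using h that unfolding has_sobolev_integral_def sobolev_measurable_def by blast
  have v: "v \<in> sobolev s" using h by (simp add: has_sobolev_integral_def)
  have Ss: "simple_function M (S n)" and Sm: "t \<in> space M \<Longrightarrow> S n t \<in> sobolev s" for n t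
    using S[of n] unfolding sobolev_simple_def by auto
  have "has_bochner_integral M (\<lambda>t. fourier_coeff (f t) k) (fourier_coeff v k)"
  proof (rule has_bochner_integral.intros[OF m simple_bochner_integrable_coeff(2)[OF M Ss]])
    show "(\<lambda>n. \<integral>\<^sup>+ t. ennreal (cmod (fourier_coeff (f t) k - fourier_coeff (S n t) k)) \<partial>M) \<longlonglongrightarrow> 0"
    proof (rule tendsto_sandwich[OF _ _ tendsto_const 1])
      show "\<forall>\<^sub>F n in sequentially. (\<integral>\<^sup>+ t. ennreal (cmod (fourier_coeff (f t) k - fourier_coeff (S n t) k)) \<partial>M)
        \<le> (\<integral>\<^sup>+ t. ennreal (sobolev_norm s (f t - S n t)) \<partial>M)"
        using fourier_coeff_le_norm[OF s sobolev_diff[OF f Sm], where k = k]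
        by (intro always_eventually allI nn_integral_mono ennreal_leI) simp
    qed simp
    have "Bochner_Integration.simple_bochner_integral M (S n) \<in> sobolev s" for n
      unfolding simple_bochner_integral_def by (auto intro!: sobolev_sum sobolev_scaleR Sm)
    then have "cmod (fourier_coeff (Bochner_Integration.simple_bochner_integral M (S n)) k - fourier_coeff v k)
       \<le> sobolev_norm s (Bochner_Integration.simple_bochner_integral M (S n) - v)" for n
      using fourier_coeff_le_norm[OF s sobolev_diff[OF _ v], of "Bochner_Integration.simple_bochner_integral M (S n)" k] by simp
    then have "(\<lambda>n. fourier_coeff (Bochner_Integration.simple_bochner_integral M (S n)) k - fourier_coeff v k) \<longlonglongrightarrow> 0"
      by (intro Lim_null_comparison[OF _ 2]) auto
    then show "(\<lambda>n. Bochner_Integration.simple_bochner_integral M (\<lambda>t. fourier_coeff (S n t) k)) \<longlonglongrightarrow> fourier_coeff v k"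
      unfolding Lim_null[of _ "fourier_coeff v k"]
      using simple_bochner_integrable_eq_integral[OF simple_bochner_integrable_coeff(2)[OF M Ss]]
      by (simp add: fourier_coeff_simple_integral[OF M Ss])
  qed
  then show ?thesis by (simp add: has_bochner_integral_integral_eq)
qed

text \<open>The candidate has the integrated coefficients. Minkowski's inequality puts it in the
  space and, applied to \<open>f t - S n t\<close>, shows that the simple integrals converge to
  it.\<close>

lemma has_sobolev_integral_ex:
  assumes M: "finite_measure M" and s: "0 \<le> s" and f: "\<And>t. t \<in> space M \<Longrightarrow> f t \<in> sobolev s"
    and m: "\<And>k. (\<lambda>t. fourier_coeff (f t) k) \<in> borel_measurable M"
    and i: "integrable M (\<lambda>t. sobolev_norm s (f t))"
  obtains v where "has_sobolev_integral s M f v" "\<And>k. fourier_coeff v k = (\<integral>t. fourier_coeff (f t) k \<partial>M)"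
proof -
  define I where "I = (\<integral>t. sobolev_norm s (f t) \<partial>M)"
  have "(\<lambda>k. (1 + freq_abs k) powr (2 * s) * (cmod (\<integral>t. fourier_coeff (f t) k \<partial>M))\<^sup>2) summable_on UNIV"
  proof (rule nonneg_bdd_above_summable_on)
    have "(\<Sum>k\<in>K. (1 + freq_abs k) powr (2 * s) * (cmod (\<integral>t. fourier_coeff (f t) k \<partial>M))\<^sup>2) \<le> I\<^sup>2 / (2 * pi)\<^sup>2"
      if "finite K" for K
      using sobolev_integral_bound[OF s f m i that] by (subst pos_le_divide_eq) (simp_all add: I_def mult.commute)
    then show "bdd_above (sum (\<lambda>k. (1 + freq_abs k) powr (2 * s) * (cmod (\<integral>t. fourier_coeff (f t) k \<partial>M))\<^sup>2)
        ` {F. F \<subseteq> UNIV \<and> finite F})"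
      by (intro bdd_aboveI[of _ "I\<^sup>2 / (2 * pi)\<^sup>2"]) blast
  qed simp
  then obtain v where v: "v \<in> sobolev s" "\<And>k. fourier_coeff v k = (\<integral>t. fourier_coeff (f t) k \<partial>M)"
    by (rule sobolev_ex[OF s]) (rule that)
  obtain S where S': "(\<forall>n. sobolev_simple s M (S n)) \<and>
    (\<forall>t\<in>space M. (\<lambda>n. sobolev_norm s (f t - S n t)) \<longlonglongrightarrow> 0) \<and>
    (\<forall>n. \<forall>t\<in>space M. sobolev_norm s (f t - S n t) \<le> 3 * sobolev_norm s (f t))"
    using sobolev_simple_approx[OF s f m] ..
  have S: "sobolev_simple s M (S n)"
    and S0: "t \<in> space M \<Longrightarrow> (\<lambda>n. sobolev_norm s (f t - S n t)) \<longlonglongrightarrow> 0"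
    and S3: "t \<in> space M \<Longrightarrow> sobolev_norm s (f t - S n t) \<le> 3 * sobolev_norm s (f t)" for n t
    using S' by auto
  have Ss: "simple_function M (S n)" and Sm: "t \<in> space M \<Longrightarrow> S n t \<in> sobolev s" for n t
    using S[of n] unfolding sobolev_simple_def by auto
  have mS [measurable]: "(\<lambda>t. fourier_coeff (S n t) k) \<in> borel_measurable M" for n k
    by (rule borel_measurable_simple_function)
       (rule simple_function_compose1[OF Ss, where g = "\<lambda>u. fourier_coeff u k"])
  have md: "(\<lambda>t. fourier_coeff (f t - S n t) k) \<in> borel_measurable M" for n k
    using m by simp
  note mn [measurable] = borel_measurable_sobolev_norm[OF sobolev_diff[OF f Sm] md]
  have int: "integrable M (\<lambda>t. sobolev_norm s (f t - S n t))" for n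
  proof (rule Bochner_Integration.integrable_bound)
    show "integrable M (\<lambda>t. 3 * sobolev_norm s (f t))" using i by simp
    show "AE t in M. norm (sobolev_norm s (f t - S n t)) \<le> norm (3 * sobolev_norm s (f t))"
      using S3 sobolev_norm_nonneg by (intro AE_I2) (simp add: abs_mult)
  qed (rule mn)
  have lim: "(\<lambda>n. \<integral>t. sobolev_norm s (f t - S n t) \<partial>M) \<longlonglongrightarrow> (\<integral>t. 0 \<partial>M)"
  proof (rule integral_dominated_convergence[where w = "\<lambda>t. 3 * sobolev_norm s (f t)"])
    show "AE t in M. norm (sobolev_norm s (f t - S n t)) \<le> 3 * sobolev_norm s (f t)" for n
      using S3 sobolev_norm_nonneg by (intro AE_I2) simp
  qed (use i S0 in auto)
  have "has_sobolev_integral s M f v"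
    unfolding has_sobolev_integral_def
  proof (intro conjI exI[of _ S] allI S v(1) sobolev_measurableI s f m)
    have "(\<integral>\<^sup>+ t. ennreal (sobolev_norm s (f t - S n t)) \<partial>M) = ennreal (\<integral>t. sobolev_norm s (f t - S n t) \<partial>M)" for n
      by (intro nn_integral_eq_integral int) (simp add: sobolev_norm_nonneg)
    then show "(\<lambda>n. \<integral>\<^sup>+ t. ennreal (sobolev_norm s (f t - S n t)) \<partial>M) \<longlonglongrightarrow> 0"
      using tendsto_ennrealI[OF lim] by simp
    have "sobolev_norm s (Bochner_Integration.simple_bochner_integral M (S n) - v) \<le> (\<integral>t. sobolev_norm s (f t - S n t) \<partial>M)" for n
    proof (rule sobolevI(2))
      have "integrable M (\<lambda>t. fourier_coeff (S n t) k)" for k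
        using simple_bochner_integrable_coeff(2)[OF M Ss] has_bochner_integral_simple_bochner_integrable integrable.intros by blast
      then have "cmod (fourier_coeff (Bochner_Integration.simple_bochner_integral M (S n) - v) k) = 
         cmod (\<integral>t. fourier_coeff (f t - S n t) k \<partial>M)" for k
        using integrable_fourier_coeff[OF s f m i]
        by (simp add: fourier_coeff_simple_integral[OF M Ss] v(2) norm_minus_commute)
      then show "(2 * pi)\<^sup>2 * (\<Sum>k\<in>K. (1 + freq_abs k) powr (2 * s) *
           (cmod (fourier_coeff (Bochner_Integration.simple_bochner_integral M (S n) - v) k))\<^sup>2)
        \<le> (\<integral>t. sobolev_norm s (f t - S n t) \<partial>M)\<^sup>2" if "finite K" for K
        using sobolev_integral_bound[OF s sobolev_diff[OF f Sm] md int that] by simp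
    qed (intro Bochner_Integration.integral_nonneg sobolev_norm_nonneg)
    then show "(\<lambda>n. sobolev_norm s (Bochner_Integration.simple_bochner_integral M (S n) - v)) \<longlonglongrightarrow> 0"
      using lim by (intro tendsto_sandwich[OF _ _ tendsto_const lim[simplified]]) (auto simp: sobolev_norm_nonneg)
  qed
  then show ?thesis using v(2) that by blast
qed

section \<open>Nonharmonic exponential sums\<close>

definition expsum :: "(real \<Rightarrow> complex) \<Rightarrow> real set \<Rightarrow> real \<Rightarrow> complex" where
  "expsum a F t = (\<Sum>l\<in>F. a l * cis (l * t))"

lemma continuous_on_expsum [continuous_intros]:
  "continuous_on S f \<Longrightarrow> continuous_on S (\<lambda>t. expsum a F (f t))"
  unfolding expsum_def by (intro continuous_intros)

lemma has_vector_derivative_cis: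
  "((\<lambda>t. cis (\<xi> * t)) has_vector_derivative \<i> * \<xi> * cis (\<xi> * t)) (at t within S)"
proof -
  have "((\<lambda>z. exp (\<i> * (of_real \<xi> * z))) has_field_derivative \<i> * \<xi> * exp (\<i> * (of_real \<xi> * of_real t))) (at (of_real t))"
    by (auto intro!: derivative_eq_intros)
  from has_vector_derivative_real_field[OF this] show ?thesis
    by (auto simp: cis_conv_exp intro: has_vector_derivative_at_within)
qed

text \<open>Two integrations by parts against \<open>cos (pi * t / L)\<close>, which vanishes at \<open>L / 2\<close> and \<open>- L / 2\<close>.\<close>

lemma cosine_kernel_integral:
  assumes L: "0 < L" and \<xi>: "\<xi>\<^sup>2 \<noteq> (pi / L)\<^sup>2"
  shows "((\<lambda>t. of_real (cos (pi * t / L)) * cis (\<xi> * t)) has_integral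
     of_real (2 * (pi / L) * cos (\<xi> * L / 2) / ((pi / L)\<^sup>2 - \<xi>\<^sup>2))) {- L / 2..L / 2}"
proof -
  define \<kappa> where "\<kappa> = pi / L"
  define D where "D = complex_of_real (\<kappa>\<^sup>2 - \<xi>\<^sup>2)"
  have D: "D \<noteq> 0" using \<xi> by (simp add: D_def \<kappa>_def flip: of_real_power of_real_diff)
  \<comment> \<open>An explicit primitive of the integrand; its denominator is nonzero by the
    hypothesis on \<xi>.\<close>
  define E where "E t = cis (\<xi> * t) * (\<i> * \<xi> * of_real (cos (\<kappa> * t)) + of_real (\<kappa> * sin (\<kappa> * t))) / D" for t
  have "((\<lambda>t. of_real (cos (\<kappa> * t)) * cis (\<xi> * t)) has_integral (E (L / 2) - E (- L / 2))) {- L / 2..L / 2}"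
  proof (rule fundamental_theorem_of_calculus)
    show "(E has_vector_derivative of_real (cos (\<kappa> * t)) * cis (\<xi> * t)) (at t within {- L / 2..L / 2})" for t
    proof -
      have c: "((\<lambda>t. complex_of_real (cos (\<kappa> * t))) has_vector_derivative of_real (- \<kappa> * sin (\<kappa> * t))) (at t within {- L / 2..L / 2})"
        by (intro has_vector_derivative_of_real) (auto intro!: derivative_eq_intros simp: has_real_derivative_iff_has_vector_derivative[symmetric])
      have s: "((\<lambda>t. complex_of_real (\<kappa> * sin (\<kappa> * t))) has_vector_derivative of_real (\<kappa> * (\<kappa> * cos (\<kappa> * t)))) (at t within {- L / 2..L / 2})"
        by (intro has_vector_derivative_of_real) (auto intro!: derivative_eq_intros simp: has_real_derivative_iff_has_vector_derivative[symmetric])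
      have "((\<lambda>t. cis (\<xi> * t) * (\<i> * \<xi> * of_real (cos (\<kappa> * t)) + of_real (\<kappa> * sin (\<kappa> * t))) * (1 / D)) has_vector_derivative
        (cis (\<xi> * t) * (\<i> * \<xi> * of_real (- \<kappa> * sin (\<kappa> * t)) + of_real (\<kappa> * (\<kappa> * cos (\<kappa> * t)))) +
         \<i> * \<xi> * cis (\<xi> * t) * (\<i> * \<xi> * of_real (cos (\<kappa> * t)) + of_real (\<kappa> * sin (\<kappa> * t)))) * (1 / D)) (at t within {- L / 2..L / 2})"
        by (intro has_vector_derivative_mult_left has_vector_derivative_mult has_vector_derivative_cis
            has_vector_derivative_add has_vector_derivative_mult_right c s)
      moreover have "(cis (\<xi> * t) * (\<i> * \<xi> * of_real (- \<kappa> * sin (\<kappa> * t)) + of_real (\<kappa> * (\<kappa> * cos (\<kappa> * t)))) +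
         \<i> * \<xi> * cis (\<xi> * t) * (\<i> * \<xi> * of_real (cos (\<kappa> * t)) + of_real (\<kappa> * sin (\<kappa> * t)))) = of_real (cos (\<kappa> * t)) * cis (\<xi> * t) * D"
        by (simp add: D_def algebra_simps power2_eq_square)
      ultimately show ?thesis using D by (simp add: E_def[abs_def])
    qed
  qed (use L in simp)
  also have "E (L / 2) - E (- L / 2) = of_real (2 * \<kappa> * cos (\<xi> * L / 2) / (\<kappa>\<^sup>2 - \<xi>\<^sup>2))"
  proof -
    have "\<kappa> * (L / 2) = pi / 2" "\<kappa> * (- L / 2) = - (pi / 2)" using L by (simp_all add: \<kappa>_def)
    moreover have "cis (\<xi> * (L / 2)) + cis (\<xi> * (- L / 2)) = of_real (2 * cos (\<xi> * L / 2))"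
      by (simp add: complex_eq_iff)
    ultimately have "E (L / 2) - E (- L / 2) = \<kappa> * of_real (2 * cos (\<xi> * L / 2)) / D"
      unfolding E_def by (simp add: diff_divide_distrib[symmetric] add_divide_distrib[symmetric] distrib_left[symmetric] mult.commute)
    then show ?thesis by (simp add: D_def)
  qed
  finally show ?thesis by (simp add: \<kappa>_def mult.commute)
qed

text \<open>Telescoping, since \<open>4 * j^2 - 1\<close> is the product of the neighbouring odd
  numbers \<open>2 * j - 1\<close> and \<open>2 * j + 1\<close>.\<close>

lemma sum_inverse_odd_products:
  assumes "finite A" "0 \<notin> A"
  shows "(\<Sum>j\<in>A. 1 / (4 * (real j)\<^sup>2 - 1)) \<le> 1 / 2"
proof -
  have "(\<Sum>j\<in>A. 1 / (4 * (real j)\<^sup>2 - 1)) \<le> (\<Sum>j\<in>{1..Max A}. 1 / (4 * (real j)\<^sup>2 - 1))"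
  proof (rule sum_mono2)
    show "A \<subseteq> {1..Max A}" using assms by (metis Max_ge One_nat_def Suc_leI atLeastAtMost_iff gr0I subsetI)
    show "0 \<le> 1 / (4 * (real j)\<^sup>2 - 1)" if "j \<in> {1..Max A} - A" for j
    proof -
      have "1 \<le> (real j)\<^sup>2" using that by (intro one_le_power) auto
      then show ?thesis by simp
    qed
  qed auto
  also have "(\<Sum>j\<in>{1..n}. 1 / (4 * (real j)\<^sup>2 - 1)) = 1 / 2 - 1 / (2 * (2 * real n + 1))" for n
  proof (induction n)
    case (Suc n)
    have *: "1 / (x * (x + 2)) = 1 / (2 * x) - 1 / (2 * (x + 2))" if "0 < x" for x :: real
      using that by (simp add: divide_simps)
    have "4 * (real (Suc n))\<^sup>2 - 1 = (2 * real n + 1) * (2 * real n + 3)"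
      by (simp add: power2_eq_square algebra_simps)
    moreover have "1 / ((2 * real n + 1) * (2 * real n + 3)) =
        1 / (2 * (2 * real n + 1)) - 1 / (2 * (2 * real (Suc n) + 1))"
      using *[of "2 * real n + 1"] by (simp add: algebra_simps)
    ultimately show ?case using Suc by (simp del: of_nat_Suc)
  qed simp
  then have "(\<Sum>j\<in>{1..Max A}. 1 / (4 * (real j)\<^sup>2 - 1)) \<le> 1 / 2" by simp
  finally show ?thesis .
qed

text \<open>Integer parts of 1-separated numbers are distinct, and passing to the integer part does
  not decrease the summand.\<close>

lemma separated_sum_bound:
  assumes F: "finite F" and sep: "\<And>x y. x \<in> F \<Longrightarrow> y \<in> F \<Longrightarrow> x \<noteq> y \<Longrightarrow> 1 \<le> \<bar>x - y\<bar>"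
    and pos: "\<And>x. x \<in> F \<Longrightarrow> 1 \<le> x"
  shows "(\<Sum>x\<in>F. 1 / (4 * x\<^sup>2 - 1)) \<le> (1 / 2 :: real)"
proof -
  define n where "n x = nat \<lfloor>x\<rfloor>" for x :: real
  have n: "1 \<le> real (n x)" "real (n x) \<le> x" "x < real (n x) + 1" if "1 \<le> x" for x
  proof -
    have "real (n x) = of_int \<lfloor>x\<rfloor>" using that by (simp add: n_def)
    moreover have "1 \<le> \<lfloor>x\<rfloor>" using that by simp
    ultimately show "1 \<le> real (n x)" "real (n x) \<le> x" "x < real (n x) + 1" by auto
  qed
  have inj: "inj_on n F"
  proof (rule inj_onI)
    fix x y assume xy: "x \<in> F" "y \<in> F" "n x = n y"
    then have "\<bar>x - y\<bar> < 1" using n[OF pos[OF xy(1)]] n[OF pos[OF xy(2)]] by linarith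
    then show "x = y" using sep[OF xy(1,2)] by fastforce
  qed
  have "(\<Sum>x\<in>F. 1 / (4 * x\<^sup>2 - 1)) \<le> (\<Sum>x\<in>F. 1 / (4 * (real (n x))\<^sup>2 - 1))"
  proof (rule sum_mono)
    fix x assume "x \<in> F"
    note n = n[OF pos[OF this]]
    have "1 \<le> (real (n x))\<^sup>2" using n by (intro one_le_power) auto
    moreover have "(real (n x))\<^sup>2 \<le> x\<^sup>2" using n by (intro power_mono) auto
    ultimately show "1 / (4 * x\<^sup>2 - 1) \<le> 1 / (4 * (real (n x))\<^sup>2 - 1)"
      by (intro divide_left_mono) (auto intro!: mult_pos_pos)
  qed
  also have "\<dots> = (\<Sum>j\<in>n ` F. 1 / (4 * (real j)\<^sup>2 - 1))"
    using inj by (simp add: sum.reindex)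
  also have "\<dots> \<le> 1 / 2"
    using F n(1)[OF pos] by (intro sum_inverse_odd_products) (auto simp: image_iff, force)
  finally show ?thesis .
qed

definition separated :: "real \<Rightarrow> real set \<Rightarrow> bool" where
  "separated \<gamma> A \<longleftrightarrow> (\<forall>x\<in>A. \<forall>y\<in>A. x \<noteq> y \<longrightarrow> \<gamma> \<le> \<bar>x - y\<bar>)"

lemma separated_subset: "separated \<gamma> A \<Longrightarrow> B \<subseteq> A \<Longrightarrow> separated \<gamma> B"
  unfolding separated_def by blast

text \<open>\<rho> is the ratio of \<open>L\<close> to the critical length
  \<open>2 * pi / \<gamma>\<close>. In units of \<gamma> the summand is compared with
  \<open>1 / (4 * y^2 - 1)\<close>, whose sum over each side of \<open>l\<close> is at most 1/2.
  Against the diagonal term \<open>2 * L / pi\<close> the total gains the factor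
  \<open>1 / \<rho>^2\<close>.\<close>

lemma cosine_kernel_sum:
  assumes F: "finite F" "separated \<gamma> F" "l \<in> F" and L: "0 < L" and \<rho>: "1 < \<rho>" "L * \<gamma> = 2 * pi * \<rho>"
  shows "(\<Sum>m\<in>F - {l}. 2 * (pi / L) / ((l - m)\<^sup>2 - (pi / L)\<^sup>2)) \<le> 2 * L / (pi * \<rho>\<^sup>2)"
    "\<And>m. m \<in> F - {l} \<Longrightarrow> (pi / L)\<^sup>2 < (l - m)\<^sup>2"
proof -
  have \<gamma>: "0 < \<gamma>" using L \<rho> by (metis mult_pos_pos not_less_iff_gr_or_eq pi_gt_zero zero_less_mult_pos zero_less_numeral less_trans zero_less_one)
  have L\<gamma>: "L = 2 * pi * \<rho> / \<gamma>" using \<rho> \<gamma> by (simp add: field_simps)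
  have key: "(pi / L)\<^sup>2 < x\<^sup>2 \<and>
      2 * (pi / L) / (x\<^sup>2 - (pi / L)\<^sup>2) \<le> (2 * L / (pi * \<rho>\<^sup>2)) * (1 / (4 * (\<bar>x\<bar> / \<gamma>)\<^sup>2 - 1))" if "\<gamma> \<le> \<bar>x\<bar>" for x
  proof -
    define y where "y = \<bar>x\<bar> / \<gamma>"
    have y: "1 \<le> y" "x\<^sup>2 = \<gamma>\<^sup>2 * y\<^sup>2" using that \<gamma> by (auto simp: y_def power_divide)
    have y2: "1 \<le> y\<^sup>2" using y(1) by (rule one_le_power)
    have p: "pi / L = \<gamma> / (2 * \<rho>)" using \<rho> by (simp add: L\<gamma>)
    have \<rho>2: "1 < \<rho>\<^sup>2" using \<rho>(1) by (simp add: one_less_power)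
    have eq: "x\<^sup>2 - (pi / L)\<^sup>2 = \<gamma>\<^sup>2 * (4 * \<rho>\<^sup>2 * y\<^sup>2 - 1) / (4 * \<rho>\<^sup>2)"
      using \<rho> unfolding p y(2) power_divide by (simp add: field_simps power_mult_distrib)
    \<comment> \<open>\<open>1 < \<rho>\<close> allows \<open>\<rho>^2\<close> to be factored out,
      which produces the gain over the diagonal.\<close>
    have ge: "\<rho>\<^sup>2 * (4 * y\<^sup>2 - 1) \<le> 4 * \<rho>\<^sup>2 * y\<^sup>2 - 1"
      using \<rho>2 by (simp add: algebra_simps)
    have pos: "0 < \<rho>\<^sup>2 * (4 * y\<^sup>2 - 1)" using \<rho>2 y2 by (intro mult_pos_pos) auto
    have d: "x\<^sup>2 - (pi / L)\<^sup>2 \<ge> \<gamma>\<^sup>2 * (\<rho>\<^sup>2 * (4 * y\<^sup>2 - 1)) / (4 * \<rho>\<^sup>2)"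
      unfolding eq by (intro divide_right_mono mult_left_mono ge) auto
    have d0: "0 < \<gamma>\<^sup>2 * (\<rho>\<^sup>2 * (4 * y\<^sup>2 - 1)) / (4 * \<rho>\<^sup>2)" using \<gamma> \<rho>(1) by (intro divide_pos_pos mult_pos_pos[OF _ pos]) auto
    have "2 * (pi / L) / (x\<^sup>2 - (pi / L)\<^sup>2) \<le> 2 * (pi / L) / (\<gamma>\<^sup>2 * (\<rho>\<^sup>2 * (4 * y\<^sup>2 - 1)) / (4 * \<rho>\<^sup>2))"
      using d d0 L by (intro divide_left_mono mult_pos_pos) auto
    also have "\<dots> = (2 * L / (pi * \<rho>\<^sup>2)) * (1 / (4 * y\<^sup>2 - 1)) * (\<rho>\<^sup>2 * (4 * y\<^sup>2 - 1) / (\<rho>\<^sup>2 * (4 * y\<^sup>2 - 1)))"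
      unfolding p L\<gamma> using pos \<rho> \<gamma> by (simp add: field_simps power2_eq_square)
    also have "\<dots> = (2 * L / (pi * \<rho>\<^sup>2)) * (1 / (4 * y\<^sup>2 - 1))" using pos by simp
    finally show ?thesis using d d0 by (simp add: y_def)
  qed
  have sep: "\<gamma> \<le> \<bar>l - m\<bar>" if "m \<in> F - {l}" for m using F that unfolding separated_def by auto
  show "\<And>m. m \<in> F - {l} \<Longrightarrow> (pi / L)\<^sup>2 < (l - m)\<^sup>2" using key sep by blast
  \<comment> \<open>Distances from \<open>l\<close> are separated only among frequencies on the same
    side, so the two sides are summed on their own.\<close>
  have half: "(\<Sum>m\<in>G. 1 / (4 * (\<bar>l - m\<bar> / \<gamma>)\<^sup>2 - 1)) \<le> 1 / 2"
    if G: "G \<subseteq> F - {l}" and side: "(\<forall>m\<in>G. l < m) \<or> (\<forall>m\<in>G. m < l)" for G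
  proof -
    define h where "h m = \<bar>l - m\<bar> / \<gamma>" for m
    have diff: "\<bar>h x - h y\<bar> = \<bar>x - y\<bar> / \<gamma>" if "x \<in> G" "y \<in> G" for x y
    proof -
      from side that have "(l < x \<and> l < y) \<or> (x < l \<and> y < l)" by blast
      then have "\<bar>\<bar>l - x\<bar> - \<bar>l - y\<bar>\<bar> = \<bar>x - y\<bar>" by linarith
      then show ?thesis using \<gamma> by (simp add: h_def diff_divide_distrib[symmetric] abs_divide)
    qed
    have inj: "inj_on h G"
    proof (rule inj_onI)
      fix x y assume "x \<in> G" "y \<in> G" "h x = h y"
      then show "x = y" using diff[of x y] \<gamma> by simp
    qed
    have "(\<Sum>m\<in>G. 1 / (4 * (h m)\<^sup>2 - 1)) = (\<Sum>y\<in>h ` G. 1 / (4 * y\<^sup>2 - 1))"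
      using inj by (simp add: sum.reindex)
    also have "\<dots> \<le> 1 / 2"
    proof (rule separated_sum_bound)
      show "finite (h ` G)" using F(1) G by (meson finite_Diff finite_imageI finite_subset)
      show "1 \<le> y" if y: "y \<in> h ` G" for y
      proof -
        obtain x where "x \<in> G" "y = h x" using y by blast
        moreover then have "\<gamma> \<le> \<bar>l - x\<bar>" using sep G by blast
        ultimately show ?thesis using \<gamma> by (simp add: h_def)
      qed
      fix x y assume "x \<in> h ` G" "y \<in> h ` G" "x \<noteq> y"
      then obtain u v where uv: "u \<in> G" "v \<in> G" "x = h u" "y = h v" "u \<noteq> v" by auto
      then have "\<gamma> \<le> \<bar>u - v\<bar>" using F(2) G unfolding separated_def by blast
      then show "1 \<le> \<bar>x - y\<bar>" using diff[OF uv(1,2)] uv \<gamma> by simp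
    qed
    finally show ?thesis by (simp add: h_def)
  qed
  have "(\<Sum>m\<in>F - {l}. 2 * (pi / L) / ((l - m)\<^sup>2 - (pi / L)\<^sup>2)) \<le>
     (\<Sum>m\<in>F - {l}. (2 * L / (pi * \<rho>\<^sup>2)) * (1 / (4 * (\<bar>l - m\<bar> / \<gamma>)\<^sup>2 - 1)))"
    using key sep by (intro sum_mono) blast
  also have "\<dots> = (2 * L / (pi * \<rho>\<^sup>2)) * (\<Sum>m\<in>{m\<in>F. l < m} \<union> {m\<in>F. m < l}. 1 / (4 * (\<bar>l - m\<bar> / \<gamma>)\<^sup>2 - 1))"
    unfolding sum_distrib_left by (intro sum.cong) auto
  also have "\<dots> = (2 * L / (pi * \<rho>\<^sup>2)) * ((\<Sum>m\<in>{m\<in>F. l < m}. 1 / (4 * (\<bar>l - m\<bar> / \<gamma>)\<^sup>2 - 1)) +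
      (\<Sum>m\<in>{m\<in>F. m < l}. 1 / (4 * (\<bar>l - m\<bar> / \<gamma>)\<^sup>2 - 1)))"
    using F(1) by (subst sum.union_disjoint) auto
  also have "\<dots> \<le> (2 * L / (pi * \<rho>\<^sup>2)) * (1 / 2 + 1 / 2)"
    using L \<rho> by (intro mult_left_mono add_mono half) auto
  finally show "(\<Sum>m\<in>F - {l}. 2 * (pi / L) / ((l - m)\<^sup>2 - (pi / L)\<^sup>2)) \<le> 2 * L / (pi * \<rho>\<^sup>2)" by simp
qed

lemma cmod_square_expsum:
  "complex_of_real ((cmod (expsum a F t))\<^sup>2) = (\<Sum>l\<in>F. \<Sum>m\<in>F. a l * cnj (a m) * cis ((l - m) * t))"
proof -
  have *: "cis ((l - m) * t) = cis (l * t) * cis (- (m * t))" for l m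
    by (simp only: cis_mult) (simp add: left_diff_distrib)
  show ?thesis
    by (simp only: complex_norm_square expsum_def cnj_sum sum_product complex_cnj_mult cis_cnj *) (simp only: mult_ac)
qed

text \<open>The diagonal terms contribute \<open>2 * L / pi\<close>; the off-diagonal ones are dominated by the gap.\<close>

lemma ingham_kernel:
  assumes F: "finite F" "separated \<gamma> F" and L: "0 < L" and \<rho>: "1 < \<rho>" "L * \<gamma> = 2 * pi * \<rho>"
  shows "\<bar>integral {- L / 2..L / 2} (\<lambda>t. cos (pi * t / L) * (cmod (expsum a F t))\<^sup>2) - 2 * L / pi * (\<Sum>l\<in>F. (cmod (a l))\<^sup>2)\<bar>
    \<le> 2 * L / (pi * \<rho>\<^sup>2) * (\<Sum>l\<in>F. (cmod (a l))\<^sup>2)"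
proof -
  define K where "K \<xi> = 2 * (pi / L) * cos (\<xi> * L / 2) / ((pi / L)\<^sup>2 - \<xi>\<^sup>2)" for \<xi>
  define \<kappa> where "\<kappa> \<xi> = 2 * (pi / L) / (\<xi>\<^sup>2 - (pi / L)\<^sup>2)" for \<xi>
  have pL: "0 < pi / L" using L by simp
  have ker: "((\<lambda>t. of_real (cos (pi * t / L)) * cis ((l - m) * t)) has_integral of_real (K (l - m))) {- L / 2..L / 2}"
    if "l \<in> F" "m \<in> F" for l m
    unfolding K_def
  proof (rule cosine_kernel_integral[OF L])
    show "(l - m)\<^sup>2 \<noteq> (pi / L)\<^sup>2"
      using cosine_kernel_sum(2)[OF F that(1) L \<rho>, of m] that pL by (cases "l = m") auto
  qed
  have "((\<lambda>t. \<Sum>l\<in>F. \<Sum>m\<in>F. (a l * cnj (a m)) * (of_real (cos (pi * t / L)) * cis ((l - m) * t))) has_integral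
      (\<Sum>l\<in>F. \<Sum>m\<in>F. (a l * cnj (a m)) * of_real (K (l - m)))) {- L / 2..L / 2}"
    by (intro has_integral_sum has_integral_mult_right ker F)
  also have "(\<lambda>t. \<Sum>l\<in>F. \<Sum>m\<in>F. (a l * cnj (a m)) * (of_real (cos (pi * t / L)) * cis ((l - m) * t))) =
      (\<lambda>t. of_real (cos (pi * t / L) * (cmod (expsum a F t))\<^sup>2))"
    unfolding of_real_mult cmod_square_expsum sum_distrib_left by (simp add: mult_ac)
  finally have 1: "((\<lambda>t. complex_of_real (cos (pi * t / L) * (cmod (expsum a F t))\<^sup>2)) has_integral
      (\<Sum>l\<in>F. \<Sum>m\<in>F. (a l * cnj (a m)) * of_real (K (l - m)))) {- L / 2..L / 2}" .
  have "(\<lambda>t. cos (pi * t / L) * (cmod (expsum a F t))\<^sup>2) integrable_on {- L / 2..L / 2}"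
    using L by (intro integrable_continuous_real continuous_intros) auto
  from has_integral_of_real[OF integrable_integral[OF this], where 'b = complex] 1
  have Q: "complex_of_real (integral {- L / 2..L / 2} (\<lambda>t. cos (pi * t / L) * (cmod (expsum a F t))\<^sup>2)) =
      (\<Sum>l\<in>F. \<Sum>m\<in>F. (a l * cnj (a m)) * of_real (K (l - m)))"
    by (rule has_integral_unique)
  have "K 0 = 2 * L / pi" using L by (simp add: K_def power2_eq_square)
  then have "(\<Sum>l\<in>F. \<Sum>m\<in>F. (a l * cnj (a m)) * of_real (K (l - m))) =
     (\<Sum>l\<in>F. of_real (2 * L / pi * (cmod (a l))\<^sup>2) + (\<Sum>m\<in>F - {l}. (a l * cnj (a m)) * of_real (K (l - m))))"
  proof (intro sum.cong refl)
    fix l assume l: "l \<in> F"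
    have "a l * cnj (a l) * of_real (K (l - l)) = of_real (2 * L / pi * (cmod (a l))\<^sup>2)"
      using \<open>K 0 = 2 * L / pi\<close> by (simp only: complex_norm_square[symmetric] diff_self) (simp add: mult.commute)
    then show "(\<Sum>m\<in>F. (a l * cnj (a m)) * of_real (K (l - m))) =
       of_real (2 * L / pi * (cmod (a l))\<^sup>2) + (\<Sum>m\<in>F - {l}. (a l * cnj (a m)) * of_real (K (l - m)))"
      using sum.remove[OF F(1) l, of "\<lambda>m. (a l * cnj (a m)) * of_real (K (l - m))"] by simp
  qed
  then have "complex_of_real (integral {- L / 2..L / 2} (\<lambda>t. cos (pi * t / L) * (cmod (expsum a F t))\<^sup>2) - 2 * L / pi * (\<Sum>l\<in>F. (cmod (a l))\<^sup>2)) =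
     (\<Sum>l\<in>F. \<Sum>m\<in>F - {l}. (a l * cnj (a m)) * of_real (K (l - m)))"
    unfolding of_real_diff Q by (simp add: sum.distrib sum_distrib_left)
  from arg_cong[OF this, of cmod]
  have "\<bar>integral {- L / 2..L / 2} (\<lambda>t. cos (pi * t / L) * (cmod (expsum a F t))\<^sup>2) - 2 * L / pi * (\<Sum>l\<in>F. (cmod (a l))\<^sup>2)\<bar> =
     cmod (\<Sum>l\<in>F. \<Sum>m\<in>F - {l}. (a l * cnj (a m)) * of_real (K (l - m)))"
    by (simp only: norm_of_real)
  \<comment> \<open>The arithmetic-geometric mean inequality splits each off-diagonal product. Since
    \<kappa> is even, the two halves agree after exchanging \<open>l\<close> and \<open>m\<close>,
    and a single row sum remains, as in Schur's test.\<close>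
  also have "\<dots> \<le> (\<Sum>l\<in>F. \<Sum>m\<in>F - {l}. (1 / 2 * (cmod (a l))\<^sup>2 + 1 / 2 * (cmod (a m))\<^sup>2) * \<kappa> (l - m))"
  proof (intro order_trans[OF norm_sum] sum_mono)
    fix l m assume lm: "l \<in> F" "m \<in> F - {l}"
    have pos: "(pi / L)\<^sup>2 < (l - m)\<^sup>2" by (rule cosine_kernel_sum(2)[OF F lm(1) L \<rho> lm(2)])
    have "\<bar>K (l - m)\<bar> = 2 * (pi / L) * \<bar>cos ((l - m) * L / 2)\<bar> / ((l - m)\<^sup>2 - (pi / L)\<^sup>2)"
      unfolding K_def abs_divide abs_mult using pos L by simp
    also have "\<dots> \<le> 2 * (pi / L) * 1 / ((l - m)\<^sup>2 - (pi / L)\<^sup>2)"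
      using pos L by (intro divide_right_mono mult_left_mono) auto
    finally have K: "\<bar>K (l - m)\<bar> \<le> \<kappa> (l - m)" by (simp add: \<kappa>_def)
    have "cmod (a l) * cmod (a m) \<le> 1 / 2 * (cmod (a l))\<^sup>2 + 1 / 2 * (cmod (a m))\<^sup>2"
      using sum_squares_bound[of "cmod (a l)" "cmod (a m)"] by simp
    then have "(cmod (a l) * cmod (a m)) * \<bar>K (l - m)\<bar> \<le> (1 / 2 * (cmod (a l))\<^sup>2 + 1 / 2 * (cmod (a m))\<^sup>2) * \<kappa> (l - m)"
      using K by (intro mult_mono) auto
    then show "cmod (a l * cnj (a m) * of_real (K (l - m))) \<le> (1 / 2 * (cmod (a l))\<^sup>2 + 1 / 2 * (cmod (a m))\<^sup>2) * \<kappa> (l - m)"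
      by (simp add: norm_mult)
  qed
  also have "\<dots> = (\<Sum>l\<in>F. 1 / 2 * (cmod (a l))\<^sup>2 * (\<Sum>m\<in>F - {l}. \<kappa> (l - m))) +
      (\<Sum>l\<in>F. \<Sum>m\<in>F - {l}. 1 / 2 * (cmod (a m))\<^sup>2 * \<kappa> (l - m))"
    by (simp add: distrib_right sum.distrib sum_distrib_left)
  also have "(\<Sum>l\<in>F. \<Sum>m\<in>F - {l}. 1 / 2 * (cmod (a m))\<^sup>2 * \<kappa> (l - m)) =
      (\<Sum>m\<in>F. \<Sum>l\<in>F - {m}. 1 / 2 * (cmod (a m))\<^sup>2 * \<kappa> (l - m))"
  proof -
    have "(\<Sum>l\<in>F. \<Sum>m\<in>F - {l}. f l m) = (\<Sum>m\<in>F. \<Sum>l\<in>F - {m}. f l m)" for f :: "real \<Rightarrow> real \<Rightarrow> real"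
    proof -
      have "(\<Sum>l\<in>F. \<Sum>m\<in>F - {l}. f l m) = (\<Sum>l\<in>F. \<Sum>m\<in>F. if m = l then 0 else f l m)"
        using F(1) by (intro sum.cong refl sum.mono_neutral_cong_left) auto
      also have "\<dots> = (\<Sum>m\<in>F. \<Sum>l\<in>F. if m = l then 0 else f l m)" by (rule sum.swap)
      also have "\<dots> = (\<Sum>m\<in>F. \<Sum>l\<in>F - {m}. f l m)"
        using F(1) by (intro sum.cong refl sum.mono_neutral_cong_right) auto
      finally show ?thesis .
    qed
    then show ?thesis .
  qed
  also have "(\<Sum>m\<in>F. \<Sum>l\<in>F - {m}. 1 / 2 * (cmod (a m))\<^sup>2 * \<kappa> (l - m)) =
      (\<Sum>l\<in>F. 1 / 2 * (cmod (a l))\<^sup>2 * (\<Sum>m\<in>F - {l}. \<kappa> (l - m)))"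
    by (simp add: \<kappa>_def power2_commute sum_distrib_left)
  also have "(\<Sum>l\<in>F. 1 / 2 * (cmod (a l))\<^sup>2 * (\<Sum>m\<in>F - {l}. \<kappa> (l - m))) +
      (\<Sum>l\<in>F. 1 / 2 * (cmod (a l))\<^sup>2 * (\<Sum>m\<in>F - {l}. \<kappa> (l - m))) =
      (\<Sum>l\<in>F. (cmod (a l))\<^sup>2 * (\<Sum>m\<in>F - {l}. \<kappa> (l - m)))"
    by (simp add: sum.distrib[symmetric])
  also have "\<dots> \<le> (\<Sum>l\<in>F. (cmod (a l))\<^sup>2 * (2 * L / (pi * \<rho>\<^sup>2)))"
    using cosine_kernel_sum(1)[OF F _ L \<rho>] by (intro sum_mono mult_left_mono) (auto simp: \<kappa>_def)
  also have "\<dots> = 2 * L / (pi * \<rho>\<^sup>2) * (\<Sum>l\<in>F. (cmod (a l))\<^sup>2)"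
    by (simp only: sum_distrib_left mult.commute[of _ "2 * L / (pi * \<rho>\<^sup>2)"])
  finally show ?thesis .
qed

lemma expsum_shift: "expsum a F (t + c) = expsum (\<lambda>l. a l * cis (l * c)) F t"
  by (simp add: expsum_def distrib_left cis_mult[symmetric] mult_ac)

lemma integral_expsum_shift:
  "integral {0..T} (\<lambda>t. (cmod (expsum a F t))\<^sup>2) =
    integral {- T / 2..T / 2} (\<lambda>t. (cmod (expsum (\<lambda>l. a l * cis (l * (T / 2))) F t))\<^sup>2)"
proof -
  have "(\<lambda>t. (cmod (expsum a F t))\<^sup>2) \<circ> (+) (T / 2) = (\<lambda>t. (cmod (expsum (\<lambda>l. a l * cis (l * (T / 2))) F t))\<^sup>2)"
    by (simp only: fun_eq_iff o_def add.commute[of "T / 2"] expsum_shift) simp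
  then show ?thesis
    using integral_shift_Icc_real[of "- T / 2" "T / 2" "\<lambda>t. (cmod (expsum a F t))\<^sup>2" "T / 2"] by simp
qed

text \<open>The lower half of the Riesz sequence property of the exponentials on
  \<open>{0..T}\<close>, known in control theory as an observability estimate. Its frequencies are
  real numbers, so coinciding eigenfrequencies count once.\<close>

definition riesz_lower :: "real \<Rightarrow> real set \<Rightarrow> bool" where
  "riesz_lower T \<Lambda> \<longleftrightarrow> (\<exists>c>0. \<forall>F a. finite F \<longrightarrow> F \<subseteq> \<Lambda> \<longrightarrow>
     c * (\<Sum>l\<in>F. (cmod (a l))\<^sup>2) \<le> integral {0..T} (\<lambda>t. (cmod (expsum a F t))\<^sup>2))"

text \<open>The cosine weight is at most 1, so the plain integral dominates the weighted one, whose
  diagonal part beats the off-diagonal part as soon as \<open>T\<close> exceeds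
  \<open>2 * pi / \<gamma>\<close>.\<close>

lemma ingham_lower:
  assumes sep: "separated \<gamma> \<Lambda>" and \<gamma>: "0 < \<gamma>" and T: "2 * pi < T * \<gamma>"
  shows "riesz_lower T \<Lambda>"
proof -
  define \<rho> where "\<rho> = T * \<gamma> / (2 * pi)"
  have \<rho>: "1 < \<rho>" "T * \<gamma> = 2 * pi * \<rho>" using T by (auto simp: \<rho>_def)
  have T0: "0 < T" using T \<gamma> pi_gt_zero by (metis less_trans mult_pos_pos zero_less_mult_pos2 zero_less_numeral)
  have \<rho>2: "1 < \<rho>\<^sup>2" using \<rho>(1) by (simp add: one_less_power)
  define c where "c = 2 * T / pi - 2 * T / (pi * \<rho>\<^sup>2)"
  have "1 / \<rho>\<^sup>2 < 1" using \<rho>2 by (subst divide_less_eq_1_pos) auto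
  then have "2 * T / pi * (1 / \<rho>\<^sup>2) < 2 * T / pi * 1" using T0 by (intro mult_strict_left_mono) auto
  then have c: "0 < c" by (simp add: c_def)
  show ?thesis
    unfolding riesz_lower_def
  proof (intro exI[of _ c] conjI c allI impI)
    fix F a assume F: "finite F" "F \<subseteq> \<Lambda>"
    define a' where "a' l = a l * cis (l * (T / 2))" for l
    have "c * (\<Sum>l\<in>F. (cmod (a l))\<^sup>2) = c * (\<Sum>l\<in>F. (cmod (a' l))\<^sup>2)" by (simp add: a'_def norm_mult)
    also have "\<dots> \<le> integral {- T / 2..T / 2} (\<lambda>t. cos (pi * t / T) * (cmod (expsum a' F t))\<^sup>2)"
      using ingham_kernel[OF F(1) separated_subset[OF sep F(2)] T0 \<rho>, of a'] by (simp add: c_def algebra_simps abs_le_iff)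
    also have "\<dots> \<le> integral {- T / 2..T / 2} (\<lambda>t. (cmod (expsum a' F t))\<^sup>2)"
      using T0 by (intro integral_le integrable_continuous_real continuous_intros) (auto simp: mult_left_le_one_le intro!: mult_left_le[of "cos _", unfolded mult.commute[of _ "cos _"]])
    finally show "c * (\<Sum>l\<in>F. (cmod (a l))\<^sup>2) \<le> integral {0..T} (\<lambda>t. (cmod (expsum a F t))\<^sup>2)"
      unfolding integral_expsum_shift a'_def[abs_def] .
  qed
qed

text \<open>For an upper bound the window may be enlarged: \<open>L\<close> is so long that the
  cosine is at least 1/2 on the interval of interest and that \<rho> is at least 2. The time
  \<open>T\<close> may then be arbitrarily short.\<close>

lemma ingham_upper:
  assumes sep: "separated \<gamma> \<Lambda>" and \<gamma>: "0 < \<gamma>" and T: "0 < T"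
  obtains C where "0 < C" "\<And>F a. finite F \<Longrightarrow> F \<subseteq> \<Lambda> \<Longrightarrow>
     integral {0..T} (\<lambda>t. (cmod (expsum a F t))\<^sup>2) \<le> C * (\<Sum>l\<in>F. (cmod (a l))\<^sup>2)"
proof -
  define L where "L = max (2 * T) (4 * pi / \<gamma>)"
  define \<rho> where "\<rho> = L * \<gamma> / (2 * pi)"
  have L: "0 < L" "2 * T \<le> L" using T by (auto simp: L_def)
  have "4 * pi / \<gamma> \<le> L" by (simp add: L_def)
  then have "4 * pi \<le> L * \<gamma>" using \<gamma> by (simp add: field_simps)
  then have "4 * pi / (2 * pi) \<le> \<rho>" unfolding \<rho>_def by (intro divide_right_mono) auto
  then have \<rho>: "1 < \<rho>" by simp
  have \<rho>L: "L * \<gamma> = 2 * pi * \<rho>" by (simp add: \<rho>_def)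
  define C where "C = 2 * (2 * L / pi + 2 * L / (pi * \<rho>\<^sup>2))"
  show ?thesis
  proof (rule that[of C])
    show "0 < C" using L \<rho> by (auto simp: C_def intro!: mult_pos_pos add_pos_pos divide_pos_pos)
    fix F a assume F: "finite F" "F \<subseteq> \<Lambda>"
    define a' where "a' l = a l * cis (l * (T / 2))" for l
    let ?g = "\<lambda>t. 2 * (cos (pi * t / L) * (cmod (expsum a' F t))\<^sup>2)"
    have cos_pos: "1 / 2 \<le> cos (pi * t / L)" if "t \<in> {- T / 2..T / 2}" for t
    proof -
      have "\<bar>t / L\<bar> \<le> 1 / 4" using that L by (auto simp: abs_divide field_simps abs_le_iff)
      then have "pi * \<bar>t / L\<bar> \<le> pi * (1 / 4)" by (intro mult_left_mono) auto
      moreover have "\<bar>pi * t / L\<bar> = pi * \<bar>t / L\<bar>" by (simp add: abs_mult abs_divide)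
      ultimately have "\<bar>pi * t / L\<bar> \<le> pi / 3" using pi_gt_zero by linarith
      then have "cos (pi / 3) \<le> cos \<bar>pi * t / L\<bar>" by (intro cos_monotone_0_pi_le) auto
      then show ?thesis by (simp only: cos_abs_real cos_60)
    qed
    have cos_nn: "0 \<le> cos (pi * t / L)" if "t \<in> {- L / 2..L / 2}" for t
    proof (rule cos_ge_zero)
      have "\<bar>t / L\<bar> \<le> 1 / 2" using that L by (auto simp: abs_divide field_simps abs_le_iff)
      then have "pi * \<bar>t / L\<bar> \<le> pi * (1 / 2)" by (intro mult_left_mono) auto
      moreover have "\<bar>pi * t / L\<bar> = pi * \<bar>t / L\<bar>" by (simp add: abs_mult abs_divide)
      ultimately have "\<bar>pi * t / L\<bar> \<le> pi / 2" by linarith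
      then show "- (pi / 2) \<le> pi * t / L" "pi * t / L \<le> pi / 2" by linarith+
    qed
    have int: "?g integrable_on {x..y}" for x y using L by (intro integrable_continuous_real continuous_intros) auto
    have "integral {- T / 2..T / 2} (\<lambda>t. (cmod (expsum a' F t))\<^sup>2) \<le> integral {- T / 2..T / 2} ?g"
    proof (intro integral_le integrable_continuous_real continuous_intros)
      fix t assume "t \<in> {- T / 2..T / 2}"
      from mult_right_mono[OF cos_pos[OF this], of "(cmod (expsum a' F t))\<^sup>2"]
      show "(cmod (expsum a' F t))\<^sup>2 \<le> ?g t" by simp
    qed (use L in auto)
    also have "\<dots> \<le> integral {- L / 2..L / 2} ?g"
      using L cos_nn T by (intro integral_subset_le int) auto
    also have "\<dots> = 2 * integral {- L / 2..L / 2} (\<lambda>t. cos (pi * t / L) * (cmod (expsum a' F t))\<^sup>2)"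
      by simp
    also have "\<dots> \<le> 2 * (2 * L / (pi * \<rho>\<^sup>2) * (\<Sum>l\<in>F. (cmod (a' l))\<^sup>2) + 2 * L / pi * (\<Sum>l\<in>F. (cmod (a' l))\<^sup>2))"
      using abs_le_D1[OF ingham_kernel[OF F(1) separated_subset[OF sep F(2)] L(1) \<rho> \<rho>L, of a']]
      unfolding diff_le_eq by (rule mult_left_mono) simp
    also have "\<dots> = C * (\<Sum>l\<in>F. (cmod (a' l))\<^sup>2)" by (simp add: C_def algebra_simps)
    also have "\<dots> = C * (\<Sum>l\<in>F. (cmod (a l))\<^sup>2)" by (simp add: a'_def norm_mult)
    finally show "integral {0..T} (\<lambda>t. (cmod (expsum a F t))\<^sup>2) \<le> C * (\<Sum>l\<in>F. (cmod (a l))\<^sup>2)"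
      unfolding integral_expsum_shift a'_def[abs_def] .
  qed
qed

section \<open>Haraux's addition of finitely many frequencies\<close>

lemma one_minus_sinc_lower:
  assumes "0 < (y0 :: real)"
  obtains \<eta> :: real where "0 < \<eta>" "\<And>y. y0 \<le> \<bar>y\<bar> \<Longrightarrow> \<eta> \<le> 1 - sin y / y"
proof
  \<comment> \<open>For \<open>2 \<le> y\<close> the bound 1/2 holds; for smaller y the double-angle
    formula gives \<open>1 - cos (y / 2)\<close>. The cap at 2 keeps the cosine in its decreasing,
    nonnegative range.\<close>
  define z where "z = min y0 2"
  have z: "0 < z" "z \<le> 2" using assms by (auto simp: z_def)
  have "cos (z / 2) < cos 0"
    using z pi_gt3 by (intro cos_monotone_0_pi) auto
  then show "0 < min (1 / 2) (1 - cos (z / 2))" by simp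
  have *: "min (1 / 2) (1 - cos (z / 2)) \<le> 1 - sin y / y" if "y0 \<le> y" for y
  proof (cases "2 \<le> y")
    case True
    then have "sin y / y \<le> 1 / 2" using sin_le_one[of y] by (subst pos_divide_le_eq) linarith+
    then show ?thesis by simp
  next
    case False
    then have y: "0 < y" "y < 2" "z \<le> y" using that assms by (auto simp: z_def)
    have "sin y = 2 * sin (y / 2) * cos (y / 2)" using sin_double[of "y / 2"] by simp
    also have "\<dots> \<le> 2 * (y / 2) * cos (y / 2)"
      using y pi_gt3 sin_x_le_x[of "y / 2"] by (intro mult_right_mono cos_ge_zero) auto
    also have "\<dots> \<le> y * cos (z / 2)"
      using y z pi_gt3 by (simp add: cos_monotone_0_pi_le)
    finally have "sin y / y \<le> cos (z / 2)" using y by (simp add: field_simps)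
    then show ?thesis by simp
  qed
  show "min (1 / 2) (1 - cos (z / 2)) \<le> 1 - sin y / y" if "y0 \<le> \<bar>y\<bar>" for y
  proof (cases "0 \<le> y")
    case True
    then show ?thesis using * that by simp
  next
    case False
    then show ?thesis using *[of "- y"] that by simp
  qed
qed

lemma cmod_one_minus_cis: "(cmod (1 - cis y))\<^sup>2 = 2 - 2 * cos y"
proof -
  have "(cmod (1 - cis y))\<^sup>2 = (1 - cos y)\<^sup>2 + (sin y)\<^sup>2"
    by (simp add: cmod_power2)
  also have "\<dots> = 2 - 2 * cos y"
    using sin_cos_squared_add[of y] by (simp add: power2_eq_square algebra_simps)
  finally show ?thesis .
qed

text \<open>Haraux's device: \<open>f t - cis (- \<mu> * \<sigma>) * f (t + \<sigma>)\<close> has no component at the frequency \<open>\<mu>\<close>,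
  and averaging over \<open>\<sigma>\<close> in \<open>{0..\<delta>}\<close> keeps the other coefficients under control.\<close>

lemma riesz_lower_insert:
  assumes low: "riesz_lower T' \<Lambda>" and T: "0 < T'" "T' < T" and \<gamma>: "0 < \<gamma>" "separated \<gamma> (insert \<mu> \<Lambda>)" and \<mu>: "\<mu> \<notin> \<Lambda>"
  shows "riesz_lower T (insert \<mu> \<Lambda>)"
proof -
  obtain c where c: "0 < c" "\<And>F a. finite F \<Longrightarrow> F \<subseteq> \<Lambda> \<Longrightarrow>
     c * (\<Sum>l\<in>F. (cmod (a l))\<^sup>2) \<le> integral {0..T'} (\<lambda>t. (cmod (expsum a F t))\<^sup>2)"
    using low unfolding riesz_lower_def by blast
  obtain C where C: "0 < C" "\<And>F a. finite F \<Longrightarrow> F \<subseteq> \<Lambda> \<Longrightarrow>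
     integral {0..T} (\<lambda>t. (cmod (expsum a F t))\<^sup>2) \<le> C * (\<Sum>l\<in>F. (cmod (a l))\<^sup>2)"
    using ingham_upper[OF separated_subset[OF \<gamma>(2) subset_insertI] \<gamma>(1), of T] T by (metis less_trans)
  \<comment> \<open>The spare time is the range of the averaging shifts, so that both
    \<open>f\<close> and its translates stay within \<open>{0..T}\<close>.\<close>
  define \<delta> where "\<delta> = T - T'"
  have \<delta>: "0 < \<delta>" using T by (simp add: \<delta>_def)
  obtain \<eta> where \<eta>: "0 < \<eta>" "\<And>y. \<gamma> * \<delta> \<le> \<bar>y\<bar> \<Longrightarrow> \<eta> \<le> 1 - sin y / y"
    using one_minus_sinc_lower[of "\<gamma> * \<delta>"] \<gamma> \<delta> by (metis mult_pos_pos)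
  \<comment> \<open>\<open>A\<close> bounds the old coefficients by the integral of the full sum;
    \<open>B\<close> also accounts for the new one, recovered by subtracting the old part, whose
    size the upper constant \<open>C\<close> controls.\<close>
  define A where "A = 2 / (c * \<eta>)"
  have A: "0 < A" using c \<eta> by (simp add: A_def)
  define B where "B = A + (2 + 2 * C * A) / T"
  have B: "0 < B" using A C T by (auto simp: B_def intro!: add_pos_nonneg divide_nonneg_pos)
  have main: "(\<Sum>l\<in>F. (cmod (a l))\<^sup>2) + (cmod z)\<^sup>2 \<le> B * integral {0..T} (\<lambda>t. (cmod (expsum a F t + z * cis (\<mu> * t)))\<^sup>2)"
    if F: "finite F" "F \<subseteq> \<Lambda>" for F and a :: "real \<Rightarrow> complex" and z
  proof -
    define f where "f t = expsum a F t + z * cis (\<mu> * t)" for t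
    define I where "I = integral {0..T} (\<lambda>t. (cmod (f t))\<^sup>2)"
    have cf: "continuous_on S f" for S unfolding f_def by (intro continuous_intros)
    have int: "(\<lambda>t. (cmod (f (t + \<sigma>)))\<^sup>2) integrable_on {x..y}" for \<sigma> x y
      by (intro integrable_continuous_real continuous_intros continuous_on_compose2[OF cf]) auto
    have le_I: "integral {0..T'} (\<lambda>t. (cmod (f (t + \<sigma>)))\<^sup>2) \<le> I" if "\<sigma> \<in> {0..\<delta>}" for \<sigma>
    proof -
      have "integral {0..T'} (\<lambda>t. (cmod (f (t + \<sigma>)))\<^sup>2) = integral {0 + \<sigma>..T' + \<sigma>} (\<lambda>t. (cmod (f t))\<^sup>2)"
        using integral_shift_Icc_real[of 0 T' "\<lambda>t. (cmod (f t))\<^sup>2" \<sigma>] by (simp add: o_def add.commute)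
      also have "\<dots> \<le> I"
        unfolding I_def using that int[of 0] T by (intro integral_subset_le) (auto simp: \<delta>_def)
      finally show ?thesis .
    qed
    have step: "c * (\<Sum>l\<in>F. (cmod (a l))\<^sup>2 * (2 - 2 * cos ((l - \<mu>) * \<sigma>))) \<le> 4 * I" if \<sigma>: "\<sigma> \<in> {0..\<delta>}" for \<sigma>
    proof -
      define a' where "a' l = a l * (1 - cis ((l - \<mu>) * \<sigma>))" for l
      have g: "expsum a' F t = f t - cis (- \<mu> * \<sigma>) * f (t + \<sigma>)" for t
      proof -
        have *: "a' l * cis (l * t) = a l * cis (l * t) - cis (- \<mu> * \<sigma>) * (a l * cis (l * (t + \<sigma>)))" for l
        proof -
          have "cis ((l - \<mu>) * \<sigma>) * cis (l * t) = cis (- \<mu> * \<sigma>) * cis (l * (t + \<sigma>))"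
            by (simp add: cis_mult algebra_simps)
          then show ?thesis unfolding a'_def by (simp add: algebra_simps)
        qed
        have "cis (- \<mu> * \<sigma>) * cis (\<mu> * (t + \<sigma>)) = cis (\<mu> * t)"
          by (simp add: cis_mult algebra_simps)
        then show ?thesis
          unfolding expsum_def f_def * sum_subtractf sum_distrib_left[symmetric] by (simp add: algebra_simps)
      qed
      have "c * (\<Sum>l\<in>F. (cmod (a l))\<^sup>2 * (2 - 2 * cos ((l - \<mu>) * \<sigma>))) = c * (\<Sum>l\<in>F. (cmod (a' l))\<^sup>2)"
        by (simp add: a'_def norm_mult power_mult_distrib cmod_one_minus_cis)
      also have "\<dots> \<le> integral {0..T'} (\<lambda>t. (cmod (expsum a' F t))\<^sup>2)" by (rule c(2)[OF F])
      also have "\<dots> \<le> integral {0..T'} (\<lambda>t. 2 * (cmod (f (t + 0)))\<^sup>2 + 2 * (cmod (f (t + \<sigma>)))\<^sup>2)"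
      proof (intro integral_le integrable_add integrable_on_mult_right int)
        show "(\<lambda>t. (cmod (expsum a' F t))\<^sup>2) integrable_on {0..T'}"
          by (intro integrable_continuous_real continuous_intros)
        show "(cmod (expsum a' F t))\<^sup>2 \<le> 2 * (cmod (f (t + 0)))\<^sup>2 + 2 * (cmod (f (t + \<sigma>)))\<^sup>2" for t
          using cmod_add_square_le[of "f t" "- (cis (- \<mu> * \<sigma>) * f (t + \<sigma>))"] by (simp add: g norm_mult)
      qed
      also have "\<dots> = 2 * integral {0..T'} (\<lambda>t. (cmod (f (t + 0)))\<^sup>2) + 2 * integral {0..T'} (\<lambda>t. (cmod (f (t + \<sigma>)))\<^sup>2)"
        by (subst integral_add) (auto intro!: integrable_on_mult_right int simp del: add_0_right)
      also have "\<dots> \<le> 4 * I" using le_I[of 0] le_I[OF \<sigma>] \<delta> by simp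
      finally show ?thesis .
    qed
    \<comment> \<open>For a single shift \<open>cis ((l - \<mu>) * \<sigma>)\<close> may equal 1 and
      lose the coefficient. Integrated over \<sigma>, the factor becomes
      \<open>2 * \<delta> * (1 - sin y / y)\<close> with \<open>y = (l - \<mu>) * \<delta>\<close>,
      and the gap keeps \<open>y\<close> away from 0.\<close>
    have "((\<lambda>\<sigma>. c * (\<Sum>l\<in>F. (cmod (a l))\<^sup>2 * (2 - 2 * cos ((l - \<mu>) * \<sigma>)))) has_integral
       (c * (\<Sum>l\<in>F. (cmod (a l))\<^sup>2 * (2 * \<delta> - 2 * (sin ((l - \<mu>) * \<delta>) / (l - \<mu>)))))) {0..\<delta>}"
    proof (intro has_integral_mult_right has_integral_sum F(1))
      fix l assume "l \<in> F"
      then have l: "l - \<mu> \<noteq> 0" using F \<mu> by auto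
      have "((\<lambda>\<sigma>. 2 - 2 * cos ((l - \<mu>) * \<sigma>)) has_integral
        ((2 * \<delta> - 2 * (sin ((l - \<mu>) * \<delta>) / (l - \<mu>))) - (2 * 0 - 2 * (sin ((l - \<mu>) * 0) / (l - \<mu>))))) {0..\<delta>}"
        using \<delta> l by (intro fundamental_theorem_of_calculus)
          (auto intro!: derivative_eq_intros simp: has_real_derivative_iff_has_vector_derivative[symmetric])
      then show "((\<lambda>\<sigma>. 2 - 2 * cos ((l - \<mu>) * \<sigma>)) has_integral (2 * \<delta> - 2 * (sin ((l - \<mu>) * \<delta>) / (l - \<mu>)))) {0..\<delta>}"
        by simp
    qed
    moreover have "((\<lambda>\<sigma>. 4 * I) has_integral (\<delta> - 0) *\<^sub>R (4 * I)) {0..\<delta>}"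
      using \<delta> has_integral_const_real[of "4 * I" 0 \<delta>] by simp
    ultimately have "c * (\<Sum>l\<in>F. (cmod (a l))\<^sup>2 * (2 * \<delta> - 2 * (sin ((l - \<mu>) * \<delta>) / (l - \<mu>)))) \<le> (\<delta> - 0) *\<^sub>R (4 * I)"
      using step by (rule has_integral_le)
    moreover have "c * (\<Sum>l\<in>F. (cmod (a l))\<^sup>2 * (2 * \<delta> * \<eta>)) \<le>
        c * (\<Sum>l\<in>F. (cmod (a l))\<^sup>2 * (2 * \<delta> - 2 * (sin ((l - \<mu>) * \<delta>) / (l - \<mu>))))"
    proof (intro mult_left_mono sum_mono)
      fix l assume l: "l \<in> F"
      then have "l \<noteq> \<mu>" "\<gamma> \<le> \<bar>l - \<mu>\<bar>" using F \<mu> \<gamma>(2) unfolding separated_def by auto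
      then have "\<eta> \<le> 1 - sin ((l - \<mu>) * \<delta>) / ((l - \<mu>) * \<delta>)"
        using \<delta> by (intro \<eta>(2)) (simp add: abs_mult)
      then have "2 * \<delta> * \<eta> \<le> 2 * \<delta> * (1 - sin ((l - \<mu>) * \<delta>) / ((l - \<mu>) * \<delta>))"
        using \<delta> by (intro mult_left_mono) auto
      also have "\<dots> = 2 * \<delta> - 2 * (sin ((l - \<mu>) * \<delta>) / (l - \<mu>))"
        using \<delta> \<open>l \<noteq> \<mu>\<close> by (simp add: right_diff_distrib)
      finally show "2 * \<delta> * \<eta> \<le> 2 * \<delta> - 2 * (sin ((l - \<mu>) * \<delta>) / (l - \<mu>))" .
    qed (use c in auto)
    moreover have "c * (\<Sum>l\<in>F. (cmod (a l))\<^sup>2 * (2 * \<delta> * \<eta>)) = 2 * (\<delta> * ((c * \<eta>) * (\<Sum>l\<in>F. (cmod (a l))\<^sup>2)))"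
      unfolding sum_distrib_right[symmetric] by (simp add: mult_ac)
    moreover have "(\<delta> - 0) *\<^sub>R (4 * I) = 2 * (\<delta> * (2 * I))" by simp
    ultimately have "\<delta> * ((c * \<eta>) * (\<Sum>l\<in>F. (cmod (a l))\<^sup>2)) \<le> \<delta> * (2 * I)"
      by linarith
    then have "(c * \<eta>) * (\<Sum>l\<in>F. (cmod (a l))\<^sup>2) \<le> 2 * I" using \<delta> by (rule mult_left_le_imp_le)
    then have 1: "(\<Sum>l\<in>F. (cmod (a l))\<^sup>2) \<le> A * I"
      using c \<eta> by (simp add: A_def field_simps)
    have "T * (cmod z)\<^sup>2 = integral {0..T} (\<lambda>t. (cmod (z * cis (\<mu> * t)))\<^sup>2)"
      using T by (simp add: norm_mult)
    also have "\<dots> \<le> integral {0..T} (\<lambda>t. 2 * (cmod (f (t + 0)))\<^sup>2 + 2 * (cmod (expsum a F t))\<^sup>2)"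
    proof (intro integral_le integrable_add integrable_on_mult_right int)
      show "(cmod (z * cis (\<mu> * t)))\<^sup>2 \<le> 2 * (cmod (f (t + 0)))\<^sup>2 + 2 * (cmod (expsum a F t))\<^sup>2" for t
        using cmod_add_square_le[of "f t" "- expsum a F t"] by (simp add: f_def)
    qed (intro integrable_continuous_real continuous_intros)+
    also have "\<dots> = 2 * I + 2 * integral {0..T} (\<lambda>t. (cmod (expsum a F t))\<^sup>2)"
      unfolding I_def using int[of 0]
      by (subst integral_add) (auto intro!: integrable_on_mult_right integrable_continuous_real continuous_intros)
    also have "\<dots> \<le> 2 * I + 2 * (C * (A * I))"
    proof -
      have "C * (\<Sum>l\<in>F. (cmod (a l))\<^sup>2) \<le> C * (A * I)" using 1 C(1) by (intro mult_left_mono) auto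
      then show ?thesis using C(2)[OF F, of a] by linarith
    qed
    finally have "(cmod z)\<^sup>2 \<le> (2 + 2 * C * A) / T * I"
      using T by (simp add: field_simps)
    with 1 show ?thesis by (simp add: B_def I_def f_def algebra_simps)
  qed
  show ?thesis
    unfolding riesz_lower_def
  proof (intro exI[of _ "1 / B"] conjI allI impI)
    show "0 < 1 / B" using B by simp
    fix F and a :: "real \<Rightarrow> complex" assume F: "finite F" "F \<subseteq> insert \<mu> \<Lambda>"
    define z where "z = (if \<mu> \<in> F then a \<mu> else 0)"
    have e: "expsum a F t = expsum a (F - {\<mu>}) t + z * cis (\<mu> * t)" for t
      unfolding expsum_def z_def using F(1) by (cases "\<mu> \<in> F") (simp_all add: sum.remove)
    have "(\<Sum>l\<in>F. (cmod (a l))\<^sup>2) = (\<Sum>l\<in>F - {\<mu>}. (cmod (a l))\<^sup>2) + (cmod z)\<^sup>2"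
      unfolding z_def using F(1) by (cases "\<mu> \<in> F") (simp_all add: sum.remove)
    also have "\<dots> \<le> B * integral {0..T} (\<lambda>t. (cmod (expsum a F t))\<^sup>2)"
      unfolding e using F by (intro main) auto
    finally show "1 / B * (\<Sum>l\<in>F. (cmod (a l))\<^sup>2) \<le> integral {0..T} (\<lambda>t. (cmod (expsum a F t))\<^sup>2)"
      using B by (simp add: field_simps)
  qed
qed

text \<open>Frequencies are restored one by one. Each insertion needs a strictly longer time, so the
  induction claims the bound for every time above the critical one and spends half of the remaining
  slack at each step.\<close>

lemma haraux_lower:
  assumes sep: "separated \<gamma> \<Lambda>" "0 < \<gamma>" and S: "finite S" "separated \<gamma>' (\<Lambda> - S)" "0 < \<gamma>'"
    and T: "2 * pi < T * \<gamma>'"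
  shows "riesz_lower T \<Lambda>"
proof -
  define T0 where "T0 = 2 * pi / \<gamma>'"
  have T0: "0 < T0" using S by (simp add: T0_def)
  have "\<forall>T>T0. riesz_lower T ((\<Lambda> - S) \<union> (S' \<inter> \<Lambda>))" if "finite S'" for S'
    using that
  proof (induction S' rule: finite_induct)
    case empty
    show ?case
    proof (intro allI impI)
      fix T assume "T0 < T"
      then have "2 * pi < T * \<gamma>'" using S(3) by (simp add: T0_def field_simps)
      then show "riesz_lower T (\<Lambda> - S \<union> {} \<inter> \<Lambda>)" using ingham_lower[OF S(2,3)] by simp
    qed
  next
    case (insert \<mu> S')
    show ?case
    proof (intro allI impI)
      fix T assume T: "T0 < T"
      let ?A = "(\<Lambda> - S) \<union> (S' \<inter> \<Lambda>)"
      show "riesz_lower T (\<Lambda> - S \<union> insert \<mu> S' \<inter> \<Lambda>)"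
      proof (cases "\<mu> \<in> \<Lambda> \<and> \<mu> \<notin> ?A")
        case True
        have "riesz_lower T (insert \<mu> ?A)"
        proof (rule riesz_lower_insert)
          show "riesz_lower ((T0 + T) / 2) ?A" using insert.IH T by auto
          show "separated \<gamma> (insert \<mu> ?A)" using sep(1) True by (auto intro: separated_subset)
        qed (use T T0 True sep in auto)
        moreover have "insert \<mu> ?A = \<Lambda> - S \<union> insert \<mu> S' \<inter> \<Lambda>" using True by auto
        ultimately show ?thesis by simp
      next
        case False
        then have "\<Lambda> - S \<union> insert \<mu> S' \<inter> \<Lambda> = ?A" by auto
        then show ?thesis using insert.IH T by simp
      qed
    qed
  qed
  from this[OF S(1)] have "riesz_lower T ((\<Lambda> - S) \<union> (S \<inter> \<Lambda>))"
    using T S(3) by (simp add: T0_def field_simps)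
  moreover have "(\<Lambda> - S) \<union> (S \<inter> \<Lambda>) = \<Lambda>" by auto
  ultimately show ?thesis by simp
qed

section \<open>Biorthogonal functions\<close>

lemma complex_zero_if_first_order_small:
  assumes "\<And>z. 2 * Re (cnj z * x) \<le> B * (cmod z)\<^sup>2"
  shows "x = 0"
proof (rule ccontr)
  assume x: "x \<noteq> 0"
  \<comment> \<open>Testing with a small multiple of \<open>x\<close> makes the quadratic side
    smaller than the linear one; this choice gives \<open>B * e < 1\<close> for either sign of
    \<open>B\<close>.\<close>
  define e where "e = 1 / (\<bar>B\<bar> + 1)"
  have e: "0 < e" "B * e < 1" by (auto simp: e_def field_simps abs_if)
  have "Re (cnj (of_real e * x) * x) = e * (cmod x)\<^sup>2"
    by (simp add: cmod_power2 algebra_simps) (simp add: power2_eq_square)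
  then have "2 * (e * (cmod x)\<^sup>2) \<le> B * (e * cmod x)\<^sup>2"
    using assms[of "of_real e * x"] e by (simp add: norm_mult)
  then have "(e * (cmod x)\<^sup>2) * 2 \<le> (e * (cmod x)\<^sup>2) * (B * e)"
    by (simp add: power2_eq_square mult_ac)
  moreover have "0 < e * (cmod x)\<^sup>2" using e(1) x by simp
  ultimately have "2 \<le> B * e" by (rule mult_left_le_imp_le)
  with e(2) show False by simp
qed

lemma integral_lebesgue_on_continuous:
  fixes f :: "real \<Rightarrow> 'b::euclidean_space"
  assumes "continuous_on {a..b} f"
  shows "integral\<^sup>L (lebesgue_on {a..b}) f = integral {a..b} f"
  by (intro lebesgue_integral_eq_integral continuous_imp_integrable_real assms) auto

lemma nn_integral_lebesgue_on_continuous: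
  fixes f :: "real \<Rightarrow> real"
  assumes "continuous_on {a..b} f" "\<And>t. 0 \<le> f t"
  shows "(\<integral>\<^sup>+t. ennreal (f t) \<partial>lebesgue_on {a..b}) = ennreal (integral {a..b} f)"
  using assms by (subst nn_integral_eq_integral) (auto intro!: continuous_imp_integrable_real simp: integral_lebesgue_on_continuous)

lemma finite_measure_lebesgue_on: "finite_measure (lebesgue_on {a..b :: real})"
  by (rule finite_measureI) (simp add: space_restrict_space emeasure_restrict_space emeasure_lborel_Icc_eq)

lemma expsum_linear:
  assumes "finite F" "finite G"
  shows "\<exists>c. \<forall>t. expsum c (F \<union> G) t = x * expsum a F t + y * expsum b G t"
proof -
  define c where "c l = x * (if l \<in> F then a l else 0) + y * (if l \<in> G then b l else 0)" for l
  have "expsum c (F \<union> G) t = x * expsum a F t + y * expsum b G t" for t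
  proof -
    have "expsum c (F \<union> G) t = x * (\<Sum>l\<in>F \<union> G. if l \<in> F then a l * cis (l * t) else 0) +
        y * (\<Sum>l\<in>F \<union> G. if l \<in> G then b l * cis (l * t) else 0)"
      unfolding expsum_def c_def sum_distrib_left sum.distrib[symmetric]
      by (intro sum.cong) (auto simp: algebra_simps)
    also have "(\<Sum>l\<in>F \<union> G. if l \<in> F then a l * cis (l * t) else 0) = expsum a F t"
      unfolding expsum_def using assms by (intro sum.mono_neutral_cong_right) auto
    also have "(\<Sum>l\<in>F \<union> G. if l \<in> G then b l * cis (l * t) else 0) = expsum b G t"
      unfolding expsum_def using assms by (intro sum.mono_neutral_cong_right) auto
    finally show ?thesis .
  qed
  then show ?thesis by blast
qed

text \<open>The dual function is the normalised residual of the projection of the exponential of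
  frequency \<open>\<mu>\<close> onto the closed span of the others; its norm is controlled by the lower Riesz bound.\<close>

lemma dual_function_ex:
  assumes T: "0 < T" and c: "0 < c" "\<And>F a. finite F \<Longrightarrow> F \<subseteq> \<Lambda> \<Longrightarrow>
     c * (\<Sum>l\<in>F. (cmod (a l))\<^sup>2) \<le> integral {0..T} (\<lambda>t. (cmod (expsum a F t))\<^sup>2)" and \<mu>: "\<mu> \<in> \<Lambda>"
  shows "\<exists>q. q \<in> borel_measurable (lebesgue_on {0..T}) \<and> integrable (lebesgue_on {0..T}) (\<lambda>t. (cmod (q t))\<^sup>2) \<and>
    (\<integral>t. (cmod (q t))\<^sup>2 \<partial>lebesgue_on {0..T}) \<le> (2 * T + 4) / c\<^sup>2 \<and>
    (\<forall>l\<in>\<Lambda>. (\<integral>t. q t * cis (- (l * t)) \<partial>lebesgue_on {0..T}) = (if l = \<mu> then 1 else 0))"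
proof -
  let ?M = "lebesgue_on {0..T}"
  interpret M: finite_measure ?M by (rule finite_measure_lebesgue_on)
  define N where "N f = integral {0..T} (\<lambda>t. (cmod (f t))\<^sup>2)" for f :: "real \<Rightarrow> complex"
  define V where "V = {expsum a F |a F. finite F \<and> F \<subseteq> \<Lambda> - {\<mu>}}"
  define e where "e l t = cis (l * t)" for l t :: real
  have ce: "continuous_on S (e l)" for S l unfolding e_def by (intro continuous_intros)
  have cV: "continuous_on S v" if "v \<in> V" for v S
    using that by (auto simp: V_def intro!: continuous_intros)
  have V_lin: "(\<lambda>t. x * v t + y * w t) \<in> V" if vw: "v \<in> V" "w \<in> V" for v w x y
  proof -
    obtain a F b G where "v = expsum a F" "finite F" "F \<subseteq> \<Lambda> - {\<mu>}" "w = expsum b G" "finite G" "G \<subseteq> \<Lambda> - {\<mu>}"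
      using vw by (auto simp: V_def)
    moreover obtain d where "\<forall>t. expsum d (F \<union> G) t = x * expsum a F t + y * expsum b G t"
      using expsum_linear calculation by blast
    ultimately have "(\<lambda>t. x * v t + y * w t) = expsum d (F \<union> G)" "finite (F \<union> G)" "F \<union> G \<subseteq> \<Lambda> - {\<mu>}" by auto
    then show ?thesis unfolding V_def by blast
  qed
  have V_e: "e l \<in> V" if "l \<in> \<Lambda>" "l \<noteq> \<mu>" for l
  proof -
    have "e l = expsum (\<lambda>_. 1) {l}" by (simp add: fun_eq_iff e_def expsum_def)
    then show ?thesis using that unfolding V_def by blast
  qed
  have V_0: "(\<lambda>t. 0) \<in> V"
    unfolding V_def by (rule CollectI, rule exI[of _ "\<lambda>_. 0"], rule exI[of _ "{}"]) (simp add: expsum_def fun_eq_iff)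
  \<comment> \<open>The exponential of frequency \<mu> enters the residual with coefficient 1, so
    the lower Riesz bound keeps its distance from the span positive.\<close>
  have low: "c \<le> N (\<lambda>t. e \<mu> t - v t)" if vV: "v \<in> V" for v
  proof -
    obtain a F where v: "v = expsum a F" "finite F" "F \<subseteq> \<Lambda> - {\<mu>}" using vV by (auto simp: V_def)
    define b where "b l = (if l = \<mu> then 1 else - a l)" for l
    have mF: "\<mu> \<notin> F" using v by auto
    have "expsum b (insert \<mu> F) t = e \<mu> t - v t" for t
    proof -
      have "(\<Sum>l\<in>F. b l * cis (l * t)) = (\<Sum>l\<in>F. - (a l * cis (l * t)))"
        using mF by (intro sum.cong) (auto simp: b_def)
      then show ?thesis using mF v by (simp add: expsum_def e_def sum_negf b_def)
    qed
    then have "c * (\<Sum>l\<in>insert \<mu> F. (cmod (b l))\<^sup>2) \<le> N (\<lambda>t. e \<mu> t - v t)"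
      using c(2)[of "insert \<mu> F" b] v \<mu> by (auto simp: N_def)
    moreover have "1 \<le> (\<Sum>l\<in>insert \<mu> F. (cmod (b l))\<^sup>2)"
      using mF v(2) by (simp add: b_def sum_nonneg)
    then have "c * 1 \<le> c * (\<Sum>l\<in>insert \<mu> F. (cmod (b l))\<^sup>2)" using c(1) by (intro mult_left_mono) auto
    ultimately show ?thesis by simp
  qed
  define d where "d = (INF v\<in>V. N (\<lambda>t. e \<mu> t - v t))"
  have bdd: "bdd_below ((\<lambda>v. N (\<lambda>t. e \<mu> t - v t)) ` V)" using low by (auto intro!: bdd_belowI[of _ c])
  have d_le: "d \<le> N (\<lambda>t. e \<mu> t - v t)" if "v \<in> V" for v
    unfolding d_def using bdd that by (rule cINF_lower)
  have cd: "c \<le> d" unfolding d_def using V_0 low by (intro cINF_greatest) auto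
  have dT: "d \<le> T" using d_le[OF V_0] T by (simp add: N_def e_def)
  have "\<exists>v\<in>V. N (\<lambda>t. e \<mu> t - v t) < d + 1 / (real n + 1)" for n
    using cINF_less_iff[OF _ bdd, of "d + 1 / (real n + 1)"] V_0 unfolding d_def[symmetric] by auto
  then obtain v where v: "\<And>n. v n \<in> V" "\<And>n. N (\<lambda>t. e \<mu> t - v n t) < d + 1 / (real n + 1)" by metis
  define r where "r n t = e \<mu> t - v n t" for n t
  have cr: "continuous_on S (r n)" for n S
    unfolding r_def by (intro continuous_intros continuous_on_compose2[OF ce[of UNIV]] continuous_on_compose2[OF cV[OF v(1), of UNIV]]) auto
  have cr': "continuous_on S (\<lambda>t. r n t)" for n S using cr[of S n] by simp
  have ce': "continuous_on S (\<lambda>t. e l t)" for l S using ce[of S l] by simp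
  note cont = continuous_intros cr' ce'
  have Nr: "d \<le> N (r n)" "N (r n) < d + 1 / (real n + 1)" for n
    using d_le[OF v(1)] v(2)[of n] by (auto simp: r_def[abs_def])
  have Nlim: "(\<lambda>n. N (r n)) \<longlonglongrightarrow> d"
  proof (rule tendsto_sandwich[OF _ _ tendsto_const])
    show "(\<lambda>n. d + 1 / (real n + 1)) \<longlonglongrightarrow> d"
      using tendsto_add[OF tendsto_const LIMSEQ_inverse_real_of_nat, of d] by (simp add: inverse_eq_divide add.commute)
  qed (use Nr in \<open>auto intro!: always_eventually less_imp_le\<close>)
  \<comment> \<open>Parallelogram identity: the midpoint of two residuals is again a residual and
    has energy at least \<open>d\<close>, so a minimising sequence is Cauchy.\<close>
  have par: "N (\<lambda>t. r n t - r m t) \<le> 2 / (real n + 1) + 2 / (real m + 1)" for n m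
  proof -
    have "N (\<lambda>t. r n t - r m t) = integral {0..T} (\<lambda>t. (2 * (cmod (r n t))\<^sup>2 + 2 * (cmod (r m t))\<^sup>2) - 4 * (cmod (1 / 2 * r n t + 1 / 2 * r m t))\<^sup>2)"
      unfolding N_def
    proof (intro integral_cong)
      fix t
      have *: "1 / 2 * r n t + 1 / 2 * r m t = (r n t + r m t) / 2" by (simp add: add_divide_distrib)
      have "4 * (cmod (1 / 2 * r n t + 1 / 2 * r m t))\<^sup>2 = (cmod (r n t + r m t))\<^sup>2"
        unfolding * by (simp add: norm_divide power_divide)
      then show "(cmod (r n t - r m t))\<^sup>2 = (2 * (cmod (r n t))\<^sup>2 + 2 * (cmod (r m t))\<^sup>2) - 4 * (cmod (1 / 2 * r n t + 1 / 2 * r m t))\<^sup>2"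
        by (simp add: cmod_power2) (simp add: power2_eq_square algebra_simps)
    qed
    also have "\<dots> = 2 * N (r n) + 2 * N (r m) - 4 * N (\<lambda>t. 1 / 2 * r n t + 1 / 2 * r m t)"
    proof -
      have i: "(\<lambda>t. 2 * (cmod (r n t))\<^sup>2) integrable_on {0..T}" for n
        by (intro integrable_continuous_real cont)
      have j: "(\<lambda>t. 4 * (cmod (1 / 2 * r n t + 1 / 2 * r m t))\<^sup>2) integrable_on {0..T}"
        by (intro integrable_continuous_real cont)
      show ?thesis
        unfolding N_def by (subst integral_diff[OF integrable_add[OF i i] j], subst integral_add[OF i i]) simp
    qed
    finally have eq: "N (\<lambda>t. r n t - r m t) = 2 * N (r n) + 2 * N (r m) - 4 * N (\<lambda>t. 1 / 2 * r n t + 1 / 2 * r m t)" .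
    have "d \<le> N (\<lambda>t. 1 / 2 * r n t + 1 / 2 * r m t)"
    proof -
      have "(\<lambda>t. 1 / 2 * r n t + 1 / 2 * r m t) = (\<lambda>t. e \<mu> t - (1 / 2 * v n t + 1 / 2 * v m t))"
        by (simp add: r_def fun_eq_iff algebra_simps add_divide_distrib)
      then show ?thesis using d_le[OF V_lin[OF v(1) v(1)], of "1 / 2" n "1 / 2" m] by simp
    qed
    then have "N (\<lambda>t. r n t - r m t) \<le> 2 * (1 / (real n + 1)) + 2 * (1 / (real m + 1))"
      using Nr(2)[of n] Nr(2)[of m] eq by linarith
    then show ?thesis by simp
  qed
  have nn: "(\<integral>\<^sup>+t. ennreal ((cmod (r n t - r m t))\<^sup>2) \<partial>?M) = ennreal (N (\<lambda>t. r n t - r m t))" for n m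
    unfolding N_def by (intro nn_integral_lebesgue_on_continuous cont) simp
  have [measurable]: "r n \<in> borel_measurable ?M" "(\<lambda>t. cis (- (l * t))) \<in> borel_measurable ?M" for n l
    using continuous_imp_integrable_real[OF cr] 
    by (auto intro!: borel_measurable_integrable continuous_imp_integrable_real continuous_intros)
  have cauchy: "\<exists>n0. \<forall>n\<ge>n0. \<forall>m\<ge>n0. (\<integral>\<^sup>+t. ennreal ((cmod (r n t - r m t))\<^sup>2) \<partial>?M) \<le> ennreal \<epsilon>" if "0 < \<epsilon>" for \<epsilon>
  proof -
    obtain n0 :: nat where n0: "4 / \<epsilon> < real n0" using reals_Archimedean2 by blast
    have *: "2 / (real n + 1) \<le> \<epsilon> / 2" if "n0 \<le> n" for n
    proof -
      have "4 / \<epsilon> \<le> real n + 1" using n0 that by linarith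
      then show ?thesis using \<open>0 < \<epsilon>\<close> by (simp add: field_simps)
    qed
    show ?thesis
    proof (intro exI[of _ n0] allI impI)
      fix n m assume "n0 \<le> n" "n0 \<le> m"
      then show "(\<integral>\<^sup>+t. ennreal ((cmod (r n t - r m t))\<^sup>2) \<partial>?M) \<le> ennreal \<epsilon>"
        using par[of n m] *[of n] *[of m] unfolding nn by (intro ennreal_leI) linarith
    qed
  qed
  obtain R where [measurable]: "R \<in> borel_measurable ?M"
    and Rlim: "(\<lambda>n. \<integral>\<^sup>+t. ennreal ((cmod (r n t - R t))\<^sup>2) \<partial>?M) \<longlonglongrightarrow> 0"
  proof (rule L2_complete[of r ?M])
    show "r n \<in> borel_measurable ?M" for n by measurable
    show "\<exists>N. \<forall>m\<ge>N. \<forall>n\<ge>N. (\<integral>\<^sup>+x. ennreal ((cmod (r m x - r n x))\<^sup>2) \<partial>?M) \<le> ennreal e" if "0 < e" for e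
      using that by (rule cauchy)
  qed
  have sq: "integrable ?M (\<lambda>t. (cmod (r n t))\<^sup>2)" for n
    by (intro continuous_imp_integrable_real cont)
  note L2 = M.L2_tendsto_integral[of r R, OF _ _ _ Rlim sq]
  have Rsq: "integrable ?M (\<lambda>t. (cmod (R t))\<^sup>2)" using L2(1)[of "\<lambda>_. 0"] by simp
  define w where "w l = (\<integral>t. R t * cis (- (l * t)) \<partial>?M)" for l
  have wlim: "(\<lambda>n. integral {0..T} (\<lambda>t. r n t * cis (- (l * t)))) \<longlonglongrightarrow> w l" for l
  proof -
    have "(\<lambda>n. \<integral>t. r n t * cis (- (l * t)) \<partial>?M) \<longlonglongrightarrow> w l"
      unfolding w_def by (rule L2(3)) auto
    then show ?thesis by (subst (asm) integral_lebesgue_on_continuous) (intro cont)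
  qed
  have expand: "N (\<lambda>t. r n t - z * e l t) = N (r n) - 2 * Re (cnj z * integral {0..T} (\<lambda>t. r n t * cis (- (l * t)))) + (cmod z)\<^sup>2 * T" for n z l
  proof -
    have i: "(\<lambda>t. cnj z * (r n t * cis (- (l * t)))) integrable_on {0..T}"
      by (intro integrable_continuous_real cont)
    have "N (\<lambda>t. r n t - z * e l t) = integral {0..T} (\<lambda>t. ((cmod (r n t))\<^sup>2 - 2 * Re (cnj z * (r n t * cis (- (l * t))))) + (cmod z)\<^sup>2)"
      unfolding N_def
    proof (intro integral_cong)
      fix t
      have A: "(cmod (x - y))\<^sup>2 = (cmod x)\<^sup>2 - 2 * Re (x * cnj y) + (cmod y)\<^sup>2" for x y
        by (simp add: cmod_power2) (simp add: power2_eq_square algebra_simps)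
      have "r n t * cnj (z * e l t) = cnj z * (r n t * cis (- (l * t)))"
        by (simp add: e_def cis_cnj mult_ac)
      moreover have "cmod (z * e l t) = cmod z" by (simp add: e_def norm_mult)
      ultimately show "(cmod (r n t - z * e l t))\<^sup>2 = ((cmod (r n t))\<^sup>2 - 2 * Re (cnj z * (r n t * cis (- (l * t))))) + (cmod z)\<^sup>2"
        by (simp only: A)
    qed
    also have "\<dots> = (integral {0..T} (\<lambda>t. (cmod (r n t))\<^sup>2) - integral {0..T} (\<lambda>t. 2 * Re (cnj z * (r n t * cis (- (l * t)))))) + integral {0..T} (\<lambda>t. (cmod z)\<^sup>2)"
    proof -
      have "(\<lambda>t. (cmod (r n t))\<^sup>2) integrable_on {0..T}" "(\<lambda>t. 2 * Re (cnj z * (r n t * cis (- (l * t))))) integrable_on {0..T}"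
        "(\<lambda>t. (cmod z)\<^sup>2) integrable_on {0..T}"
        by (intro integrable_continuous_real cont)+
      then show ?thesis by (subst integral_add) (auto intro: integrable_diff simp: integral_diff)
    qed
    also have "integral {0..T} (\<lambda>t. 2 * Re (cnj z * (r n t * cis (- (l * t))))) = 2 * Re (cnj z * integral {0..T} (\<lambda>t. r n t * cis (- (l * t))))"
      by (simp only: integral_mult_right integral_linear[OF i bounded_linear_Re, unfolded o_def])
    finally show ?thesis using T by (simp add: N_def)
  qed
  \<comment> \<open>For \<open>l \<noteq> \<mu>\<close> subtracting \<open>z * e l\<close> gives
    another residual, of energy at least \<open>d\<close>. For \<open>l = \<mu>\<close> it gives a
    residual scaled by \<open>1 - z\<close>, with \<open>z = 1\<close> treated apart because of the
    division.\<close>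
  have var: "(cmod (1 - (if l = \<mu> then z else 0)))\<^sup>2 * d \<le> N (\<lambda>t. r n t - z * e l t)" if l: "l \<in> \<Lambda>" for n z l
  proof (cases "l = \<mu>")
    case False
    have "(\<lambda>t. r n t - z * e l t) = (\<lambda>t. e \<mu> t - (1 * v n t + z * e l t))" by (simp add: r_def fun_eq_iff)
    then show ?thesis using False d_le[OF V_lin[OF v(1) V_e[OF l False]], of 1 n z] by simp
  next
    case True
    show ?thesis
    proof (cases "z = 1")
      case True
      then show ?thesis using \<open>l = \<mu>\<close> by (simp add: N_def integral_nonneg integrable_continuous_real cont)
    next
      case False
      have "(\<lambda>t. r n t - z * e l t) = (\<lambda>t. (1 - z) * (e \<mu> t - (1 / (1 - z) * v n t + 0 * v n t)))"
        using False True by (simp add: r_def fun_eq_iff field_simps)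
      then have "N (\<lambda>t. r n t - z * e l t) = (cmod (1 - z))\<^sup>2 * N (\<lambda>t. e \<mu> t - (1 / (1 - z) * v n t + 0 * v n t))"
        by (simp add: N_def norm_mult power_mult_distrib)
      then show ?thesis
        using mult_left_mono[OF d_le[OF V_lin[OF v(1) v(1)], of "1 / (1 - z)" n 0 n], of "(cmod (1 - z))\<^sup>2"] True by simp
    qed
  qed
  \<comment> \<open>The inequality is passed to the limit in \<open>n\<close>, so that
    \<open>R\<close> enters only through its moments \<open>w l\<close> and need not be identified
    as an element of the closed span.\<close>
  have lim: "(cmod (1 - (if l = \<mu> then z else 0)))\<^sup>2 * d \<le> d - 2 * Re (cnj z * w l) + (cmod z)\<^sup>2 * T" if "l \<in> \<Lambda>" for z l
  proof (rule LIMSEQ_le_const)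
    show "(\<lambda>n. N (\<lambda>t. r n t - z * e l t)) \<longlonglongrightarrow> d - 2 * Re (cnj z * w l) + (cmod z)\<^sup>2 * T"
      unfolding expand by (intro tendsto_intros Nlim wlim)
  qed (use var[OF that] in auto)
  \<comment> \<open>First-order optimality: the term linear in \<open>z\<close> has to vanish. Here
    this is orthogonality to the other exponentials; at \<mu> itself it yields the value
    \<open>d\<close>.\<close>
  have w0: "w l = 0" if "l \<in> \<Lambda>" "l \<noteq> \<mu>" for l
  proof (rule complex_zero_if_first_order_small[where B = T])
    show "2 * Re (cnj z * w l) \<le> T * (cmod z)\<^sup>2" for z
      using lim[OF that(1), of z] that(2) by (simp add: mult.commute)
  qed
  have "w \<mu> - of_real d = 0"
  proof (rule complex_zero_if_first_order_small[where B = "T - d"])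
    fix z
    have *: "(cmod (1 - z))\<^sup>2 = 1 - 2 * Re z + (cmod z)\<^sup>2"
      by (simp add: cmod_power2) (simp add: power2_eq_square algebra_simps)
    have "(1 - 2 * Re z + (cmod z)\<^sup>2) * d \<le> d - 2 * Re (cnj z * w \<mu>) + (cmod z)\<^sup>2 * T"
      using lim[OF \<mu>, of z] unfolding *[symmetric] by simp
    then show "2 * Re (cnj z * (w \<mu> - of_real d)) \<le> (T - d) * (cmod z)\<^sup>2"
      by (simp add: algebra_simps)
  qed
  then have wd: "w \<mu> = of_real d" by simp
  have d0: "0 < d" using c(1) cd by simp
  obtain n where n: "(\<integral>\<^sup>+t. ennreal ((cmod (r n t - R t))\<^sup>2) \<partial>?M) < ennreal 1"
    using order_tendstoD(2)[OF Rlim, of "ennreal 1"] by (auto simp: eventually_sequentially)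
  have di: "integrable ?M (\<lambda>t. (cmod (r n t - R t))\<^sup>2)"
    using n by (intro integrableI_bounded) (auto intro: less_trans)
  have "(\<integral>t. (cmod (r n t - R t))\<^sup>2 \<partial>?M) \<le> 1"
    using n nn_integral_eq_integral[OF di] by (simp add: ennreal_less_iff)
  moreover have "(\<integral>t. (cmod (r n t))\<^sup>2 \<partial>?M) \<le> T + 1"
  proof -
    have "(\<integral>t. (cmod (r n t))\<^sup>2 \<partial>?M) = N (r n)" unfolding N_def by (intro integral_lebesgue_on_continuous cont)
    moreover have "1 / (real n + 1) \<le> 1" by simp
    ultimately show ?thesis using Nr(2)[of n] dT by linarith
  qed
  moreover have "(\<integral>t. (cmod (R t))\<^sup>2 \<partial>?M) \<le> (\<integral>t. 2 * (cmod (r n t))\<^sup>2 + 2 * (cmod (r n t - R t))\<^sup>2 \<partial>?M)"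
  proof (intro integral_mono Rsq Bochner_Integration.integrable_add integrable_mult_right sq di)
    show "(cmod (R t))\<^sup>2 \<le> 2 * (cmod (r n t))\<^sup>2 + 2 * (cmod (r n t - R t))\<^sup>2" for t
      using cmod_add_square_le[of "r n t" "- (r n t - R t)"] by (simp add: norm_minus_commute)
  qed
  \<comment> \<open>A crude bound, \<open>2 * (T + 1) + 2 * 1\<close>, through one approximant at
    squared distance at most 1 from \<open>R\<close>.\<close>
  ultimately have Rbound: "(\<integral>t. (cmod (R t))\<^sup>2 \<partial>?M) \<le> 2 * T + 4"
    using sq[of n] di by simp
  \<comment> \<open>Dividing by \<open>d\<close> normalises the moment at \<mu> to 1;
    \<open>c \<le> d\<close> bounds the effect on the norm.\<close>
  define q where "q t = R t / of_real d" for t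
  show ?thesis
  proof (intro exI[of _ q] conjI ballI)
    show "q \<in> borel_measurable ?M" unfolding q_def by measurable
    have qe: "(cmod (q t))\<^sup>2 = (cmod (R t))\<^sup>2 / d\<^sup>2" for t by (simp add: q_def norm_divide power_divide)
    show "integrable ?M (\<lambda>t. (cmod (q t))\<^sup>2)" unfolding qe using Rsq by simp
    have "(\<integral>t. (cmod (q t))\<^sup>2 \<partial>?M) = (\<integral>t. (cmod (R t))\<^sup>2 \<partial>?M) / d\<^sup>2" unfolding qe by simp
    also have "\<dots> \<le> (2 * T + 4) / d\<^sup>2" using Rbound by (intro divide_right_mono) auto
    also have "\<dots> \<le> (2 * T + 4) / c\<^sup>2"
      using c(1) cd T by (intro divide_left_mono power_mono mult_pos_pos) auto
    finally show "(\<integral>t. (cmod (q t))\<^sup>2 \<partial>?M) \<le> (2 * T + 4) / c\<^sup>2" .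
    fix l assume l: "l \<in> \<Lambda>"
    have "(\<integral>t. q t * cis (- (l * t)) \<partial>?M) = w l / of_real d"
      unfolding w_def q_def by (simp add: times_divide_eq_left)
    then show "(\<integral>t. q t * cis (- (l * t)) \<partial>?M) = (if l = \<mu> then 1 else 0)"
      using w0[OF l] wd d0 by auto
  qed
qed

section \<open>Mild solutions\<close>

text \<open>The multiplier has modulus 1, so the prescribed coefficients belong to a distribution in
  the same space; its existence and uniqueness make the description in
  \<open>fourier_multiplier\<close> denote.\<close>

lemma propagator_sobolev:
  assumes "0 \<le> s" "u \<in> sobolev s"
  shows "fourier_coeff (propagator b t u) k = cis (eigenfreq b k * t) * fourier_coeff u k"
    "propagator b t u \<in> sobolev s" "sobolev_norm s (propagator b t u) \<le> sobolev_norm s u"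
proof -
  have c: "exp (\<i> * of_real (eigenfreq b k * t)) = cis (eigenfreq b k * t)" for k
    by (simp add: cis_conv_exp)
  have "(\<lambda>k. (1 + freq_abs k) powr (2 * s) * (cmod (cis (eigenfreq b k * t) * fourier_coeff u k))\<^sup>2) summable_on UNIV"
    using sobolev_summable[OF assms(2)] by (simp add: norm_mult)
  then obtain v where v: "v \<in> sobolev s" "\<And>k. fourier_coeff v k = cis (eigenfreq b k * t) * fourier_coeff u k"
    by (rule sobolev_ex[OF assms(1)]) (rule that)
  have eq: "propagator b t u = v"
    unfolding propagator_def fourier_multiplier_def c
    by (rule the_equality) (auto intro!: distribution_eqI simp: v(2))
  show "fourier_coeff (propagator b t u) k = cis (eigenfreq b k * t) * fourier_coeff u k"
    "propagator b t u \<in> sobolev s" using v by (simp_all add: eq)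
  show "sobolev_norm s (propagator b t u) \<le> sobolev_norm s u"
    using sobolev_dominated(2)[OF assms(2), of 1 v] by (simp add: v(2) norm_mult eq)
qed

lemma lebesgue_on_measurable_mono:
  assumes "f \<in> borel_measurable (lebesgue_on {0..T :: real})" "t \<le> T"
  shows "f \<in> borel_measurable (lebesgue_on {0..t})"
  using assms by (intro measurable_restrict_mono[of f lebesgue "{0..T}" borel "{0..t}"]) auto

lemma lebesgue_on_integrable_mono:
  fixes f :: "real \<Rightarrow> 'b::euclidean_space"
  assumes "integrable (lebesgue_on {0..T :: real}) f" "t \<le> T"
  shows "integrable (lebesgue_on {0..t}) f"
  using assms(1) by (rule integrable_subinterval) (use assms(2) in auto)

locale control_data =
  fixes s T :: real and b :: "int \<times> int \<Rightarrow> real" and g1 g2 :: "real \<Rightarrow> real"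
    and u0 :: torus_distribution and h :: "real \<Rightarrow> torus_distribution"
  assumes s: "0 \<le> s" and T: "0 \<le> T" and g: "control_profile g1" "control_profile g2"
    and u0: "u0 \<in> sobolev s" and h: "\<And>t. t \<in> {0..T} \<Longrightarrow> h t \<in> sobolev s"
    and hm: "\<And>k. (\<lambda>t. fourier_coeff (h t) k) \<in> borel_measurable (lebesgue_on {0..T})"
    and hi: "integrable (lebesgue_on {0..T}) (\<lambda>t. sobolev_norm s (h t))"
begin

abbreviation Gh :: "real \<Rightarrow> torus_distribution" where
  "Gh t \<equiv> G_op g1 g2 (h t)"

lemma Gh_coeff_tendsto:
  "t \<in> {0..T} \<Longrightarrow> (\<lambda>n. control_coeff g1 g2 (fourier_coeff (h t)) n k) \<longlonglongrightarrow> fourier_coeff (Gh t) k"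
  using sobolev_represents[OF s h] G_op_coeff[OF g] by metis

lemma Gh_sobolev: "t \<in> {0..T} \<Longrightarrow> Gh t \<in> sobolev s"
  using G_op_sobolev[OF s g] h by metis

text \<open>Coefficients of \<open>Gh\<close> are limits of finite combinations of coefficients of
  \<open>h\<close>.\<close>

lemma Gh_measurable: "(\<lambda>t. fourier_coeff (Gh t) k) \<in> borel_measurable (lebesgue_on {0..T})"
proof (rule borel_measurable_LIMSEQ_metric)
  show "(\<lambda>t. control_coeff g1 g2 (fourier_coeff (h t)) n k) \<in> borel_measurable (lebesgue_on {0..T})" for n
    unfolding control_coeff_def using hm by (cases "fst k = 0"; cases "snd k = 0") simp_all
  show "(\<lambda>n. control_coeff g1 g2 (fourier_coeff (h t)) n k) \<longlonglongrightarrow> fourier_coeff (Gh t) k"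
    if "t \<in> space (lebesgue_on {0..T})" for t
    using that by (intro Gh_coeff_tendsto) simp
qed

lemma Gh_integrable: "integrable (lebesgue_on {0..T}) (\<lambda>t. sobolev_norm s (Gh t))"
proof -
  obtain C where C: "0 \<le> C" "\<And>u. u \<in> sobolev s \<Longrightarrow> sobolev_norm s (G_op g1 g2 u) \<le> C * sobolev_norm s u"
    using G_op_sobolev[OF s g] by metis
  show ?thesis
  proof (rule Bochner_Integration.integrable_bound)
    show "integrable (lebesgue_on {0..T}) (\<lambda>t. C * sobolev_norm s (h t))" using hi by simp
    show "(\<lambda>t. sobolev_norm s (Gh t)) \<in> borel_measurable (lebesgue_on {0..T})"
      by (rule borel_measurable_sobolev_norm[OF _ Gh_measurable]) (simp add: Gh_sobolev)
    show "AE t in lebesgue_on {0..T}. norm (sobolev_norm s (Gh t)) \<le> norm (C * sobolev_norm s (h t))"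
      using C h sobolev_norm_nonneg by (intro AE_I2) (simp add: abs_mult)
  qed
qed

lemma Gh_coeff_integrable: "integrable (lebesgue_on {0..T}) (\<lambda>t. fourier_coeff (Gh t) k)"
  by (rule integrable_fourier_coeff[OF s _ Gh_measurable Gh_integrable]) (simp add: Gh_sobolev)

lemma Duhamel_integrand:
  assumes t: "t \<in> {0..T}"
  shows "\<And>r. r \<in> space (lebesgue_on {0..t}) \<Longrightarrow> propagator b (t - r) (Gh r) \<in> sobolev s"
    "(\<lambda>r. fourier_coeff (propagator b (t - r) (Gh r)) k) \<in> borel_measurable (lebesgue_on {0..t})"
    "integrable (lebesgue_on {0..t}) (\<lambda>r. sobolev_norm s (propagator b (t - r) (Gh r)))"
proof -
  have mem: "r \<in> {0..T}" if "r \<in> space (lebesgue_on {0..t})" for r using that t by simp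
  note P = propagator_sobolev[OF s Gh_sobolev[OF mem]]
  show 1: "\<And>r. r \<in> space (lebesgue_on {0..t}) \<Longrightarrow> propagator b (t - r) (Gh r) \<in> sobolev s"
    by (rule P(2))
  have "(\<lambda>r. cis (eigenfreq b k * (t - r))) \<in> borel_measurable (lebesgue_on {0..t})" for k
    by (intro borel_measurable_integrable continuous_imp_integrable_real continuous_intros)
  then have "(\<lambda>r. cis (eigenfreq b k * (t - r)) * fourier_coeff (Gh r) k) \<in> borel_measurable (lebesgue_on {0..t})" for k
    using lebesgue_on_measurable_mono[OF Gh_measurable, of t] t by (intro borel_measurable_times) auto
  moreover have "((\<lambda>r. fourier_coeff (propagator b (t - r) (Gh r)) k) \<in> borel_measurable (lebesgue_on {0..t})) \<longleftrightarrow>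
    ((\<lambda>r. cis (eigenfreq b k * (t - r)) * fourier_coeff (Gh r) k) \<in> borel_measurable (lebesgue_on {0..t}))" for k
    by (rule measurable_cong) (rule P(1))
  ultimately have 2: "(\<lambda>r. fourier_coeff (propagator b (t - r) (Gh r)) k) \<in> borel_measurable (lebesgue_on {0..t})" for k
    by blast
  then show "(\<lambda>r. fourier_coeff (propagator b (t - r) (Gh r)) k) \<in> borel_measurable (lebesgue_on {0..t})" .
  show "integrable (lebesgue_on {0..t}) (\<lambda>r. sobolev_norm s (propagator b (t - r) (Gh r)))"
  proof (rule Bochner_Integration.integrable_bound)
    show "integrable (lebesgue_on {0..t}) (\<lambda>r. sobolev_norm s (Gh r))"
      using lebesgue_on_integrable_mono[OF Gh_integrable] t by simp
    show "AE r in lebesgue_on {0..t}. norm (sobolev_norm s (propagator b (t - r) (Gh r))) \<le> norm (sobolev_norm s (Gh r))"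
      using P(3) sobolev_norm_nonneg by (intro AE_I2) simp
  qed (rule borel_measurable_sobolev_norm[OF 1 2])
qed

text \<open>Factoring out \<open>cis (eigenfreq b k * t)\<close> leaves an integrand independent of
  \<open>t\<close>; at the final time the control requirement thus becomes a condition on
  moments.\<close>

lemma Duhamel_coeff:
  assumes t: "t \<in> {0..T}"
    and w: "has_sobolev_integral s (lebesgue_on {0..t}) (\<lambda>r. propagator b (t - r) (Gh r)) w"
  shows "fourier_coeff (propagator b t u0 + w) k = cis (eigenfreq b k * t) *
     (fourier_coeff u0 k + (\<integral>r. cis (- (eigenfreq b k * r)) * fourier_coeff (Gh r) k \<partial>lebesgue_on {0..t}))"
proof -
  have "fourier_coeff w k = (\<integral>r. fourier_coeff (propagator b (t - r) (Gh r)) k \<partial>lebesgue_on {0..t})"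
    by (rule has_sobolev_integral_coeff[OF finite_measure_lebesgue_on s w Duhamel_integrand(2)[OF t]])
  also have "\<dots> = (\<integral>r. cis (eigenfreq b k * t) * (cis (- (eigenfreq b k * r)) * fourier_coeff (Gh r) k) \<partial>lebesgue_on {0..t})"
  proof (rule Bochner_Integration.integral_cong[OF refl])
    fix r assume "r \<in> space (lebesgue_on {0..t})"
    then have "Gh r \<in> sobolev s" using t by (intro Gh_sobolev) simp
    moreover have "cis (eigenfreq b k * (t - r)) = cis (eigenfreq b k * t) * cis (- (eigenfreq b k * r))"
      by (simp only: cis_mult) (simp add: right_diff_distrib)
    ultimately show "fourier_coeff (propagator b (t - r) (Gh r)) k =
        cis (eigenfreq b k * t) * (cis (- (eigenfreq b k * r)) * fourier_coeff (Gh r) k)"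
      using propagator_sobolev(1)[OF s] by (simp add: mult.assoc)
  qed
  finally show ?thesis
    using propagator_sobolev(1)[OF s u0] by (simp add: distrib_left)
qed

lemma mild_solution_coeff:
  assumes "mild_solution s b g1 g2 T u0 h v" "t \<in> {0..T}"
  shows "fourier_coeff (v t) k = cis (eigenfreq b k * t) *
     (fourier_coeff u0 k + (\<integral>r. cis (- (eigenfreq b k * r)) * fourier_coeff (Gh r) k \<partial>lebesgue_on {0..t}))"
proof -
  obtain w where "has_sobolev_integral s (lebesgue_on {0..t}) (\<lambda>r. propagator b (t - r) (Gh r)) w"
    "v t = propagator b t u0 + w"
    using assms unfolding mild_solution_def by blast
  then show ?thesis using Duhamel_coeff[OF assms(2)] by simp
qed

lemma modulated_integrable:
  "integrable (lebesgue_on {0..T}) (\<lambda>r. cis (- (eigenfreq b k * r)) * fourier_coeff (Gh r) k)"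
proof (rule Bochner_Integration.integrable_bound[OF Gh_coeff_integrable[of k]])
  have "(\<lambda>r. cis (- (eigenfreq b k * r))) \<in> borel_measurable (lebesgue_on {0..T})"
    by (intro borel_measurable_integrable continuous_imp_integrable_real continuous_intros)
  then show "(\<lambda>r. cis (- (eigenfreq b k * r)) * fourier_coeff (Gh r) k) \<in> borel_measurable (lebesgue_on {0..T})"
    using Gh_measurable by (intro borel_measurable_times)
qed (simp add: norm_mult)

text \<open>Each coefficient is continuous in time, being up to a phase an indefinite integral.
  Continuity in norm needs in addition a majorant independent of \<open>t\<close>: the moduli of the
  coefficients of \<open>u0\<close> plus the time integrals of the moduli for
  \<open>Gh\<close>.\<close>

lemma mild_solution_continuous:
  assumes c: "\<And>t k. t \<in> {0..T} \<Longrightarrow> fourier_coeff (u t) k = cis (eigenfreq b k * t) *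
     (fourier_coeff u0 k + (\<integral>r. cis (- (eigenfreq b k * r)) * fourier_coeff (Gh r) k \<partial>lebesgue_on {0..t}))"
  shows "u \<in> C_sobolev s T"
proof -
  define \<phi> where "\<phi> k r = cis (- (eigenfreq b k * r)) * fourier_coeff (Gh r) k" for k r
  define \<Psi> where "\<Psi> k = (\<integral>r. cmod (fourier_coeff (Gh r) k) \<partial>lebesgue_on {0..T})" for k
  have \<Psi>0: "0 \<le> \<Psi> k" for k unfolding \<Psi>_def by (intro Bochner_Integration.integral_nonneg) simp
  have \<phi>i: "integrable (lebesgue_on {0..t}) (\<phi> k)" if "t \<in> {0..T}" for k t
    using lebesgue_on_integrable_mono[OF modulated_integrable] that unfolding \<phi>_def by simp
  \<comment> \<open>Replacing coefficients by their moduli keeps the norm; integrating the resulting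
    field shows that the majorant lies in the Sobolev space.\<close>
  have "\<exists>v. v \<in> sobolev s \<and> (\<forall>k. fourier_coeff v k = of_real (cmod (fourier_coeff (Gh r) k)))" if "r \<in> {0..T}" for r
  proof -
    have "(\<lambda>k. (1 + freq_abs k) powr (2 * s) * (cmod (of_real (cmod (fourier_coeff (Gh r) k))))\<^sup>2) summable_on UNIV"
      using sobolev_summable[OF Gh_sobolev[OF that]] by simp
    from sobolev_ex[OF s this] show ?thesis by blast
  qed
  then obtain A where A: "\<And>r. r \<in> {0..T} \<Longrightarrow> A r \<in> sobolev s"
    "\<And>r k. r \<in> {0..T} \<Longrightarrow> fourier_coeff (A r) k = of_real (cmod (fourier_coeff (Gh r) k))" by metis
  have Am: "(\<lambda>r. fourier_coeff (A r) k) \<in> borel_measurable (lebesgue_on {0..T})" for k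
    using Gh_measurable[of k] by (subst measurable_cong[OF A(2)]) auto
  have An: "sobolev_norm s (A r) = sobolev_norm s (Gh r)" if "r \<in> {0..T}" for r
    using that by (simp add: sobolev_norm_def A(2))
  have Ai: "integrable (lebesgue_on {0..T}) (\<lambda>r. sobolev_norm s (A r))"
    using Gh_integrable by (subst Bochner_Integration.integrable_cong[OF refl An]) auto
  have A1: "A r \<in> sobolev s" if "r \<in> space (lebesgue_on {0..T})" for r
    using that by (simp add: A(1))
  obtain w where w: "has_sobolev_integral s (lebesgue_on {0..T}) A w"
    "\<And>k. fourier_coeff w k = (\<integral>r. fourier_coeff (A r) k \<partial>lebesgue_on {0..T})"
    using has_sobolev_integral_ex[OF finite_measure_lebesgue_on s A1 Am Ai] by blast
  have w\<Psi>: "fourier_coeff w k = of_real (\<Psi> k)" for k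
  proof -
    have "fourier_coeff w k = (\<integral>r. of_real (cmod (fourier_coeff (Gh r) k)) \<partial>lebesgue_on {0..T})"
      unfolding w(2) by (rule Bochner_Integration.integral_cong[OF refl]) (simp add: A(2))
    then show ?thesis by (simp add: \<Psi>_def)
  qed
  have "(\<lambda>k. (1 + freq_abs k) powr (2 * s) * (cmod (of_real (cmod (fourier_coeff u0 k))))\<^sup>2) summable_on UNIV"
    using sobolev_summable[OF u0] by simp
  then obtain u0' where u0': "u0' \<in> sobolev s" "\<And>k. fourier_coeff u0' k = of_real (cmod (fourier_coeff u0 k))"
    by (rule sobolev_ex[OF s]) (rule that)
  define B where "B = u0' + w"
  have B: "B \<in> sobolev s" unfolding B_def using u0'(1) w(1) by (auto intro: sobolev_add simp: has_sobolev_integral_def)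
  have cB: "cmod (fourier_coeff B k) = cmod (fourier_coeff u0 k) + \<Psi> k" for k
    unfolding B_def fourier_coeff_simps u0'(2) w\<Psi> of_real_add[symmetric] norm_of_real using \<Psi>0[of k] by simp
  have bound: "cmod (fourier_coeff (u t) k) \<le> 1 * cmod (fourier_coeff B k)" if t: "t \<in> {0..T}" for t k
  proof -
    have "cmod (\<integral>r. \<phi> k r \<partial>lebesgue_on {0..t}) \<le> (\<integral>r. cmod (\<phi> k r) \<partial>lebesgue_on {0..t})"
      by (rule integral_norm_bound)
    also have "\<dots> = (\<integral>r. cmod (fourier_coeff (Gh r) k) \<partial>lebesgue_on {0..t})" by (simp add: \<phi>_def norm_mult)
    also have "\<dots> \<le> \<Psi> k"
    proof -
      have i: "integrable (lebesgue_on {0..T}) (\<lambda>r. cmod (fourier_coeff (Gh r) k))"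
        using Gh_coeff_integrable by simp
      have j: "integrable (lebesgue_on {0..t}) (\<lambda>r. cmod (fourier_coeff (Gh r) k))"
        using lebesgue_on_integrable_mono[OF i] t by simp
      show ?thesis
        unfolding \<Psi>_def lebesgue_integral_eq_integral[OF i, simplified] lebesgue_integral_eq_integral[OF j, simplified]
        using t integrable_on_lebesgue_on[OF i] integrable_on_lebesgue_on[OF j]
        by (intro integral_subset_le) auto
    qed
    finally have "cmod (fourier_coeff u0 k + (\<integral>r. \<phi> k r \<partial>lebesgue_on {0..t})) \<le> cmod (fourier_coeff u0 k) + \<Psi> k"
      using norm_triangle_ineq[of "fourier_coeff u0 k" "\<integral>r. \<phi> k r \<partial>lebesgue_on {0..t}"] by linarith
    then show ?thesis unfolding cB c[OF t] \<phi>_def by (simp add: norm_mult)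
  qed
  have mem: "u t \<in> sobolev s" if "t \<in> {0..T}" for t
    by (rule sobolev_dominated(1)[OF B _ bound[OF that]]) simp
  have cont: "continuous_on {0..T} (\<lambda>t. fourier_coeff (u t) k)" for k
  proof -
    have int: "(\<phi> k) integrable_on {0..T}"
      using \<phi>i[of T k] T integrable_on_lebesgue_on by fastforce
    have eq: "fourier_coeff (u t) k = cis (eigenfreq b k * t) * (fourier_coeff u0 k + integral {0..t} (\<phi> k))" if "t \<in> {0..T}" for t
      using lebesgue_integral_eq_integral[OF \<phi>i[OF that]] unfolding c[OF that] \<phi>_def by simp
    have "continuous_on {0..T} (\<lambda>t. cis (eigenfreq b k * t) * (fourier_coeff u0 k + integral {0..t} (\<phi> k)))"
      by (intro continuous_intros indefinite_integral_continuous_1 int)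
    then show ?thesis by (subst continuous_on_cong[OF refl eq]) auto
  qed
  show ?thesis
    unfolding C_sobolev_def
  proof (intro CollectI ballI conjI mem)
    fix t assume t: "t \<in> {0..T}"
    show "((\<lambda>t'. sobolev_norm s (u t' - u t)) \<longlongrightarrow> 0) (at t within {0..T})"
    proof (rule sobolev_norm_dominated_tendsto[OF B])
      show "\<forall>\<^sub>F t' in at t within {0..T}. \<forall>k. cmod (fourier_coeff (u t' - u t) k) \<le> 2 * cmod (fourier_coeff B k)"
        unfolding eventually_at_filter
      proof (rule always_eventually, intro allI impI)
        fix t' k assume "t' \<in> {0..T}"
        then show "cmod (fourier_coeff (u t' - u t) k) \<le> 2 * cmod (fourier_coeff B k)"
          using bound[OF t, of k] bound[of t' k] norm_triangle_ineq4[of "fourier_coeff (u t') k" "fourier_coeff (u t) k"] by simp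
      qed
      show "((\<lambda>t'. fourier_coeff (u t' - u t) k) \<longlongrightarrow> 0) (at t within {0..T})" for k
        using cont[of k] t unfolding continuous_on_def by (auto intro: LIM_zero)
    qed
  qed
qed

text \<open>Existence comes from the vector integral at each time. Every mild solution has the same
  explicit coefficients, which gives uniqueness at once.\<close>

lemma mild_solution_exists_unique:
  obtains u where "mild_solution s b g1 g2 T u0 h u"
    "\<And>v. mild_solution s b g1 g2 T u0 h v \<Longrightarrow> \<forall>t\<in>{0..T}. v t = u t"
    "\<And>t k. t \<in> {0..T} \<Longrightarrow> fourier_coeff (u t) k = cis (eigenfreq b k * t) *
     (fourier_coeff u0 k + (\<integral>r. cis (- (eigenfreq b k * r)) * fourier_coeff (Gh r) k \<partial>lebesgue_on {0..t}))"
proof -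
  have "\<exists>w. has_sobolev_integral s (lebesgue_on {0..t}) (\<lambda>r. propagator b (t - r) (Gh r)) w" if "t \<in> {0..T}" for t
    using has_sobolev_integral_ex[OF finite_measure_lebesgue_on s Duhamel_integrand[OF that]] by blast
  then obtain W where W: "\<And>t. t \<in> {0..T} \<Longrightarrow> has_sobolev_integral s (lebesgue_on {0..t}) (\<lambda>r. propagator b (t - r) (Gh r)) (W t)"
    by metis
  define u where "u t = propagator b t u0 + W t" for t
  have c: "fourier_coeff (u t) k = cis (eigenfreq b k * t) *
     (fourier_coeff u0 k + (\<integral>r. cis (- (eigenfreq b k * r)) * fourier_coeff (Gh r) k \<partial>lebesgue_on {0..t}))"
    if "t \<in> {0..T}" for t k
    unfolding u_def by (rule Duhamel_coeff[OF that W[OF that]])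
  have "u 0 = u0"
  proof (rule distribution_eqI)
    fix k
    have "integrable (lebesgue_on {0..0}) (\<lambda>r. cis (- (eigenfreq b k * r)) * fourier_coeff (Gh r) k)"
      using lebesgue_on_integrable_mono[OF modulated_integrable, of 0 k] T by simp
    then have "(\<integral>r. cis (- (eigenfreq b k * r)) * fourier_coeff (Gh r) k \<partial>lebesgue_on {0..0}) = 0"
      by (subst lebesgue_integral_eq_integral) auto
    then show "fourier_coeff (u 0) k = fourier_coeff u0 k" using c[of 0 k] T by simp
  qed
  then have mild: "mild_solution s b g1 g2 T u0 h u"
    unfolding mild_solution_def
  proof (intro conjI ballI)
    show "u \<in> C_sobolev s T" by (rule mild_solution_continuous[OF c])
    fix t assume "t \<in> {0..T}"
    then show "\<exists>w. has_sobolev_integral s (lebesgue_on {0..t}) (\<lambda>r. propagator b (t - r) (Gh r)) w \<and>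
        u t = propagator b t u0 + w"
      using W unfolding u_def by blast
  qed
  show ?thesis
  proof (rule that[OF mild _ c])
    fix v assume "mild_solution s b g1 g2 T u0 h v"
    then show "\<forall>t\<in>{0..T}. v t = u t"
      by (intro ballI distribution_eqI) (simp add: mild_solution_coeff c)
  qed
qed

end

section \<open>Resonances and the moment problem\<close>

text \<open>A frequency not attained on \<open>J\<close> could be added to \<open>J\<close>. The gap
  conditions on \<open>J\<close> therefore speak about the whole set of frequencies.\<close>

lemma maximal_separated_image:
  assumes "maximal_separated \<mu> J"
  shows "\<mu> ` J = range \<mu>"
proof (rule ccontr)
  assume "\<mu> ` J \<noteq> range \<mu>"
  then obtain k where k: "\<mu> k \<notin> \<mu> ` J" by blast
  then have "inj_on \<mu> (insert k J)" using assms by (auto simp: maximal_separated_def)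
  then have "insert k J = J" using assms unfolding maximal_separated_def by blast
  with k show False by auto
qed

text \<open>A real number strictly below the gap is used because the gap is an extended real,
  infinite when \<open>J\<close> has at most one element.\<close>

lemma separated_of_spectral_gap:
  assumes "ereal \<gamma> < spectral_gap \<mu> J"
  shows "separated \<gamma> (\<mu> ` J)"
  unfolding separated_def
proof (intro ballI impI)
  fix x y assume "x \<in> \<mu> ` J" "y \<in> \<mu> ` J" "x \<noteq> y"
  then obtain k k' where k: "k \<in> J" "k' \<in> J" "x = \<mu> k" "y = \<mu> k'" "k \<noteq> k'" by blast
  have "spectral_gap \<mu> J \<le> ereal \<bar>\<mu> k - \<mu> k'\<bar>"
    unfolding spectral_gap_def by (rule INF_lower2[of "(k, k')"]) (use k in auto)
  with assms have "ereal \<gamma> < ereal \<bar>\<mu> k - \<mu> k'\<bar>" by (rule less_le_trans)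
  then show "\<gamma> \<le> \<bar>x - y\<bar>" using k by simp
qed

text \<open>The supremum defining the asymptotic gap provides one finite set beyond which the gap
  exceeds \<open>2 * pi / T\<close>. The frequencies in it are put back by Haraux's argument, which
  draws on the positive overall gap.\<close>

lemma riesz_lower_of_gaps:
  assumes J: "maximal_separated \<mu> J" and gap: "0 < spectral_gap \<mu> J"
    and T: "ereal (2 * pi) / asymptotic_gap \<mu> J < ereal T"
  shows "0 < T" "riesz_lower T (range \<mu>)"
proof -
  have "spectral_gap \<mu> (J - {}) \<le> asymptotic_gap \<mu> J"
    unfolding asymptotic_gap_def by (rule SUP_upper) auto
  with gap have A: "0 < asymptotic_gap \<mu> J" by (simp add: less_le_trans)
  have "0 \<le> ereal (2 * pi) / asymptotic_gap \<mu> J"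
    using A by (cases "asymptotic_gap \<mu> J") (auto simp: zero_less_divide_iff)
  from le_less_trans[OF this T] show T0: "0 < T" by (simp add: zero_ereal_def)
  \<comment> \<open>An infinite asymptotic gap is covered, the quotient of
    \<open>ereal (2 * pi)\<close> by it being 0.\<close>
  have "ereal (2 * pi / T) < asymptotic_gap \<mu> J"
    using A T T0 by (cases "asymptotic_gap \<mu> J") (auto simp: field_simps)
  then obtain S where S: "S \<subseteq> J" "finite S" "ereal (2 * pi / T) < spectral_gap \<mu> (J - S)"
    unfolding asymptotic_gap_def less_SUP_iff by blast
  obtain \<gamma>' where \<gamma>': "ereal (2 * pi / T) < ereal \<gamma>'" "ereal \<gamma>' < spectral_gap \<mu> (J - S)"
    using ereal_dense2[OF S(3)] by blast
  obtain \<gamma> where \<gamma>: "ereal 0 < ereal \<gamma>" "ereal \<gamma> < spectral_gap \<mu> J"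
    using ereal_dense2[OF gap] by (auto simp: zero_ereal_def)
  have "2 * pi / T < \<gamma>'" using \<gamma>'(1) by simp
  then have T\<gamma>: "2 * pi < T * \<gamma>'" using T0 by (simp add: field_simps)
  show "riesz_lower T (range \<mu>)"
  proof (rule haraux_lower)
    show "separated \<gamma> (range \<mu>)"
      using separated_of_spectral_gap[OF \<gamma>(2)] maximal_separated_image[OF J] by simp
    show "0 < \<gamma>" using \<gamma>(1) by simp
    show "finite (\<mu> ` S)" using S(2) by simp
    have "range \<mu> - \<mu> ` S \<subseteq> \<mu> ` (J - S)"
      using maximal_separated_image[OF J] by blast
    then show "separated \<gamma>' (range \<mu> - \<mu> ` S)"
      using separated_of_spectral_gap[OF \<gamma>'(2)] separated_subset by blast
    show "0 < \<gamma>'" using \<open>2 * pi / T < \<gamma>'\<close> T0 by (meson divide_pos_pos less_trans mult_pos_pos pi_gt_zero zero_less_numeral)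
  qed (rule T\<gamma>)
qed

section \<open>Resonant eigenspaces and their blocks\<close>

definition reflect :: "int \<times> int \<Rightarrow> int \<times> int" where
  "reflect k = (- fst k, snd k)"

lemma reflect_simps [simp]:
  "fst (reflect k) = - fst k" "snd (reflect k) = snd k" "reflect (reflect k) = k" "freq_abs (reflect k) = freq_abs k"
  by (simp_all add: reflect_def freq_abs_def)

lemma inj_reflect: "inj_on reflect K"
  by (metis inj_onI reflect_simps(3))

text \<open>The action of the control operator on a resonant eigenspace: it only couples \<open>k\<close> with \<open>reflect k\<close>.\<close>

definition resonant_block :: "(real \<Rightarrow> real) \<Rightarrow> (int \<times> int \<Rightarrow> complex) \<Rightarrow> int \<times> int \<Rightarrow> complex" where
  "resonant_block g1 a k = (1 / (2 * pi)) *
     ((if fst k = 0 then 0 else a k / of_real (2 * pi)) +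
      (if snd k = 0 then 0 else a k / of_real (2 * pi) + (if fst k = 0 then 0 else profile_coeff g1 (2 * fst k) * a (reflect k))))"

text \<open>Cramer's rule. On the axes, off the origin, the block is the scalar
  \<open>1 / (4 * pi^2)\<close>. Off the axes it is, up to the prefactor
  \<open>1 / (2 * pi)\<close>, a two-by-two system whose determinant is at least
  \<open>1 / pi^2 - 1 / (4 * pi^2)\<close> in modulus. At the origin the block is 0, so the datum
  has to vanish there.\<close>

lemma resonant_block_solvable:
  fixes d :: "int \<times> int \<Rightarrow> complex"
  assumes g: "control_profile g1" and d: "d (0, 0) = 0"
  obtains a where "\<And>k. resonant_block g1 a k = d k"
    "\<And>k. cmod (a k) \<le> 4 * pi\<^sup>2 * (cmod (d k) + cmod (d (reflect k)))"
proof -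
  define p where "p = complex_of_real (1 / pi)"
  define \<gamma> where "\<gamma> k = profile_coeff g1 (2 * fst k)" for k :: "int \<times> int"
  define D where "D k = p\<^sup>2 - \<gamma> k * \<gamma> (reflect k)" for k
  define a where "a k = (if fst k = 0 \<or> snd k = 0 then 4 * pi\<^sup>2 * d k
     else 2 * pi * (p * d k - \<gamma> k * d (reflect k)) / D k)" for k
  have g_le: "cmod (\<gamma> k) \<le> 1 / (2 * pi)" for k
    unfolding \<gamma>_def by (rule norm_profile_coeff_le[OF g])
  have D_ge: "3 / (4 * pi\<^sup>2) \<le> cmod (D k)" for k
  proof -
    have "cmod (\<gamma> k * \<gamma> (reflect k)) \<le> 1 / (2 * pi) * (1 / (2 * pi))"
      unfolding norm_mult by (intro mult_mono g_le) auto
    moreover have "cmod (p\<^sup>2) = 1 / pi\<^sup>2" by (simp add: p_def norm_power power_divide norm_divide)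
    ultimately have "1 / pi\<^sup>2 - 1 / (2 * pi) * (1 / (2 * pi)) \<le> cmod (D k)"
      unfolding D_def using norm_triangle_ineq2[of "p\<^sup>2" "\<gamma> k * \<gamma> (reflect k)"] by linarith
    moreover have "1 / pi\<^sup>2 - 1 / (2 * pi) * (1 / (2 * pi)) = 3 / (4 * pi\<^sup>2)"
      by (simp add: field_simps power2_eq_square)
    ultimately show ?thesis by simp
  qed
  have D0: "D k \<noteq> 0" for k
  proof -
    have "0 < 3 / (4 * pi\<^sup>2)" by simp
    then have "0 < cmod (D k)" using D_ge[of k] by linarith
    then show ?thesis by simp
  qed
  have D_reflect: "D (reflect k) = D k" for k by (simp add: D_def mult.commute)
  show ?thesis
  proof (rule that[of a])
    fix k
    have pi2: "complex_of_real pi \<noteq> 0" by simp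
    show "resonant_block g1 a k = d k"
    proof (cases "fst k = 0 \<or> snd k = 0")
      case True
      have "k = (0, 0)" if "fst k = 0" "snd k = 0" using that by (cases k) auto
      then show ?thesis using True d unfolding resonant_block_def a_def
        by (auto simp: field_simps power2_eq_square)
    next
      case False
      have "p * a k + \<gamma> k * a (reflect k) =
         2 * pi * (p * (p * d k - \<gamma> k * d (reflect k)) + \<gamma> k * (p * d (reflect k) - \<gamma> (reflect k) * d k)) / D k"
        using False by (simp add: a_def D_reflect add_divide_distrib[symmetric] algebra_simps)
      also have "p * (p * d k - \<gamma> k * d (reflect k)) + \<gamma> k * (p * d (reflect k) - \<gamma> (reflect k) * d k) = D k * d k"
        by (simp add: D_def algebra_simps power2_eq_square)
      finally have "p * a k + \<gamma> k * a (reflect k) = 2 * pi * d k" using D0[of k] by simp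
      moreover have "a k / (2 * pi) + a k / (2 * pi) = p * a k" by (simp add: p_def field_simps)
      ultimately have "resonant_block g1 a k = (1 / (2 * pi)) * (2 * pi * d k)"
        unfolding resonant_block_def \<gamma>_def using False by (simp add: add.assoc[symmetric])
      then show ?thesis by simp
    qed
    show "cmod (a k) \<le> 4 * pi\<^sup>2 * (cmod (d k) + cmod (d (reflect k)))"
    proof (cases "fst k = 0 \<or> snd k = 0")
      case True
      then have "cmod (a k) = 4 * pi\<^sup>2 * cmod (d k)" by (simp add: a_def norm_mult norm_power)
      then show ?thesis by (simp add: mult_left_mono)
    next
      case False
      have "cmod (p * d k - \<gamma> k * d (reflect k)) \<le> cmod p * cmod (d k) + cmod (\<gamma> k) * cmod (d (reflect k))"
        by (rule order_trans[OF norm_triangle_ineq4]) (simp add: norm_mult)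
      also have "\<dots> \<le> 1 / pi * cmod (d k) + 1 / pi * cmod (d (reflect k))"
      proof (intro add_mono mult_right_mono)
        have "1 / (2 * pi) \<le> 1 / pi" by (simp add: field_simps)
        then show "cmod (\<gamma> k) \<le> 1 / pi" using g_le[of k] by linarith
      qed (simp_all add: p_def norm_divide)
      also have "\<dots> = 1 / pi * (cmod (d k) + cmod (d (reflect k)))" by (simp add: distrib_left)
      finally have n: "cmod (p * d k - \<gamma> k * d (reflect k)) \<le> 1 / pi * (cmod (d k) + cmod (d (reflect k)))" .
      have "cmod (a k) = 2 * pi * cmod (p * d k - \<gamma> k * d (reflect k)) / cmod (D k)"
        using False by (simp add: a_def norm_mult norm_divide)
      also have "\<dots> \<le> 2 * pi * (1 / pi * (cmod (d k) + cmod (d (reflect k)))) / (3 / (4 * pi\<^sup>2))"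
        using n D_ge[of k] by (intro frac_le mult_left_mono) auto
      \<comment> \<open>8/3 is rounded up to 4, so that one constant also covers the axes.\<close>
      also have "\<dots> = 8 / 3 * pi\<^sup>2 * (cmod (d k) + cmod (d (reflect k)))" by (simp add: field_simps)
      also have "\<dots> \<le> 4 * pi\<^sup>2 * (cmod (d k) + cmod (d (reflect k)))"
        by (intro mult_right_mono) auto
      finally show ?thesis .
    qed
  qed
qed

text \<open>Coefficients of a profile lifted in y sit on the second axis, so they connect modes with
  the same first index, among which \<open>ii\<close> leaves only the shift 0. For the profile in x,
  \<open>iii\<close> leaves the shifts 0 and \<open>(2 * fst k, 0)\<close>, the latter leading to
  \<open>reflect k\<close>. Equality is eventual because the square has to contain these
  shifts.\<close>

lemma control_coeff_resonant:
  fixes a :: "int \<times> int \<Rightarrow> complex" and \<mu> :: "int \<times> int \<Rightarrow> real"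
  assumes g: "control_profile g1" "control_profile g2"
    and ii: "\<And>k1 k2 j2. k1 \<noteq> 0 \<Longrightarrow> \<mu> (k1, j2) = \<mu> (k1, k2) \<longleftrightarrow> j2 = k2"
    and iii: "\<And>k1 k2 j1. k2 \<noteq> 0 \<Longrightarrow> \<mu> (j1, k2) = \<mu> (k1, k2) \<longleftrightarrow> j1 = k1 \<or> j1 = - k1"
  shows "\<forall>\<^sub>F n in sequentially. control_coeff g1 g2 (\<lambda>j. if \<mu> j = \<mu> k then a j else 0) n k = resonant_block g1 a k"
  using freq_box_exhaust[of "{0, (2 * fst k, 0)}", simplified]
proof eventually_elim
  case (elim n)
  define c where "c j = (if \<mu> j = \<mu> k then a j else 0)" for j
  obtain k1 k2 where k: "k = (k1, k2)" by (cases k)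
  have 2: "(\<Sum>j\<in>freq_box n. fcoeff (lift_y g2) j * c (k - j)) = a k / (2 * pi)" if "fst k \<noteq> 0"
  proof -
    have "(\<Sum>j\<in>freq_box n. fcoeff (lift_y g2) j * c (k - j)) = (\<Sum>j\<in>{0}. fcoeff (lift_y g2) j * c (k - j))"
    proof (rule sum.mono_neutral_right)
      show "\<forall>j\<in>freq_box n - {0}. fcoeff (lift_y g2) j * c (k - j) = 0"
      proof
        fix j assume j: "j \<in> freq_box n - {0}"
        obtain j1 j2 where j12: "j = (j1, j2)" by (cases j)
        show "fcoeff (lift_y g2) j * c (k - j) = 0"
          using j that ii[of k1 "k2 - j2" k2] unfolding j12 k c_def
          by (auto simp: fcoeff_lift_y[OF g(2)] zero_prod_def)
      qed
    qed (use elim in auto)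
    then show ?thesis using profile_coeff_0[OF g(2)] by (simp add: fcoeff_lift_y[OF g(2)] c_def)
  qed
  have 1: "(\<Sum>j\<in>freq_box n. fcoeff (lift_x g1) j * c (k - j)) =
      a k / (2 * pi) + (if fst k = 0 then 0 else profile_coeff g1 (2 * fst k) * a (reflect k))" if "snd k \<noteq> 0"
  proof -
    have "(\<Sum>j\<in>freq_box n. fcoeff (lift_x g1) j * c (k - j)) =
       (\<Sum>j\<in>{0, (2 * fst k, 0)}. fcoeff (lift_x g1) j * c (k - j))"
    proof (rule sum.mono_neutral_right)
      show "\<forall>j\<in>freq_box n - {0, (2 * fst k, 0)}. fcoeff (lift_x g1) j * c (k - j) = 0"
      proof
        fix j assume j: "j \<in> freq_box n - {0, (2 * fst k, 0)}"
        obtain j1 j2 where j12: "j = (j1, j2)" by (cases j)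
        show "fcoeff (lift_x g1) j * c (k - j) = 0"
          using j that iii[of k2 "k1 - j1" k1] unfolding j12 k c_def
          by (auto simp: fcoeff_lift_x[OF g(1)] zero_prod_def)
      qed
    qed (use elim in auto)
    moreover have "k - (2 * fst k, 0) = reflect k" by (simp add: k reflect_def)
    moreover have "\<mu> (reflect k) = \<mu> k" using iii[of k2 "- k1" k1] that by (simp add: k reflect_def)
    \<comment> \<open>When the first index is 0 the two shifts coincide and must be counted
      once.\<close>
    moreover have "(2 * fst k, 0) = (0 :: int \<times> int) \<longleftrightarrow> fst k = 0" by (simp add: zero_prod_def)
    ultimately show ?thesis
      using profile_coeff_0[OF g(1)]
      by (cases "fst k = 0") (simp_all add: fcoeff_lift_x[OF g(1)] c_def eq_commute[of 0 "(_, _)"])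
  qed
  show ?case
    unfolding control_coeff_def resonant_block_def c_def[symmetric] using 1 2 by auto
qed

text \<open>The constant is uniform in \<open>n\<close> and \<open>k\<close>, so that a multiple of
  the norm of \<open>h t\<close> can dominate the truncations when they are integrated in
  time.\<close>

lemma control_coeff_bound:
  assumes g: "control_profile g1" "control_profile g2"
  obtains C where "\<And>c n k S. (\<And>j. cmod (c j) \<le> S) \<Longrightarrow> cmod (control_coeff g1 g2 c n k) \<le> C * S"
proof -
  define A where "A w = (\<Sum>\<^sub>\<infinity>j. cmod (fcoeff w j))" for w
  have conv: "cmod (\<Sum>j\<in>freq_box n. fcoeff w j * c (k - j)) \<le> A w * S"
    if c: "\<And>j. cmod (c j) \<le> S" and w: "test_function w" for w c S n k
  proof -
    have S0: "0 \<le> S" using c[of undefined] norm_ge_zero order_trans by blast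
    have "cmod (\<Sum>j\<in>freq_box n. fcoeff w j * c (k - j)) \<le> (\<Sum>j\<in>freq_box n. cmod (fcoeff w j) * S)"
      by (rule sum_norm_le) (simp add: norm_mult mult_left_mono c)
    also have "\<dots> = (\<Sum>j\<in>freq_box n. cmod (fcoeff w j)) * S" by (simp add: sum_distrib_right)
    also have "\<dots> \<le> A w * S"
      unfolding A_def using summable_fcoeff_weighted[OF w, of 0] S0
      by (intro mult_right_mono finite_sum_le_infsum) auto
    finally show ?thesis .
  qed
  have A0: "0 \<le> A w" for w unfolding A_def by (intro infsum_nonneg) simp
  show ?thesis
  proof (rule that[of "(1 / (2 * pi)) * (A (lift_y g2) + A (lift_x g1))"])
    fix c :: "int \<times> int \<Rightarrow> complex" and n k S assume c: "\<And>j. cmod (c j) \<le> S"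
    have S0: "0 \<le> S" using c[of undefined] norm_ge_zero order_trans by blast
    have "cmod ((if fst k = 0 then 0 else (\<Sum>j\<in>freq_box n. fcoeff (lift_y g2) j * c (k - j))) +
        (if snd k = 0 then 0 else (\<Sum>j\<in>freq_box n. fcoeff (lift_x g1) j * c (k - j)))) \<le> A (lift_y g2) * S + A (lift_x g1) * S"
      using conv[OF c test_function_lift(2)[OF g(2)], where n = n and k = k]
        conv[OF c test_function_lift(1)[OF g(1)], where n = n and k = k] A0 S0
      by (intro order_trans[OF norm_triangle_ineq] add_mono) auto
    then show "cmod (control_coeff g1 g2 c n k) \<le> (1 / (2 * pi)) * (A (lift_y g2) + A (lift_x g1)) * S"
      unfolding control_coeff_def norm_mult by (simp add: norm_divide norm_mult divide_right_mono distrib_right)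
  qed
qed

section \<open>Assembling the control from its modes, and its moments\<close>

lemma modulated_field_ex:
  assumes s: "0 \<le> s" and \<alpha>: "\<alpha> \<in> sobolev s"
    and p [measurable]: "\<And>k. p k \<in> borel_measurable M" and pI: "\<And>k. integrable M (\<lambda>t. (cmod (p k t))\<^sup>2)"
    and Q: "\<And>k. (\<integral>t. (cmod (p k t))\<^sup>2 \<partial>M) \<le> Q" "0 \<le> Q"
  shows "\<exists>h. (\<forall>t. h t \<in> sobolev s) \<and> (\<forall>k. (\<lambda>t. fourier_coeff (h t) k) \<in> borel_measurable M) \<and>
    (\<forall>k. AE t in M. fourier_coeff (h t) k = fourier_coeff \<alpha> k * p k t) \<and>
    (\<integral>\<^sup>+t. ennreal ((sobolev_norm s (h t))\<^sup>2) \<partial>M) \<le> ennreal (Q * (sobolev_norm s \<alpha>)\<^sup>2)"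
proof -
  define W where "W t k = (1 + freq_abs k) powr (2 * s) * (cmod (fourier_coeff \<alpha> k * p k t))\<^sup>2" for t k
  define F where "F n t = (2 * pi)\<^sup>2 * (\<Sum>k\<in>freq_box n. W t k)" for n t
  have W0: "0 \<le> W t k" for t k by (simp add: W_def)
  have [measurable]: "F n \<in> borel_measurable M" for n unfolding F_def W_def by measurable
  have F_mono: "F m t \<le> F n t" if "m \<le> n" for m n t
    unfolding F_def using that by (intro mult_left_mono sum_mono2 W0) (auto simp: freq_box_def)
  \<comment> \<open>The pointwise energy. Monotone convergence makes its integral finite, hence the
    energy is finite for almost every t; at individual times the series may diverge.\<close>
  define \<Phi> where "\<Phi> t = (SUP n. ennreal (F n t))" for t
  have [measurable]: "\<Phi> \<in> borel_measurable M" unfolding \<Phi>_def by measurable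
  have "(\<integral>\<^sup>+t. \<Phi> t \<partial>M) = (SUP n. \<integral>\<^sup>+t. ennreal (F n t) \<partial>M)"
    unfolding \<Phi>_def by (rule nn_integral_monotone_convergence_SUP)
      (auto simp: incseq_def le_fun_def intro!: ennreal_leI F_mono)
  also have "\<dots> \<le> ennreal (Q * (sobolev_norm s \<alpha>)\<^sup>2)"
  proof (rule SUP_least)
    fix n
    have Wi: "integrable M (\<lambda>t. W t k)" for k
      using pI[of k] unfolding W_def by (simp add: norm_mult power_mult_distrib)
    have "(\<integral>\<^sup>+t. ennreal (F n t) \<partial>M) = ennreal (\<integral>t. F n t \<partial>M)"
      unfolding F_def using Wi by (intro nn_integral_eq_integral) (auto intro!: sum_nonneg W0 mult_nonneg_nonneg)
    also have "(\<integral>t. F n t \<partial>M) = (2 * pi)\<^sup>2 * (\<Sum>k\<in>freq_box n. \<integral>t. W t k \<partial>M)"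
      unfolding F_def using Wi by simp
    also have "\<dots> \<le> (2 * pi)\<^sup>2 * (\<Sum>k\<in>freq_box n. Q * ((1 + freq_abs k) powr (2 * s) * (cmod (fourier_coeff \<alpha> k))\<^sup>2))"
    proof (intro mult_left_mono sum_mono)
      fix k
      have "(\<integral>t. W t k \<partial>M) = (1 + freq_abs k) powr (2 * s) * (cmod (fourier_coeff \<alpha> k))\<^sup>2 * (\<integral>t. (cmod (p k t))\<^sup>2 \<partial>M)"
        unfolding W_def by (simp add: norm_mult power_mult_distrib mult.assoc)
      also have "\<dots> \<le> (1 + freq_abs k) powr (2 * s) * (cmod (fourier_coeff \<alpha> k))\<^sup>2 * Q"
        by (intro mult_left_mono Q) auto
      finally show "(\<integral>t. W t k \<partial>M) \<le> Q * ((1 + freq_abs k) powr (2 * s) * (cmod (fourier_coeff \<alpha> k))\<^sup>2)"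
        by (simp add: mult_ac)
    qed simp
    also have "\<dots> = Q * ((2 * pi)\<^sup>2 * (\<Sum>k\<in>freq_box n. (1 + freq_abs k) powr (2 * s) * (cmod (fourier_coeff \<alpha> k))\<^sup>2))"
      by (simp add: sum_distrib_left mult_ac)
    also have "\<dots> \<le> Q * (sobolev_norm s \<alpha>)\<^sup>2"
      by (intro mult_left_mono sobolev_norm_finite_sum \<alpha> Q) auto
    finally show "(\<integral>\<^sup>+t. ennreal (F n t) \<partial>M) \<le> ennreal (Q * (sobolev_norm s \<alpha>)\<^sup>2)"
      by (simp add: ennreal_leI)
  qed
  finally have \<Phi>: "(\<integral>\<^sup>+t. \<Phi> t \<partial>M) \<le> ennreal (Q * (sobolev_norm s \<alpha>)\<^sup>2)" .
  have "(\<integral>\<^sup>+t. \<Phi> t \<partial>M) < \<infinity>" by (rule le_less_trans[OF \<Phi>]) simp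
  then have "(\<integral>\<^sup>+t. \<Phi> t \<partial>M) \<noteq> \<infinity>" by simp
  then have fin: "AE t in M. \<Phi> t \<noteq> \<infinity>" by (intro nn_integral_noteq_infinite) auto
  \<comment> \<open>On the exceptional null set the field is set to 0, so that it lies in the space
    at every time; the formula for its coefficients then holds almost everywhere.\<close>
  have ex: "\<exists>u. u \<in> sobolev s \<and> (\<forall>k. fourier_coeff u k = (if \<Phi> t = \<infinity> then 0 else fourier_coeff \<alpha> k * p k t)) \<and>
     ennreal ((sobolev_norm s u)\<^sup>2) \<le> \<Phi> t" for t
  proof (cases "\<Phi> t = \<infinity>")
    case True
    then show ?thesis by (intro exI[of _ 0]) (simp add: sobolev_zero)
  next
    case False
    define B where "B = enn2real (\<Phi> t)"
    have B: "0 \<le> B" "\<Phi> t = ennreal B" using False by (auto simp: B_def top.not_eq_extremum)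
    have le: "(2 * pi)\<^sup>2 * (\<Sum>k\<in>K. W t k) \<le> B" if K: "finite K" for K
    proof -
      obtain n where n: "K \<subseteq> freq_box n" using freq_box_exhaust[OF K] by (auto simp: eventually_sequentially)
      have "(2 * pi)\<^sup>2 * (\<Sum>k\<in>K. W t k) \<le> F n t"
        unfolding F_def using n by (intro mult_left_mono sum_mono2 W0) auto
      also have "ennreal (F n t) \<le> ennreal B" unfolding B(2)[symmetric] \<Phi>_def by (rule SUP_upper) simp
      then have "F n t \<le> B" using B(1) by (simp add: ennreal_le_iff)
      finally show ?thesis .
    qed
    have "(\<lambda>k. W t k) summable_on UNIV"
    proof (rule nonneg_bdd_above_summable_on)
      have "(\<Sum>k\<in>K. W t k) \<le> B / (2 * pi)\<^sup>2" if "finite K" for K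
        using le[OF that] by (subst pos_le_divide_eq) (simp_all add: mult.commute)
      then show "bdd_above (sum (W t) ` {F. F \<subseteq> UNIV \<and> finite F})"
        by (intro bdd_aboveI[of _ "B / (2 * pi)\<^sup>2"]) blast
    qed (rule W0)
    then obtain u where u: "u \<in> sobolev s" "\<And>k. fourier_coeff u k = fourier_coeff \<alpha> k * p k t"
      unfolding W_def by (rule sobolev_ex[OF s]) (rule that)
    have "sobolev_norm s u \<le> sqrt B"
      using le B(1) by (intro sobolevI(2)) (auto simp: u(2) W_def)
    then have "(sobolev_norm s u)\<^sup>2 \<le> (sqrt B)\<^sup>2" by (intro power_mono sobolev_norm_nonneg)
    then have "ennreal ((sobolev_norm s u)\<^sup>2) \<le> \<Phi> t" using B by (simp add: ennreal_leI)
    then show ?thesis using u False by auto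
  qed
  then obtain h where h: "\<And>t. h t \<in> sobolev s"
    "\<And>t k. fourier_coeff (h t) k = (if \<Phi> t = \<infinity> then 0 else fourier_coeff \<alpha> k * p k t)"
    "\<And>t. ennreal ((sobolev_norm s (h t))\<^sup>2) \<le> \<Phi> t" by metis
  show ?thesis
  proof (intro exI[of _ h] conjI allI h(1))
    show "(\<lambda>t. fourier_coeff (h t) k) \<in> borel_measurable M" for k unfolding h(2) by measurable
    show "AE t in M. fourier_coeff (h t) k = fourier_coeff \<alpha> k * p k t" for k
      using fin by eventually_elim (simp add: h(2))
    have "(\<integral>\<^sup>+t. ennreal ((sobolev_norm s (h t))\<^sup>2) \<partial>M) \<le> (\<integral>\<^sup>+t. \<Phi> t \<partial>M)"
      by (intro nn_integral_mono h(3))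
    also note \<Phi>
    finally show "(\<integral>\<^sup>+t. ennreal ((sobolev_norm s (h t))\<^sup>2) \<partial>M) \<le> ennreal (Q * (sobolev_norm s \<alpha>)\<^sup>2)" .
  qed
qed

text \<open>The weight is invariant under \<open>reflect\<close>, so reflected coefficients have the
  same norm. Squaring four terms costs a factor 4, each of the two norms occurs twice, and the
  resulting 8 is rounded up to the square 9.\<close>

lemma sobolev_reflected_combination:
  fixes a :: "int \<times> int \<Rightarrow> complex"
  assumes s: "0 \<le> s" and u: "u0 \<in> sobolev s" "u1 \<in> sobolev s" and C: "0 \<le> C"
    and a: "\<And>k. cmod (a k) \<le> C * (cmod (fourier_coeff u1 k) + cmod (fourier_coeff u0 k)
      + (cmod (fourier_coeff u1 (reflect k)) + cmod (fourier_coeff u0 (reflect k))))"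
  obtains \<alpha> where "\<alpha> \<in> sobolev s" "\<And>k. fourier_coeff \<alpha> k = a k"
    "sobolev_norm s \<alpha> \<le> 3 * C * (sobolev_norm s u0 + sobolev_norm s u1)"
proof -
  let ?w = "\<lambda>k. (1 + freq_abs k) powr (2 * s)"
  define E where "E u K = (2 * pi)\<^sup>2 * (\<Sum>k\<in>K. ?w k * (cmod (fourier_coeff u k))\<^sup>2)" for u K
  have Er: "(2 * pi)\<^sup>2 * (\<Sum>k\<in>K. ?w k * (cmod (fourier_coeff u (reflect k)))\<^sup>2) = E u (reflect ` K)" for u K
    unfolding E_def by (subst sum.reindex[OF inj_reflect]) simp
  have le: "(2 * pi)\<^sup>2 * (\<Sum>k\<in>K. ?w k * (cmod (a k))\<^sup>2) \<le> (3 * C * (sobolev_norm s u0 + sobolev_norm s u1))\<^sup>2"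
    if K: "finite K" for K
  proof -
    have "(2 * pi)\<^sup>2 * (\<Sum>k\<in>K. ?w k * (cmod (a k))\<^sup>2) \<le> (2 * pi)\<^sup>2 * (\<Sum>k\<in>K. ?w k * (4 * C\<^sup>2 *
        ((cmod (fourier_coeff u1 k))\<^sup>2 + (cmod (fourier_coeff u0 k))\<^sup>2
      + ((cmod (fourier_coeff u1 (reflect k)))\<^sup>2 + (cmod (fourier_coeff u0 (reflect k)))\<^sup>2))))"
    proof (intro mult_left_mono sum_mono)
      fix k
      have sq: "(x + y)\<^sup>2 \<le> 2 * x\<^sup>2 + 2 * y\<^sup>2" for x y :: real
        using sum_squares_bound[of x y] by (simp add: power2_sum)
      have four: "(x + y + (z + v))\<^sup>2 \<le> 4 * (x\<^sup>2 + y\<^sup>2 + (z\<^sup>2 + v\<^sup>2))" for x y z v :: real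
      proof -
        have "(x + y + (z + v))\<^sup>2 \<le> 2 * (x + y)\<^sup>2 + 2 * (z + v)\<^sup>2" by (rule sq)
        also have "\<dots> \<le> 2 * (2 * x\<^sup>2 + 2 * y\<^sup>2) + 2 * (2 * z\<^sup>2 + 2 * v\<^sup>2)"
          by (intro add_mono mult_left_mono sq) auto
        finally show ?thesis by simp
      qed
      have "(cmod (a k))\<^sup>2 \<le> (C * (cmod (fourier_coeff u1 k) + cmod (fourier_coeff u0 k)
        + (cmod (fourier_coeff u1 (reflect k)) + cmod (fourier_coeff u0 (reflect k)))))\<^sup>2"
        by (intro power_mono a) auto
      also have "\<dots> \<le> C\<^sup>2 * (4 * ((cmod (fourier_coeff u1 k))\<^sup>2 + (cmod (fourier_coeff u0 k))\<^sup>2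
        + ((cmod (fourier_coeff u1 (reflect k)))\<^sup>2 + (cmod (fourier_coeff u0 (reflect k)))\<^sup>2)))"
        unfolding power_mult_distrib by (intro mult_left_mono four) auto
      finally show "(cmod (a k))\<^sup>2 \<le> 4 * C\<^sup>2 * ((cmod (fourier_coeff u1 k))\<^sup>2 + (cmod (fourier_coeff u0 k))\<^sup>2
        + ((cmod (fourier_coeff u1 (reflect k)))\<^sup>2 + (cmod (fourier_coeff u0 (reflect k)))\<^sup>2))"
        by (simp only: mult_ac)
    qed auto
    also have "\<dots> = 4 * C\<^sup>2 * (E u1 K + E u0 K + (E u1 (reflect ` K) + E u0 (reflect ` K)))"
      unfolding Er[symmetric] unfolding E_def by (simp add: sum_distrib_left sum.distrib algebra_simps)
    also have "\<dots> \<le> 4 * C\<^sup>2 * ((sobolev_norm s u1)\<^sup>2 + (sobolev_norm s u0)\<^sup>2 + ((sobolev_norm s u1)\<^sup>2 + (sobolev_norm s u0)\<^sup>2))"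
      unfolding E_def using K by (intro mult_left_mono add_mono sobolev_norm_finite_sum u) auto
    also have "\<dots> = 8 * (C\<^sup>2 * ((sobolev_norm s u0)\<^sup>2 + (sobolev_norm s u1)\<^sup>2))" by (simp add: algebra_simps)
    also have "\<dots> \<le> 9 * (C\<^sup>2 * (sobolev_norm s u0 + sobolev_norm s u1)\<^sup>2)"
      using sobolev_norm_nonneg[of s u0] sobolev_norm_nonneg[of s u1]
      by (intro mult_mono) (auto simp: power2_sum intro!: mult_nonneg_nonneg)
    also have "\<dots> = (3 * C * (sobolev_norm s u0 + sobolev_norm s u1))\<^sup>2" by (simp add: power_mult_distrib)
    finally show ?thesis .
  qed
  have "(\<lambda>k. ?w k * (cmod (a k))\<^sup>2) summable_on UNIV"
  proof (rule nonneg_bdd_above_summable_on)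
    let ?B = "(3 * C * (sobolev_norm s u0 + sobolev_norm s u1))\<^sup>2"
    have "(\<Sum>k\<in>K. ?w k * (cmod (a k))\<^sup>2) \<le> ?B / (2 * pi)\<^sup>2" if "finite K" for K
      using le[OF that] by (subst pos_le_divide_eq) (simp_all add: mult.commute)
    then show "bdd_above (sum (\<lambda>k. ?w k * (cmod (a k))\<^sup>2) ` {F. F \<subseteq> UNIV \<and> finite F})"
      by (intro bdd_aboveI[of _ "?B / (2 * pi)\<^sup>2"]) blast
  qed simp
  then obtain \<alpha> where \<alpha>: "\<alpha> \<in> sobolev s" "\<And>k. fourier_coeff \<alpha> k = a k"
    by (rule sobolev_ex[OF s]) (rule that)
  moreover have "sobolev_norm s \<alpha> \<le> 3 * C * (sobolev_norm s u0 + sobolev_norm s u1)"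
    using le C sobolev_norm_nonneg[of s u0] sobolev_norm_nonneg[of s u1]
    by (intro sobolevI(2)) (auto simp: \<alpha>(2))
  ultimately show ?thesis by (rule that)
qed

text \<open>Duality filters frequencies: integrated against \<open>cis (- (\<mu> k * t))\<close>,
  the coefficients of \<open>h\<close> survive only on the eigenspace of \<open>k\<close>, with
  values \<open>a\<close>. The infinite convolution in the control operator is exchanged with the
  time integral through its truncations.\<close>

lemma control_moment:
  fixes \<mu> :: "int \<times> int \<Rightarrow> real" and a :: "int \<times> int \<Rightarrow> complex"
  assumes data: "control_data s T g1 g2 u0 h"
    and q: "\<And>j. integrable (lebesgue_on {0..T}) (q j)"
    and dual: "\<And>j. (\<integral>t. q j t * cis (- (\<mu> k * t)) \<partial>lebesgue_on {0..T}) = (if \<mu> j = \<mu> k then 1 else 0)"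
    and hq: "\<And>j. AE t in lebesgue_on {0..T}. fourier_coeff (h t) j = a j * q j t"
    and ii: "\<And>k1 k2 j2. k1 \<noteq> 0 \<Longrightarrow> \<mu> (k1, j2) = \<mu> (k1, k2) \<longleftrightarrow> j2 = k2"
    and iii: "\<And>k1 k2 j1. k2 \<noteq> 0 \<Longrightarrow> \<mu> (j1, k2) = \<mu> (k1, k2) \<longleftrightarrow> j1 = k1 \<or> j1 = - k1"
  shows "(\<integral>t. cis (- (\<mu> k * t)) * fourier_coeff (G_op g1 g2 (h t)) k \<partial>lebesgue_on {0..T}) = resonant_block g1 a k"
proof -
  \<comment> \<open>The facts about \<open>h\<close> and \<open>Gh\<close> used below do not involve
    the symbol, so the zero symbol is supplied.\<close>
  interpret control_data s T "\<lambda>_. 0" g1 g2 u0 h by (rule data)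
  let ?M = "lebesgue_on {0..T}"
  define e where "e t = cis (- (\<mu> k * t))" for t
  have [measurable]: "e \<in> borel_measurable ?M"
    unfolding e_def by (intro borel_measurable_integrable continuous_imp_integrable_real continuous_intros)
  have ne: "cmod (e t) = 1" for t by (simp add: e_def)
  have hci: "integrable ?M (\<lambda>t. fourier_coeff (h t) j)" for j
    by (rule integrable_fourier_coeff[OF s _ hm hi]) (simp add: h)
  have ehi: "integrable ?M (\<lambda>t. e t * fourier_coeff (h t) j)" for j
    by (rule Bochner_Integration.integrable_bound[OF hci[of j]]) (use hm in \<open>auto simp: norm_mult ne\<close>)
  have eh: "(\<integral>t. e t * fourier_coeff (h t) j \<partial>?M) = (if \<mu> j = \<mu> k then a j else 0)" for j
  proof -
    have [measurable]: "q j \<in> borel_measurable ?M" using q by simp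
    have "(\<integral>t. e t * fourier_coeff (h t) j \<partial>?M) = (\<integral>t. a j * (q j t * e t) \<partial>?M)"
      using hq[of j] hm by (intro integral_cong_AE) (auto elim!: eventually_mono simp: mult_ac)
    then show ?thesis using dual[of j] by (simp add: e_def)
  qed
  have lin: "(\<integral>t. e t * control_coeff g1 g2 (fourier_coeff (h t)) n k \<partial>?M) =
      control_coeff g1 g2 (\<lambda>j. if \<mu> j = \<mu> k then a j else 0) n k" for n
  proof -
    have S: "(\<integral>t. (\<Sum>j\<in>freq_box n. fcoeff w j * (e t * fourier_coeff (h t) (k - j))) \<partial>?M) =
        (\<Sum>j\<in>freq_box n. fcoeff w j * (if \<mu> (k - j) = \<mu> k then a (k - j) else 0))"
      "integrable ?M (\<lambda>t. (\<Sum>j\<in>freq_box n. fcoeff w j * (e t * fourier_coeff (h t) (k - j))))" for w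
      using ehi by (simp_all add: eh)
    have "(\<lambda>t. e t * control_coeff g1 g2 (fourier_coeff (h t)) n k) = (\<lambda>t. (1 / (2 * pi)) *
      ((if fst k = 0 then 0 else (\<Sum>j\<in>freq_box n. fcoeff (lift_y g2) j * (e t * fourier_coeff (h t) (k - j)))) +
       (if snd k = 0 then 0 else (\<Sum>j\<in>freq_box n. fcoeff (lift_x g1) j * (e t * fourier_coeff (h t) (k - j))))))"
      by (auto simp: control_coeff_def fun_eq_iff sum_distrib_left algebra_simps)
    then show ?thesis
      unfolding control_coeff_def using S by (cases "fst k = 0"; cases "snd k = 0") simp_all
  qed
  obtain C where C: "\<And>c n k S. (\<And>j. cmod (c j) \<le> S) \<Longrightarrow> cmod (control_coeff g1 g2 c n k) \<le> C * S"
    using control_coeff_bound[OF g] by blast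
  have lim: "(\<lambda>n. \<integral>t. e t * control_coeff g1 g2 (fourier_coeff (h t)) n k \<partial>?M) \<longlonglongrightarrow> (\<integral>t. e t * fourier_coeff (Gh t) k \<partial>?M)"
  proof (rule integral_dominated_convergence[where w = "\<lambda>t. C * sobolev_norm s (h t)"])
    show "(\<lambda>t. e t * fourier_coeff (Gh t) k) \<in> borel_measurable ?M"
      using Gh_measurable by measurable
    show "(\<lambda>t. e t * control_coeff g1 g2 (fourier_coeff (h t)) n k) \<in> borel_measurable ?M" for n
      unfolding control_coeff_def using hm by (cases "fst k = 0"; cases "snd k = 0") simp_all
    show "integrable ?M (\<lambda>t. C * sobolev_norm s (h t))" using hi by simp
    show "AE t in ?M. (\<lambda>n. e t * control_coeff g1 g2 (fourier_coeff (h t)) n k) \<longlonglongrightarrow> e t * fourier_coeff (Gh t) k"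
      by (intro AE_I2 tendsto_mult tendsto_const Gh_coeff_tendsto) simp
    show "AE t in ?M. cmod (e t * control_coeff g1 g2 (fourier_coeff (h t)) n k) \<le> C * sobolev_norm s (h t)" for n
      using C fourier_coeff_le_norm[OF s h] by (intro AE_I2) (simp add: norm_mult ne)
  qed
  have "(\<lambda>n. control_coeff g1 g2 (\<lambda>j. if \<mu> j = \<mu> k then a j else 0) n k) \<longlonglongrightarrow> resonant_block g1 a k"
    by (rule tendsto_eventually) (rule control_coeff_resonant[OF g ii iii])
  from LIMSEQ_unique[OF lim[unfolded lin] this] show ?thesis
    by (simp only: e_def)
qed

text \<open>The biorthogonal functions depend on the time and on the set of frequencies only, so the
  constant can be fixed before the second profile and the end states are given.\<close>

theorem theorem1p1:
  fixes s r :: real and b :: "int \<times> int \<Rightarrow> real" and J :: "(int \<times> int) set" and g\<^sub>1 :: "real \<Rightarrow> real"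
  assumes s: "0 \<le> s" and r: "1 \<le> r"
    and growth: "\<exists>C N\<^sub>0. 0 < C \<and> 0 \<le> N\<^sub>0 \<and>
      (\<forall>k. N\<^sub>0 \<le> freq_abs k \<longrightarrow> \<bar>b k\<bar> \<le> C * freq_abs k powr (r - 1))"
    and i: "\<And>k1 k2. eigenfreq b (- k1, k2) = eigenfreq b (k1, k2)
      \<and> eigenfreq b (k1, - k2) = - eigenfreq b (k1, k2)"
    and ii: "\<And>k1 k2 j2. k1 \<noteq> 0 \<Longrightarrow> eigenfreq b (k1, j2) = eigenfreq b (k1, k2) \<longleftrightarrow> j2 = k2"
    and iii: "\<And>k1 k2 j1. k2 \<noteq> 0 \<Longrightarrow>
      eigenfreq b (j1, k2) = eigenfreq b (k1, k2) \<longleftrightarrow> j1 = k1 \<or> j1 = - k1"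
    and J: "maximal_separated (eigenfreq b) J"
    and gap: "0 < spectral_gap (eigenfreq b) J"
    and g1: "control_profile g\<^sub>1"
  shows "\<forall>T::real. ereal T > ereal (2 * pi) / asymptotic_gap (eigenfreq b) J \<longrightarrow>
    (\<exists>\<nu>>0. \<forall>g\<^sub>2. control_profile g\<^sub>2 \<longrightarrow>
      (\<forall>u\<^sub>0\<in>sobolev s. \<forall>u\<^sub>1\<in>sobolev s. fourier_coeff u\<^sub>0 (0, 0) = fourier_coeff u\<^sub>1 (0, 0) \<longrightarrow>
        (\<exists>h\<in>L2_sobolev s T.
          (\<exists>u. mild_solution s b g\<^sub>1 g\<^sub>2 T u\<^sub>0 h u \<and>
               (\<forall>v. mild_solution s b g\<^sub>1 g\<^sub>2 T u\<^sub>0 h v \<longrightarrow> (\<forall>t\<in>{0..T}. v t = u t)) \<and>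
               u T = u\<^sub>1) \<and>
          L2_sobolev_norm s T h \<le> \<nu> * (sobolev_norm s u\<^sub>0 + sobolev_norm s u\<^sub>1))))"
proof (intro allI impI)
  fix T :: real
  assume "ereal T > ereal (2 * pi) / asymptotic_gap (eigenfreq b) J"
  note gaps = riesz_lower_of_gaps[OF J gap this]
  have T: "0 < T" by (rule gaps(1))
  let ?M = "lebesgue_on {0..T}" and ?\<mu> = "eigenfreq b"
  interpret M: finite_measure ?M by (rule finite_measure_lebesgue_on)
  obtain c where c: "0 < c" "\<And>F a. finite F \<Longrightarrow> F \<subseteq> range ?\<mu> \<Longrightarrow>
     c * (\<Sum>l\<in>F. (cmod (a l))\<^sup>2) \<le> integral {0..T} (\<lambda>t. (cmod (expsum a F t))\<^sup>2)"
    using gaps(2) unfolding riesz_lower_def by blast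
  define Q where "Q = (2 * T + 4) / c\<^sup>2"
  have Q: "0 \<le> Q" using T by (simp add: Q_def)
  \<comment> \<open>One function is chosen per mode. Modes of equal frequency need not receive the
    same one, since only the moments and the common bound \<open>Q\<close> matter.\<close>
  have "\<forall>j. \<exists>q. q \<in> borel_measurable ?M \<and> integrable ?M (\<lambda>t. (cmod (q t))\<^sup>2) \<and> (\<integral>t. (cmod (q t))\<^sup>2 \<partial>?M) \<le> Q \<and>
    (\<forall>l\<in>range ?\<mu>. (\<integral>t. q t * cis (- (l * t)) \<partial>?M) = (if l = ?\<mu> j then 1 else 0))"
    unfolding Q_def by (intro allI dual_function_ex[OF T c] rangeI)
  from choice[OF this] obtain q where q': "\<forall>j. q j \<in> borel_measurable ?M \<and> integrable ?M (\<lambda>t. (cmod (q j t))\<^sup>2) \<and>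
    (\<integral>t. (cmod (q j t))\<^sup>2 \<partial>?M) \<le> Q \<and>
    (\<forall>l\<in>range ?\<mu>. (\<integral>t. q j t * cis (- (l * t)) \<partial>?M) = (if l = ?\<mu> j then 1 else 0))" ..
  note qj = q'[THEN spec]
  note q = qj[THEN conjunct1] qj[THEN conjunct2, THEN conjunct1] qj[THEN conjunct2, THEN conjunct2, THEN conjunct1]
    qj[THEN conjunct2, THEN conjunct2, THEN conjunct2, THEN bspec]
  have qi: "integrable ?M (q j)" for j
  proof -
    have "integrable ?M (\<lambda>t. cmod (q j t))"
      by (rule M.square_integrable_imp_integrable[OF measurable_compose[OF q(1) borel_measurable_norm] q(2)])
    then show ?thesis by (rule integrable_norm_iff[OF q(1), THEN iffD1])
  qed
  \<comment> \<open>\<open>sqrt Q\<close> bounds the biorthogonal functions, \<open>4 * pi^2\<close>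
    inverts the blocks and 3 comes from combining coefficients with reflected ones; the summand 1
    makes the constant positive from \<open>0 \<le> Q\<close> alone.\<close>
  define \<nu> where "\<nu> = sqrt Q * (3 * (4 * pi\<^sup>2)) + 1"
  show "\<exists>\<nu>>0. \<forall>g\<^sub>2. control_profile g\<^sub>2 \<longrightarrow>
      (\<forall>u\<^sub>0\<in>sobolev s. \<forall>u\<^sub>1\<in>sobolev s. fourier_coeff u\<^sub>0 (0, 0) = fourier_coeff u\<^sub>1 (0, 0) \<longrightarrow>
        (\<exists>h\<in>L2_sobolev s T.
          (\<exists>u. mild_solution s b g\<^sub>1 g\<^sub>2 T u\<^sub>0 h u \<and>
               (\<forall>v. mild_solution s b g\<^sub>1 g\<^sub>2 T u\<^sub>0 h v \<longrightarrow> (\<forall>t\<in>{0..T}. v t = u t)) \<and>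
               u T = u\<^sub>1) \<and>
          L2_sobolev_norm s T h \<le> \<nu> * (sobolev_norm s u\<^sub>0 + sobolev_norm s u\<^sub>1)))"
  proof (intro exI[of _ \<nu>] conjI allI impI ballI)
    show "0 < \<nu>" using Q by (simp add: \<nu>_def add_nonneg_pos)
    fix g\<^sub>2 u\<^sub>0 u\<^sub>1
    assume g2: "control_profile g\<^sub>2" and u0: "u\<^sub>0 \<in> sobolev s" and u1: "u\<^sub>1 \<in> sobolev s"
      and mean: "fourier_coeff u\<^sub>0 (0, 0) = fourier_coeff u\<^sub>1 (0, 0)"
    \<comment> \<open>Solving the requirement on the final state for the time integral in Duhamel's
      formula, one coefficient at a time, prescribes these moments.\<close>
    define d where "d k = cis (- (?\<mu> k * T)) * fourier_coeff u\<^sub>1 k - fourier_coeff u\<^sub>0 k" for k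
    \<comment> \<open>The frequency at the origin is 0, so equal means give a vanishing datum there,
      as the solvability of the blocks demands.\<close>
    have "d (0, 0) = 0" using mean by (simp add: d_def eigenfreq_def)
    then obtain a where a: "\<And>k. resonant_block g\<^sub>1 a k = d k"
      "\<And>k. cmod (a k) \<le> 4 * pi\<^sup>2 * (cmod (d k) + cmod (d (reflect k)))"
      by (rule resonant_block_solvable[OF g1]) (rule that)
    have d_le: "cmod (d k) \<le> cmod (fourier_coeff u\<^sub>1 k) + cmod (fourier_coeff u\<^sub>0 k)" for k
      unfolding d_def by (rule order_trans[OF norm_triangle_ineq4]) (simp add: norm_mult)
    have a_le: "cmod (a k) \<le> 4 * pi\<^sup>2 * (cmod (fourier_coeff u\<^sub>1 k) + cmod (fourier_coeff u\<^sub>0 k)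
        + (cmod (fourier_coeff u\<^sub>1 (reflect k)) + cmod (fourier_coeff u\<^sub>0 (reflect k))))" for k
      by (rule order_trans[OF a(2)]) (intro mult_left_mono add_mono d_le, simp)
    obtain \<alpha> where \<alpha>: "\<alpha> \<in> sobolev s" "\<And>k. fourier_coeff \<alpha> k = a k"
      "sobolev_norm s \<alpha> \<le> 3 * (4 * pi\<^sup>2) * (sobolev_norm s u\<^sub>0 + sobolev_norm s u\<^sub>1)"
      using sobolev_reflected_combination[OF s u0 u1 _ a_le] by auto
    obtain h where h: "\<And>t. h t \<in> sobolev s" "\<And>k. (\<lambda>t. fourier_coeff (h t) k) \<in> borel_measurable ?M"
      "\<And>k. AE t in ?M. fourier_coeff (h t) k = a k * q k t"
      "(\<integral>\<^sup>+t. ennreal ((sobolev_norm s (h t))\<^sup>2) \<partial>?M) \<le> ennreal (Q * (sobolev_norm s \<alpha>)\<^sup>2)"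
      using modulated_field_ex[OF s \<alpha>(1), where p = q and M = ?M and Q = Q, OF q(1,2,3) Q] unfolding \<alpha>(2) by blast
    have nm: "(\<lambda>t. sobolev_norm s (h t)) \<in> borel_measurable ?M"
      by (rule borel_measurable_sobolev_norm[OF h(1,2)])
    have fin: "(\<integral>\<^sup>+t. ennreal ((sobolev_norm s (h t))\<^sup>2) \<partial>?M) < \<infinity>"
      by (rule le_less_trans[OF h(4)]) simp
    have "integrable ?M (\<lambda>t. (sobolev_norm s (h t))\<^sup>2)"
      using nm fin by (intro integrableI_bounded) auto
    then have hi: "integrable ?M (\<lambda>t. sobolev_norm s (h t))"
      by (rule M.square_integrable_imp_integrable[OF nm])
    have data: "control_data s T g\<^sub>1 g\<^sub>2 u\<^sub>0 h"
      using s T g1 g2 u0 h(1,2) hi by unfold_locales auto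
    obtain u where u: "mild_solution s b g\<^sub>1 g\<^sub>2 T u\<^sub>0 h u"
      "\<And>v. mild_solution s b g\<^sub>1 g\<^sub>2 T u\<^sub>0 h v \<Longrightarrow> \<forall>t\<in>{0..T}. v t = u t"
      "\<And>t k. t \<in> {0..T} \<Longrightarrow> fourier_coeff (u t) k = cis (?\<mu> k * t) *
         (fourier_coeff u\<^sub>0 k + (\<integral>r. cis (- (?\<mu> k * r)) * fourier_coeff (G_op g\<^sub>1 g\<^sub>2 (h r)) k \<partial>lebesgue_on {0..t}))"
      by (rule control_data.mild_solution_exists_unique[OF data, of b]) (rule that)
    have "u T = u\<^sub>1"
    proof (rule distribution_eqI)
      fix k
      have "(\<integral>r. cis (- (?\<mu> k * r)) * fourier_coeff (G_op g\<^sub>1 g\<^sub>2 (h r)) k \<partial>?M) = d k"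
        unfolding a(1)[symmetric] using q(4)[of "?\<mu> k"]
        by (intro control_moment[OF data qi _ h(3) ii iii]) auto
      then have "fourier_coeff (u T) k = cis (?\<mu> k * T) * (cis (- (?\<mu> k * T)) * fourier_coeff u\<^sub>1 k)"
        using T by (simp add: u(3) d_def)
      also have "\<dots> = fourier_coeff u\<^sub>1 k"
        by (simp only: mult.assoc[symmetric] cis_mult) simp
      finally show "fourier_coeff (u T) k = fourier_coeff u\<^sub>1 k" .
    qed
    moreover have "h \<in> L2_sobolev s T"
      unfolding L2_sobolev_def using fin sobolev_measurableI[OF s h(1,2)] by simp
    moreover have "L2_sobolev_norm s T h \<le> \<nu> * (sobolev_norm s u\<^sub>0 + sobolev_norm s u\<^sub>1)"
    proof -
      let ?N = "sobolev_norm s u\<^sub>0 + sobolev_norm s u\<^sub>1"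
      have N: "0 \<le> ?N" using sobolev_norm_nonneg by (intro add_nonneg_nonneg)
      have "(\<integral>t. (sobolev_norm s (h t))\<^sup>2 \<partial>?M) \<le> Q * (sobolev_norm s \<alpha>)\<^sup>2"
        using h(4) Q nm by (subst integral_eq_nn_integral) (auto intro!: enn2real_leI mult_nonneg_nonneg)
      then have "L2_sobolev_norm s T h \<le> sqrt (Q * (sobolev_norm s \<alpha>)\<^sup>2)"
        unfolding L2_sobolev_norm_def by simp
      also have "\<dots> = sqrt Q * sobolev_norm s \<alpha>"
        using sobolev_norm_nonneg by (simp add: real_sqrt_mult)
      also have "\<dots> \<le> sqrt Q * (3 * (4 * pi\<^sup>2) * ?N)"
        using Q by (intro mult_left_mono \<alpha>(3)) simp
      also have "\<dots> \<le> \<nu> * ?N"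
        using N by (simp add: \<nu>_def algebra_simps)
      finally show ?thesis .
    qed
    ultimately show "\<exists>h\<in>L2_sobolev s T.
          (\<exists>u. mild_solution s b g\<^sub>1 g\<^sub>2 T u\<^sub>0 h u \<and>
               (\<forall>v. mild_solution s b g\<^sub>1 g\<^sub>2 T u\<^sub>0 h v \<longrightarrow> (\<forall>t\<in>{0..T}. v t = u t)) \<and>
               u T = u\<^sub>1) \<and>
          L2_sobolev_norm s T h \<le> \<nu> * (sobolev_norm s u\<^sub>0 + sobolev_norm s u\<^sub>1)"
      using u(1,2) by blast
  qed
qed

end
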